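(* Let $A$ be a local ring with residue field $k$. If a finite direct sum of syzygy modules of $k$ maps onto a non-zero maximal Cohen-Macaulay $A$-module $L$ of finite injective dimension (that is, there is a surjective $A$-module homomorphism $\bigoplus_{n\in\Lambda}\left(\Omega_n^A(k)\right)^{j_n}\to L$ with $\Lambda$ a finite collection of non-negative integers and $j_n\ge1$ for each $n\in\Lambda$), then $A$ is regular.
   Context: All rings are commutative Noetherian with identity. For $n\ge0$, $\Omega_n^A(k)$ denotes the $n$th syzygy module of $k$ in a minimal free resolution of $k$ over $A$, with $\Omega_0^A(k)=k$. *)

theory Defs
  imports "HOL-Algebra.Algebra" "HOL-Library.Extended_Nat"
begin

section \<open>Modules\<close>

definition hom_module ::
    "('a, 'r) ring_scheme \<Rightarrow> ('a, 'b, 'm) module_scheme \<Rightarrow> ('a, 'c, 'n) module_scheme \<Rightarrow> ('b \<Rightarrow> 'c) set"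
  where "hom_module R M N =
    {f \<in> carrier M \<rightarrow> carrier N.
       (\<forall>x\<in>carrier M. \<forall>y\<in>carrier M. f (x \<oplus>\<^bsub>M\<^esub> y) = f x \<oplus>\<^bsub>N\<^esub> f y) \<and>
       (\<forall>a\<in>carrier R. \<forall>x\<in>carrier M. f (a \<odot>\<^bsub>M\<^esub> x) = a \<odot>\<^bsub>N\<^esub> f x)}"

definition module_isomorphic ::
    "('a, 'r) ring_scheme \<Rightarrow> ('a, 'b, 'm) module_scheme \<Rightarrow> ('a, 'c, 'n) module_scheme \<Rightarrow> bool"
  where "module_isomorphic R M N \<longleftrightarrow>
    (\<exists>f\<in>hom_module R M N. bij_betw f (carrier M) (carrier N))"

definition module_ker ::
    "('a, 'b, 'm) module_scheme \<Rightarrow> ('a, 'c, 'n) module_scheme \<Rightarrow> ('b \<Rightarrow> 'c) \<Rightarrow> 'b set"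
  where "module_ker M N f = {x \<in> carrier M. f x = \<zero>\<^bsub>N\<^esub>}"

definition gen_submodule ::
    "('a, 'r) ring_scheme \<Rightarrow> ('a, 'b, 'm) module_scheme \<Rightarrow> 'b set \<Rightarrow> 'b set"
  where "gen_submodule R M S = \<Inter>{H. submodule H R M \<and> S \<subseteq> H}"

definition finitely_generated_module ::
    "('a, 'r) ring_scheme \<Rightarrow> ('a, 'b, 'm) module_scheme \<Rightarrow> bool"
  where "finitely_generated_module R M \<longleftrightarrow> module R M \<and>
    (\<exists>S. finite S \<and> S \<subseteq> carrier M \<and> gen_submodule R M S = carrier M)"

definition finite_free_module ::
    "('a, 'r) ring_scheme \<Rightarrow> ('a, 'b, 'm) module_scheme \<Rightarrow> bool"
  where "finite_free_module R M \<longleftrightarrow> module R M \<and>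
    (\<exists>B. finite B \<and> B \<subseteq> carrier M \<and>
       (\<forall>x\<in>carrier M. \<exists>!c. c \<in> B \<rightarrow>\<^sub>E carrier R \<and> x = (\<Oplus>\<^bsub>M\<^esub>b\<in>B. c b \<odot>\<^bsub>M\<^esub> b)))"

text \<open>The submodule \<open>I M\<close> of \<open>M\<close>.\<close>

definition ideal_smult ::
    "('a, 'r) ring_scheme \<Rightarrow> 'a set \<Rightarrow> ('a, 'b, 'm) module_scheme \<Rightarrow> 'b set"
  where "ideal_smult R I M = gen_submodule R M {a \<odot>\<^bsub>M\<^esub> x | a x. a \<in> I \<and> x \<in> carrier M}"

text \<open>The record fields \<^term>\<open>monoid.mult\<close> and \<^term>\<open>one\<close> play no role in the locale \<^locale>\<open>module\<close>;
  they are left unspecified in the direct sum.\<close>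

definition direct_sum :: "'i set \<Rightarrow> ('i \<Rightarrow> ('a, 'b, 'm) module_scheme) \<Rightarrow> ('a, 'i \<Rightarrow> 'b) module"
  where "direct_sum I M =
    (let G = sum_group I (\<lambda>i. add_monoid (M i)) in
     \<lparr>carrier = carrier G, monoid.mult = undefined, one = undefined,
      ring.zero = \<one>\<^bsub>G\<^esub>, add = (\<otimes>\<^bsub>G\<^esub>), smult = (\<lambda>a f. \<lambda>i\<in>I. a \<odot>\<^bsub>M i\<^esub> f i)\<rparr>)"

lemma direct_sum_module:
  assumes R: "cring R" and M: "\<And>i. i \<in> I \<Longrightarrow> module R (M i)"
  shows "module R (direct_sum I M)"
proof -
  have ab: "abelian_group (M i)" if "i \<in> I" for i using M[OF that] by (simp add: module_def)
  have gr: "group (add_monoid (M i))" if "i \<in> I" for i using ab[OF that] by (simp add: abelian_group.a_group)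
  let ?G = "sum_group I (\<lambda>i. add_monoid (M i))"
  interpret G: group ?G by (rule sum_group) (rule gr)
  have simps: "carrier (direct_sum I M) = carrier ?G" "(\<oplus>\<^bsub>direct_sum I M\<^esub>) = (\<otimes>\<^bsub>?G\<^esub>)"
    "\<zero>\<^bsub>direct_sum I M\<^esub> = \<one>\<^bsub>?G\<^esub>" "\<And>a f. a \<odot>\<^bsub>direct_sum I M\<^esub> f = (\<lambda>i\<in>I. a \<odot>\<^bsub>M i\<^esub> f i)"
    by (simp_all add: direct_sum_def Let_def del: mult_sum_group one_sum_group)
  have car: "f \<in> carrier ?G \<longleftrightarrow> f \<in> (\<Pi>\<^sub>E i\<in>I. carrier (M i)) \<and> finite {i \<in> I. f i \<noteq> \<zero>\<^bsub>M i\<^esub>}" for f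
    using gr by (subst carrier_sum_group) auto
  have pt: "f i \<in> carrier (M i)" if "f \<in> carrier ?G" "i \<in> I" for f i using that unfolding car by auto
  have ext: "f \<in> extensional I" if "f \<in> carrier ?G" for f using that unfolding car PiE_def by auto
  show ?thesis
  proof (rule moduleI[OF R])
    show "abelian_group (direct_sum I M)"
    proof (rule abelian_groupI; unfold simps)
      fix x y assume xy: "x \<in> carrier ?G" "y \<in> carrier ?G"
      have "x i \<oplus>\<^bsub>M i\<^esub> y i = y i \<oplus>\<^bsub>M i\<^esub> x i" if "i \<in> I" for i
        using that xy pt ab by (meson abelian_group.axioms(1) abelian_monoid.a_comm)
      then show "x \<otimes>\<^bsub>?G\<^esub> y = y \<otimes>\<^bsub>?G\<^esub> x" by (auto simp: restrict_def)
    qed (assumption | rule G.m_closed G.one_closed G.m_assoc G.l_one G.l_inv_ex)+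
  next
    fix a f assume a: "a \<in> carrier R" and f: "f \<in> carrier (direct_sum I M)"
    have sub: "{i \<in> I. (\<lambda>i\<in>I. a \<odot>\<^bsub>M i\<^esub> f i) i \<noteq> \<zero>\<^bsub>M i\<^esub>} \<subseteq> {i \<in> I. f i \<noteq> \<zero>\<^bsub>M i\<^esub>}"
      using module.smult_r_null[OF M a] by auto
    show "a \<odot>\<^bsub>direct_sum I M\<^esub> f \<in> carrier (direct_sum I M)"
      using f finite_subset[OF sub] module.smult_closed[OF M a] unfolding simps car by auto
  next
    fix a b f assume "a \<in> carrier R" "b \<in> carrier R" "f \<in> carrier (direct_sum I M)"
    then show "(a \<oplus>\<^bsub>R\<^esub> b) \<odot>\<^bsub>direct_sum I M\<^esub> f =
        (a \<odot>\<^bsub>direct_sum I M\<^esub> f) \<oplus>\<^bsub>direct_sum I M\<^esub> (b \<odot>\<^bsub>direct_sum I M\<^esub> f)"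
      and "(a \<otimes>\<^bsub>R\<^esub> b) \<odot>\<^bsub>direct_sum I M\<^esub> f = a \<odot>\<^bsub>direct_sum I M\<^esub> (b \<odot>\<^bsub>direct_sum I M\<^esub> f)"
      by (auto simp: simps pt module.smult_l_distr[OF M] module.smult_assoc1[OF M] intro!: restrict_ext)
  next
    fix a f g assume "a \<in> carrier R" "f \<in> carrier (direct_sum I M)" "g \<in> carrier (direct_sum I M)"
    then show "a \<odot>\<^bsub>direct_sum I M\<^esub> (f \<oplus>\<^bsub>direct_sum I M\<^esub> g) =
        (a \<odot>\<^bsub>direct_sum I M\<^esub> f) \<oplus>\<^bsub>direct_sum I M\<^esub> (a \<odot>\<^bsub>direct_sum I M\<^esub> g)"
      by (auto simp: simps pt module.smult_r_distr[OF M] intro!: restrict_ext)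
  next
    fix f assume f: "f \<in> carrier (direct_sum I M)"
    then have "\<one>\<^bsub>R\<^esub> \<odot>\<^bsub>direct_sum I M\<^esub> f = restrict f I"
      by (auto simp: simps pt module.smult_one[OF M] intro!: restrict_ext)
    also have "\<dots> = f" using ext f by (simp add: simps extensional_restrict)
    finally show "\<one>\<^bsub>R\<^esub> \<odot>\<^bsub>direct_sum I M\<^esub> f = f" .
  qed
qed

definition ring_as_module :: "('a, 'r) ring_scheme \<Rightarrow> ('a, 'a) module"
  where "ring_as_module R =
    \<lparr>carrier = carrier R, monoid.mult = (\<otimes>\<^bsub>R\<^esub>), one = \<one>\<^bsub>R\<^esub>,
     ring.zero = \<zero>\<^bsub>R\<^esub>, add = (\<oplus>\<^bsub>R\<^esub>), smult = (\<otimes>\<^bsub>R\<^esub>)\<rparr>"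

lemma ring_as_module_simps [simp]:
  "carrier (ring_as_module R) = carrier R" "\<zero>\<^bsub>ring_as_module R\<^esub> = \<zero>\<^bsub>R\<^esub>"
  "x \<oplus>\<^bsub>ring_as_module R\<^esub> y = x \<oplus>\<^bsub>R\<^esub> y" "x \<odot>\<^bsub>ring_as_module R\<^esub> y = x \<otimes>\<^bsub>R\<^esub> y"
  by (simp_all add: ring_as_module_def)

lemma ring_as_module_is_module:
  assumes "cring R" shows "module R (ring_as_module R)"
proof -
  interpret cring R by fact
  show ?thesis
  proof (rule moduleI)
    show "abelian_group (ring_as_module R)"
      by (rule abelian_groupI) (auto simp: a_assoc intro: a_comm l_neg bexI[of _ "\<ominus>\<^bsub>R\<^esub> x" for x])
  qed (auto simp: cring_axioms l_distr r_distr m_assoc)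
qed


section \<open>Local rings\<close>

definition noetherian_local_ring :: "('a, 'r) ring_scheme \<Rightarrow> bool"
  where "noetherian_local_ring R \<longleftrightarrow>
    cring R \<and> noetherian_ring R \<and> (\<exists>!\<mm>. maximalideal \<mm> R)"

definition max_ideal :: "('a, 'r) ring_scheme \<Rightarrow> 'a set"
  where "max_ideal R = (THE \<mm>. maximalideal \<mm> R)"

definition residue_field :: "('a, 'r) ring_scheme \<Rightarrow> ('a, 'a set) module"
  where "residue_field R =
    ring.extend (R Quot max_ideal R)
      (module.fields (\<lambda>a c. (max_ideal R +>\<^bsub>R\<^esub> a) \<otimes>\<^bsub>R Quot max_ideal R\<^esub> c))"

lemma residue_field_module:
  assumes "noetherian_local_ring R" shows "module R (residue_field R)"
proof -
  interpret cring R using assms by (simp add: noetherian_local_ring_def)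
  have "maximalideal (max_ideal R) R"
    using assms theI'[of "\<lambda>m. maximalideal m R"] unfolding noetherian_local_ring_def max_ideal_def by blast
  then interpret m: maximalideal "max_ideal R" R .
  interpret Q: cring "R Quot max_ideal R" by (rule m.quotient_is_cring) (rule cring_axioms)
  let ?h = "\<lambda>a. max_ideal R +>\<^bsub>R\<^esub> a"
  have h: "?h \<in> ring_hom R (R Quot max_ideal R)" by (rule m.rcos_ring_hom)
  note hs = ring_hom_closed[OF h] ring_hom_mult[OF h] ring_hom_add[OF h] ring_hom_one[OF h]
  have simps: "carrier (residue_field R) = carrier (R Quot max_ideal R)"
    "\<And>x y. x \<oplus>\<^bsub>residue_field R\<^esub> y = x \<oplus>\<^bsub>R Quot max_ideal R\<^esub> y"
    "\<zero>\<^bsub>residue_field R\<^esub> = \<zero>\<^bsub>R Quot max_ideal R\<^esub>"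
    "\<And>a x. a \<odot>\<^bsub>residue_field R\<^esub> x = ?h a \<otimes>\<^bsub>R Quot max_ideal R\<^esub> x"
    by (simp_all add: residue_field_def ring.defs module.defs)
  show ?thesis
  proof (rule moduleI)
    show "abelian_group (residue_field R)"
      by (rule abelian_groupI) (auto simp: simps Q.a_assoc intro!: Q.a_comm intro: Q.l_neg bexI[of _ "\<ominus>\<^bsub>R Quot max_ideal R\<^esub> x" for x])
  qed (auto simp: cring_axioms simps hs Q.l_distr Q.r_distr Q.m_assoc)
qed

text \<open>Krull dimension of \<open>R/I\<close>: the supremum of the lengths of chains of primes containing \<open>I\<close>.\<close>

definition krull_dim_over :: "('a, 'r) ring_scheme \<Rightarrow> 'a set \<Rightarrow> enat"
  where "krull_dim_over R I =
    Sup {enat n | n. \<exists>P. (\<forall>i\<le>n. primeideal (P i) R \<and> I \<subseteq> P i) \<and> (\<forall>i<n. P i \<subset> P (Suc i))}"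

definition krull_dim :: "('a, 'r) ring_scheme \<Rightarrow> enat"
  where "krull_dim R = krull_dim_over R {\<zero>\<^bsub>R\<^esub>}"

definition embedding_dim :: "('a, 'r) ring_scheme \<Rightarrow> nat"
  where "embedding_dim R =
    (LEAST n. \<exists>S. finite S \<and> card S = n \<and> S \<subseteq> carrier R \<and> Idl\<^bsub>R\<^esub> S = max_ideal R)"

definition regular_local_ring :: "('a, 'r) ring_scheme \<Rightarrow> bool"
  where "regular_local_ring R \<longleftrightarrow>
    noetherian_local_ring R \<and> enat (embedding_dim R) = krull_dim R"


section \<open>Maximal Cohen--Macaulay modules\<close>

definition annihilator :: "('a, 'r) ring_scheme \<Rightarrow> ('a, 'b, 'm) module_scheme \<Rightarrow> 'a set"
  where "annihilator R M = {a \<in> carrier R. \<forall>x\<in>carrier M. a \<odot>\<^bsub>M\<^esub> x = \<zero>\<^bsub>M\<^esub>}"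

definition module_dim :: "('a, 'r) ring_scheme \<Rightarrow> ('a, 'b, 'm) module_scheme \<Rightarrow> enat"
  where "module_dim R M = krull_dim_over R (annihilator R M)"

text \<open>In a regular sequence \<open>x\<^sub>0, \<dots>, x\<^sub>r\<close> each \<open>x\<^sub>i\<close> is a non-zero-divisor on the quotient
  \<open>M / (x\<^sub>0, \<dots>, x\<^bsub>i-1\<^esub>) M\<close>; this is spelled out below on representatives.\<close>

definition regular_sequence ::
    "('a, 'r) ring_scheme \<Rightarrow> ('a, 'b, 'm) module_scheme \<Rightarrow> 'a list \<Rightarrow> bool"
  where "regular_sequence R M xs \<longleftrightarrow> set xs \<subseteq> carrier R \<and>
    (\<forall>i<length xs. \<forall>y\<in>carrier M.
       xs ! i \<odot>\<^bsub>M\<^esub> y \<in> ideal_smult R (Idl\<^bsub>R\<^esub> (set (take i xs))) M \<longrightarrow>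
       y \<in> ideal_smult R (Idl\<^bsub>R\<^esub> (set (take i xs))) M) \<and>
    ideal_smult R (Idl\<^bsub>R\<^esub> (set xs)) M \<noteq> carrier M"

definition depth :: "('a, 'r) ring_scheme \<Rightarrow> ('a, 'b, 'm) module_scheme \<Rightarrow> enat"
  where "depth R M =
    Sup {enat (length xs) | xs. set xs \<subseteq> max_ideal R \<and> regular_sequence R M xs}"

text \<open>\<^term>\<open>depth\<close> and \<^term>\<open>module_dim\<close> carry their usual meaning for non-zero modules only.\<close>

definition maximal_cohen_macaulay ::
    "('a, 'r) ring_scheme \<Rightarrow> ('a, 'b, 'm) module_scheme \<Rightarrow> bool"
  where "maximal_cohen_macaulay R M \<longleftrightarrow>
    finitely_generated_module R M \<and> depth R M = module_dim R M \<and> module_dim R M = krull_dim R"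


section \<open>Injective dimension\<close>

text \<open>A definition cannot quantify over all types, so the test modules \<open>M\<close> range over modules whose
  elements are of the type of the ring. These include all ideals, so by Baer's criterion nothing
  is lost: theorem \<open>injective_module_extend\<close> below gives the extension property with
  respect to modules on every type.\<close>

definition injective_module ::
    "('a, 'r) ring_scheme \<Rightarrow> ('a, 'e, 'm) module_scheme \<Rightarrow> bool"
  where "injective_module R E \<longleftrightarrow> module R E \<and>
    (\<forall>(M :: ('a, 'a) module) N f. module R M \<and> submodule N R M \<and> f \<in> hom_module R (M\<lparr>carrier := N\<rparr>) E \<longrightarrow>
       (\<exists>g\<in>hom_module R M E. \<forall>x\<in>N. g x = f x))"

theorem injective_module_extend:
  fixes M :: "('a, 'b, 'm) module_scheme"
  assumes inj: "injective_module R E" and M: "module R M" and N: "submodule N R M"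
    and f: "f \<in> hom_module R (M\<lparr>carrier := N\<rparr>) E"
  shows "\<exists>g\<in>hom_module R M E. \<forall>x\<in>N. g x = f x"
proof -
  interpret M: module R M by fact
  interpret E: module R E using inj by (simp add: injective_module_def)
  interpret N: submodule N R M by fact
  have NM: "N \<subseteq> carrier M" using N.subset by simp
  have f_in: "f x \<in> carrier E" if "x \<in> N" for x using f that by (auto simp: hom_module_def)
  have f_add: "f (x \<oplus>\<^bsub>M\<^esub> y) = f x \<oplus>\<^bsub>E\<^esub> f y" if "x \<in> N" "y \<in> N" for x y
    using f that by (auto simp: hom_module_def)
  have f_smult: "f (a \<odot>\<^bsub>M\<^esub> x) = a \<odot>\<^bsub>E\<^esub> f x" if "a \<in> carrier R" "x \<in> N" for a x
    using f that by (auto simp: hom_module_def)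
  have f0: "f \<zero>\<^bsub>M\<^esub> = \<zero>\<^bsub>E\<^esub>"
    using f_smult[of "\<zero>\<^bsub>R\<^esub>" "\<zero>\<^bsub>M\<^esub>"] f_in[of "\<zero>\<^bsub>M\<^esub>"] N.one_closed by simp
  define P where "P G \<longleftrightarrow> G \<subseteq> carrier M \<times> carrier E \<and> (\<lambda>x. (x, f x)) ` N \<subseteq> G \<and>
    (\<forall>x y x' y'. (x, y) \<in> G \<longrightarrow> (x', y') \<in> G \<longrightarrow> (x \<oplus>\<^bsub>M\<^esub> x', y \<oplus>\<^bsub>E\<^esub> y') \<in> G) \<and>
    (\<forall>a x y. a \<in> carrier R \<longrightarrow> (x, y) \<in> G \<longrightarrow> (a \<odot>\<^bsub>M\<^esub> x, a \<odot>\<^bsub>E\<^esub> y) \<in> G) \<and>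
    (\<forall>y. (\<zero>\<^bsub>M\<^esub>, y) \<in> G \<longrightarrow> y = \<zero>\<^bsub>E\<^esub>)" for G
  have P_car: "x \<in> carrier M" "y \<in> carrier E" if "P G" "(x, y) \<in> G" for G x y
    using that unfolding P_def by blast+
  have P_add: "(x \<oplus>\<^bsub>M\<^esub> x', y \<oplus>\<^bsub>E\<^esub> y') \<in> G" if "P G" "(x, y) \<in> G" "(x', y') \<in> G" for G x y x' y'
    using that unfolding P_def by blast
  have P_smult: "(a \<odot>\<^bsub>M\<^esub> x, a \<odot>\<^bsub>E\<^esub> y) \<in> G" if "P G" "a \<in> carrier R" "(x, y) \<in> G" for G a x y
    using that unfolding P_def by blast
  have P_0: "y = \<zero>\<^bsub>E\<^esub>" if "P G" "(\<zero>\<^bsub>M\<^esub>, y) \<in> G" for G y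
    using that unfolding P_def by blast
  have P_f: "(x, f x) \<in> G" if "P G" "x \<in> N" for G x
    using that unfolding P_def by blast
  have P_neg: "(\<ominus>\<^bsub>M\<^esub> x, \<ominus>\<^bsub>E\<^esub> y) \<in> G" if "P G" "(x, y) \<in> G" for G x y
    using P_smult[OF that(1) _ that(2), of "\<ominus>\<^bsub>R\<^esub> \<one>\<^bsub>R\<^esub>"] P_car[OF that]
    by (simp add: M.smult_l_minus E.smult_l_minus)
  have P_fun: "y = y'" if "P G" "(x, y) \<in> G" "(x, y') \<in> G" for G x y y'
  proof -
    have "(x \<oplus>\<^bsub>M\<^esub> \<ominus>\<^bsub>M\<^esub> x, y \<oplus>\<^bsub>E\<^esub> \<ominus>\<^bsub>E\<^esub> y') \<in> G"
      using P_add P_neg that by blast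
    then have "y \<oplus>\<^bsub>E\<^esub> \<ominus>\<^bsub>E\<^esub> y' = \<zero>\<^bsub>E\<^esub>"
      using P_0 that P_car by (simp add: M.M.r_neg)
    then show ?thesis
      using P_car that by (metis E.M.minus_equality E.M.add.inv_closed E.M.minus_minus E.M.a_comm)
  qed
  have P_graph: "P ((\<lambda>x. (x, f x)) ` N)"
    unfolding P_def using NM f_in f_add f_smult f0 N.m_closed N.smult_closed by auto
  have "\<exists>G\<in>{G. P G}. \<forall>H\<in>{G. P G}. G \<subseteq> H \<longrightarrow> H = G"
  proof (rule subset_Zorn_nonempty)
    show "{G. P G} \<noteq> {}" using P_graph by blast
    fix C assume "C \<noteq> {}" and C: "subset.chain {G. P G} C"
    then obtain G0 where G0: "G0 \<in> C" by blast
    have CP: "P G" if "G \<in> C" for G using C that by (auto simp: subset_chain_def)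
    have "P (\<Union>C)"
      unfolding P_def
    proof (intro conjI allI impI)
      show "\<Union>C \<subseteq> carrier M \<times> carrier E" using CP unfolding P_def by blast
      show "(\<lambda>x. (x, f x)) ` N \<subseteq> \<Union>C" using G0 CP P_f by blast
      show "(x \<oplus>\<^bsub>M\<^esub> x', y \<oplus>\<^bsub>E\<^esub> y') \<in> \<Union>C" if *: "(x, y) \<in> \<Union>C" "(x', y') \<in> \<Union>C" for x y x' y'
      proof -
        obtain G G' where G: "G \<in> C" "(x, y) \<in> G" "G' \<in> C" "(x', y') \<in> G'" using * by blast
        then have "G \<subseteq> G' \<or> G' \<subseteq> G" using C by (auto simp: subset_chain_def)
        then show ?thesis using G P_add CP by (metis UnionI subsetD)
      qed
      show "(a \<odot>\<^bsub>M\<^esub> x, a \<odot>\<^bsub>E\<^esub> y) \<in> \<Union>C" if "a \<in> carrier R" "(x, y) \<in> \<Union>C" for a x y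
        using that CP P_smult by blast
      show "y = \<zero>\<^bsub>E\<^esub>" if "(\<zero>\<^bsub>M\<^esub>, y) \<in> \<Union>C" for y
        using that CP P_0 by blast
    qed
    then show "\<Union>C \<in> {G. P G}" by simp
  qed
  then obtain G where G: "P G" and G_max: "\<And>H. P H \<Longrightarrow> G \<subseteq> H \<Longrightarrow> H = G" by blast
  have G00: "(\<zero>\<^bsub>M\<^esub>, \<zero>\<^bsub>E\<^esub>) \<in> G" using P_f[OF G, of "\<zero>\<^bsub>M\<^esub>"] N.one_closed f0 by simp
  have total: "\<exists>y. (x, y) \<in> G" if x: "x \<in> carrier M" for x
  proof -
    define J where "J = {a \<in> carrier R. \<exists>y. (a \<odot>\<^bsub>M\<^esub> x, y) \<in> G}"
    define \<psi> where "\<psi> a = (THE y. (a \<odot>\<^bsub>M\<^esub> x, y) \<in> G)" for a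
    have \<psi>: "\<psi> a = y" if "(a \<odot>\<^bsub>M\<^esub> x, y) \<in> G" for a y
      unfolding \<psi>_def using that P_fun[OF G] by blast
    have J_add: "(a \<oplus>\<^bsub>R\<^esub> b) \<in> J \<and> \<psi> (a \<oplus>\<^bsub>R\<^esub> b) = \<psi> a \<oplus>\<^bsub>E\<^esub> \<psi> b" if "a \<in> J" "b \<in> J" for a b
    proof -
      obtain y z where yz: "(a \<odot>\<^bsub>M\<^esub> x, y) \<in> G" "(b \<odot>\<^bsub>M\<^esub> x, z) \<in> G" and ab: "a \<in> carrier R" "b \<in> carrier R"
        using \<open>a \<in> J\<close> \<open>b \<in> J\<close> by (auto simp: J_def)
      have "((a \<oplus>\<^bsub>R\<^esub> b) \<odot>\<^bsub>M\<^esub> x, y \<oplus>\<^bsub>E\<^esub> z) \<in> G"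
        using P_add[OF G yz] ab x by (simp add: M.smult_l_distr)
      then show ?thesis using \<psi> yz ab by (auto simp: J_def)
    qed
    have J_smult: "(a \<otimes>\<^bsub>R\<^esub> b) \<in> J \<and> \<psi> (a \<otimes>\<^bsub>R\<^esub> b) = a \<odot>\<^bsub>E\<^esub> \<psi> b" if "a \<in> carrier R" "b \<in> J" for a b
    proof -
      obtain z where z: "(b \<odot>\<^bsub>M\<^esub> x, z) \<in> G" and b: "b \<in> carrier R"
        using \<open>b \<in> J\<close> by (auto simp: J_def)
      have "((a \<otimes>\<^bsub>R\<^esub> b) \<odot>\<^bsub>M\<^esub> x, a \<odot>\<^bsub>E\<^esub> z) \<in> G"
        using P_smult[OF G \<open>a \<in> carrier R\<close> z] that b x by (simp add: M.smult_assoc1)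
      then show ?thesis using \<psi> z that b by (auto simp: J_def)
    qed
    have J0: "\<zero>\<^bsub>R\<^esub> \<in> J" using G00 x by (auto simp: J_def)
    have JR: "J \<subseteq> carrier R" by (auto simp: J_def)
    interpret RM: module R "ring_as_module R" by (rule ring_as_module_is_module) (rule M.R.cring_axioms)
    have J_sub: "submodule J R (ring_as_module R)"
    proof (rule RM.submoduleI)
      fix a assume a: "a \<in> J"
      have "(\<ominus>\<^bsub>R\<^esub> \<one>\<^bsub>R\<^esub>) \<otimes>\<^bsub>R\<^esub> a \<in> J" using J_smult[of "\<ominus>\<^bsub>R\<^esub> \<one>\<^bsub>R\<^esub>" a] a by simp
      moreover have "\<ominus>\<^bsub>ring_as_module R\<^esub> a = (\<ominus>\<^bsub>R\<^esub> \<one>\<^bsub>R\<^esub>) \<otimes>\<^bsub>R\<^esub> a"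
        using RM.smult_l_minus[of "\<one>\<^bsub>R\<^esub>" a] a JR by auto
      ultimately show "\<ominus>\<^bsub>ring_as_module R\<^esub> a \<in> J" by simp
    qed (use J0 JR J_add J_smult in auto)
    have "\<psi> \<in> hom_module R (ring_as_module R\<lparr>carrier := J\<rparr>) E"
      using J_add J_smult P_car[OF G] \<psi> by (fastforce simp: hom_module_def J_def)
    then obtain h where h: "h \<in> hom_module R (ring_as_module R) E" "\<And>a. a \<in> J \<Longrightarrow> h a = \<psi> a"
      using inj J_sub RM.module_axioms unfolding injective_module_def by metis
    define e where "e = h \<one>\<^bsub>R\<^esub>"
    have e: "e \<in> carrier E" using h(1) by (auto simp: e_def hom_module_def)
    have h_e: "h a = a \<odot>\<^bsub>E\<^esub> e" if "a \<in> carrier R" for a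
    proof -
      have "\<forall>a\<in>carrier R. \<forall>x\<in>carrier R. h (a \<otimes>\<^bsub>R\<^esub> x) = a \<odot>\<^bsub>E\<^esub> h x"
        using h(1) by (simp add: hom_module_def)
      then have "h (a \<otimes>\<^bsub>R\<^esub> \<one>\<^bsub>R\<^esub>) = a \<odot>\<^bsub>E\<^esub> h \<one>\<^bsub>R\<^esub>"
        using that by blast
      then show ?thesis using that by (simp add: e_def)
    qed
    define H where "H = {(u \<oplus>\<^bsub>M\<^esub> a \<odot>\<^bsub>M\<^esub> x, y \<oplus>\<^bsub>E\<^esub> a \<odot>\<^bsub>E\<^esub> e) | u y a. (u, y) \<in> G \<and> a \<in> carrier R}"
    have HI: "(u \<oplus>\<^bsub>M\<^esub> a \<odot>\<^bsub>M\<^esub> x, y \<oplus>\<^bsub>E\<^esub> a \<odot>\<^bsub>E\<^esub> e) \<in> H" if "(u, y) \<in> G" "a \<in> carrier R" for u y a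
      using that by (auto simp: H_def)
    have GH: "G \<subseteq> H"
    proof
      fix p assume p: "p \<in> G"
      obtain u y where [simp]: "p = (u, y)" by (cases p)
      show "p \<in> H" using HI[of u y "\<zero>\<^bsub>R\<^esub>"] p P_car[OF G, of u y] x e by simp
    qed
    have "P H"
      unfolding P_def
    proof (intro conjI allI impI)
      show "H \<subseteq> carrier M \<times> carrier E" using P_car[OF G] x e by (auto simp: H_def)
      show "(\<lambda>x. (x, f x)) ` N \<subseteq> H" using GH P_f[OF G] by blast
    next
      fix p q p' q' assume "(p, q) \<in> H" "(p', q') \<in> H"
      then obtain u y a u' y' a' where *: "(u, y) \<in> G" "(u', y') \<in> G" "a \<in> carrier R" "a' \<in> carrier R"
        and [simp]: "p = u \<oplus>\<^bsub>M\<^esub> a \<odot>\<^bsub>M\<^esub> x" "q = y \<oplus>\<^bsub>E\<^esub> a \<odot>\<^bsub>E\<^esub> e"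
          "p' = u' \<oplus>\<^bsub>M\<^esub> a' \<odot>\<^bsub>M\<^esub> x" "q' = y' \<oplus>\<^bsub>E\<^esub> a' \<odot>\<^bsub>E\<^esub> e"
        unfolding H_def by blast
      have "p \<oplus>\<^bsub>M\<^esub> p' = (u \<oplus>\<^bsub>M\<^esub> u') \<oplus>\<^bsub>M\<^esub> (a \<oplus>\<^bsub>R\<^esub> a') \<odot>\<^bsub>M\<^esub> x"
        using * P_car[OF G] x by (simp add: M.smult_l_distr M.M.a_ac)
      moreover have "q \<oplus>\<^bsub>E\<^esub> q' = (y \<oplus>\<^bsub>E\<^esub> y') \<oplus>\<^bsub>E\<^esub> (a \<oplus>\<^bsub>R\<^esub> a') \<odot>\<^bsub>E\<^esub> e"
        using * P_car[OF G] e by (simp add: E.smult_l_distr E.M.a_ac)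
      ultimately show "(p \<oplus>\<^bsub>M\<^esub> p', q \<oplus>\<^bsub>E\<^esub> q') \<in> H"
        using HI[OF P_add[OF G *(1,2)], of "a \<oplus>\<^bsub>R\<^esub> a'"] *(3,4) by simp
    next
      fix b p q assume b: "b \<in> carrier R" and "(p, q) \<in> H"
      then obtain u y a where *: "(u, y) \<in> G" "a \<in> carrier R"
        and [simp]: "p = u \<oplus>\<^bsub>M\<^esub> a \<odot>\<^bsub>M\<^esub> x" "q = y \<oplus>\<^bsub>E\<^esub> a \<odot>\<^bsub>E\<^esub> e"
        unfolding H_def by blast
      have "b \<odot>\<^bsub>M\<^esub> p = b \<odot>\<^bsub>M\<^esub> u \<oplus>\<^bsub>M\<^esub> (b \<otimes>\<^bsub>R\<^esub> a) \<odot>\<^bsub>M\<^esub> x"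
        using * b P_car[OF G] x by (simp add: M.smult_r_distr M.smult_assoc1)
      moreover have "b \<odot>\<^bsub>E\<^esub> q = b \<odot>\<^bsub>E\<^esub> y \<oplus>\<^bsub>E\<^esub> (b \<otimes>\<^bsub>R\<^esub> a) \<odot>\<^bsub>E\<^esub> e"
        using * b P_car[OF G] e by (simp add: E.smult_r_distr E.smult_assoc1)
      ultimately show "(b \<odot>\<^bsub>M\<^esub> p, b \<odot>\<^bsub>E\<^esub> q) \<in> H"
        using HI[OF P_smult[OF G b *(1)], of "b \<otimes>\<^bsub>R\<^esub> a"] *(2) b by simp
    next
      fix q assume "(\<zero>\<^bsub>M\<^esub>, q) \<in> H"
      then obtain u y a where *: "(u, y) \<in> G" "a \<in> carrier R"
        and z: "\<zero>\<^bsub>M\<^esub> = u \<oplus>\<^bsub>M\<^esub> a \<odot>\<^bsub>M\<^esub> x" and q: "q = y \<oplus>\<^bsub>E\<^esub> a \<odot>\<^bsub>E\<^esub> e"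
        unfolding H_def by blast
      have u: "u \<in> carrier M" "y \<in> carrier E" using P_car[OF G *(1)] by auto
      have "\<ominus>\<^bsub>M\<^esub> u = a \<odot>\<^bsub>M\<^esub> x"
        using z[symmetric] u * x by (metis M.M.minus_equality M.M.a_comm M.smult_closed)
      then have "(a \<odot>\<^bsub>M\<^esub> x, \<ominus>\<^bsub>E\<^esub> y) \<in> G" using P_neg[OF G *(1)] by simp
      then have "\<psi> a = \<ominus>\<^bsub>E\<^esub> y" "a \<in> J" using \<psi> * by (auto simp: J_def)
      then have "a \<odot>\<^bsub>E\<^esub> e = \<ominus>\<^bsub>E\<^esub> y" using h(2) h_e * by metis
      then show "q = \<zero>\<^bsub>E\<^esub>" using q u by (simp add: E.M.r_neg)
    qed
    then have "H = G" using G_max GH by blast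
    moreover have "(x, e) \<in> H" using HI[OF G00, of "\<one>\<^bsub>R\<^esub>"] x e by simp
    ultimately show ?thesis by blast
  qed
  define g where "g x = (THE y. (x, y) \<in> G)" for x
  have g: "g x = y" if "(x, y) \<in> G" for x y
    unfolding g_def using that P_fun[OF G] by blast
  have gG: "(x, g x) \<in> G" if "x \<in> carrier M" for x using total[OF that] g by blast
  have "g (x \<oplus>\<^bsub>M\<^esub> y) = g x \<oplus>\<^bsub>E\<^esub> g y" if "x \<in> carrier M" "y \<in> carrier M" for x y
    using g P_add[OF G gG gG] that by blast
  moreover have "g (a \<odot>\<^bsub>M\<^esub> x) = a \<odot>\<^bsub>E\<^esub> g x" if "a \<in> carrier R" "x \<in> carrier M" for a x
    using g P_smult[OF G _ gG] that by blast
  moreover have "g x \<in> carrier E" if "x \<in> carrier M" for x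
    using P_car(2)[OF G gG] that by blast
  ultimately have "g \<in> hom_module R M E"
    by (simp add: hom_module_def)
  moreover have "\<forall>x\<in>N. g x = f x" using g P_f[OF G] by blast
  ultimately show ?thesis by blast
qed

text \<open>An injective resolution \<open>0 \<rightarrow> L \<rightarrow> I\<^sub>0 \<rightarrow> I\<^sub>1 \<rightarrow> \<dots>\<close> with augmentation \<open>\<eta>\<close> and
  differentials \<open>\<delta> i : I i \<rightarrow> I (i + 1)\<close>.\<close>

definition injective_resolution ::
    "('a, 'r) ring_scheme \<Rightarrow> ('a, 'b, 'm) module_scheme \<Rightarrow>
     (nat \<Rightarrow> ('a, 'e) module) \<Rightarrow> (nat \<Rightarrow> 'e \<Rightarrow> 'e) \<Rightarrow> ('b \<Rightarrow> 'e) \<Rightarrow> bool"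
  where "injective_resolution R L I \<delta> \<eta> \<longleftrightarrow>
    (\<forall>i. injective_module R (I i)) \<and>
    \<eta> \<in> hom_module R L (I 0) \<and> inj_on \<eta> (carrier L) \<and>
    (\<forall>i. \<delta> i \<in> hom_module R (I i) (I (Suc i))) \<and>
    \<eta> ` carrier L = module_ker (I 0) (I 1) (\<delta> 0) \<and>
    (\<forall>i. \<delta> i ` carrier (I i) = module_ker (I (Suc i)) (I (Suc (Suc i))) (\<delta> (Suc i)))"

text \<open>The first argument names the type on which the modules of the resolution live; in a theorem
  it should be a type variable of its own, so that resolutions of any size are covered.\<close>

definition finite_injective_dimension ::
    "'e itself \<Rightarrow> ('a, 'r) ring_scheme \<Rightarrow> ('a, 'b, 'm) module_scheme \<Rightarrow> bool"
  where "finite_injective_dimension T R L \<longleftrightarrow>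
    (\<exists>n (I :: nat \<Rightarrow> ('a, 'e) module) \<delta> \<eta>.
       injective_resolution R L I \<delta> \<eta> \<and> (\<forall>i>n. carrier (I i) = {\<zero>\<^bsub>I i\<^esub>}))"


section \<open>Minimal free resolutions and syzygies\<close>

text \<open>A minimal free resolution \<open>\<dots> \<rightarrow> F\<^sub>1 \<rightarrow> F\<^sub>0 \<rightarrow> M \<rightarrow> 0\<close> with augmentation \<open>\<epsilon>\<close> and
  differentials \<open>d i : F (i + 1) \<rightarrow> F i\<close>.\<close>

definition minimal_free_resolution ::
    "('a, 'r) ring_scheme \<Rightarrow> ('a, 'b, 'm) module_scheme \<Rightarrow>
     (nat \<Rightarrow> ('a, 'f) module) \<Rightarrow> (nat \<Rightarrow> 'f \<Rightarrow> 'f) \<Rightarrow> ('f \<Rightarrow> 'b) \<Rightarrow> bool"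
  where "minimal_free_resolution R M F d \<epsilon> \<longleftrightarrow>
    (\<forall>i. finite_free_module R (F i)) \<and>
    \<epsilon> \<in> hom_module R (F 0) M \<and> \<epsilon> ` carrier (F 0) = carrier M \<and>
    (\<forall>i. d i \<in> hom_module R (F (Suc i)) (F i)) \<and>
    d 0 ` carrier (F 1) = module_ker (F 0) M \<epsilon> \<and>
    (\<forall>i. d (Suc i) ` carrier (F (Suc (Suc i))) = module_ker (F (Suc i)) (F i) (d i)) \<and>
    (\<forall>i. d i ` carrier (F (Suc i)) \<subseteq> ideal_smult R (max_ideal R) (F i))"

text \<open>\<open>N\<close> is (a copy of) the \<open>n\<close>th syzygy module of \<open>M\<close> in the resolution \<open>(F, d)\<close>: \<open>M\<close> itself for
  \<open>n = 0\<close>, and the image of \<open>F n \<rightarrow> F (n - 1)\<close> otherwise. Working up to isomorphism allows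
  all syzygies, including \<open>M\<close>, to live on one type.\<close>

definition is_syzygy ::
    "('a, 'r) ring_scheme \<Rightarrow> ('a, 'b, 'm) module_scheme \<Rightarrow>
     (nat \<Rightarrow> ('a, 'f) module) \<Rightarrow> (nat \<Rightarrow> 'f \<Rightarrow> 'f) \<Rightarrow> nat \<Rightarrow> ('a, 'x, 'n) module_scheme \<Rightarrow> bool"
  where "is_syzygy R M F d n N \<longleftrightarrow> module R N \<and>
    (case n of
       0 \<Rightarrow> module_isomorphic R N M
     | Suc i \<Rightarrow> module_isomorphic R N ((F i)\<lparr>carrier := d i ` carrier (F (Suc i))\<rparr>))"

end

theory Submission
  imports Defs
begin

text \<open>Call \<open>J\<close> a regular ideal if it is generated by a sequence in \<open>\<mm>\<close> that is regular on \<open>R\<close> and on \<open>L\<close>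
  and such that each element lies outside \<open>\<mm>\<^sup>2\<close> plus the ideal of the preceding ones. Suppose that
  \<open>s \<mm> \<subseteq> J\<close> with \<open>s \<in> \<mm>\<close>. Then \<open>s \<Omega> \<subseteq> J \<Omega>\<close> for every syzygy \<open>\<Omega>\<close> of \<open>k\<close>, because
  \<open>Tor (R / J, k) \<rightarrow> Tor (k, k)\<close> is injective, and so \<open>s L \<subseteq> J L\<close> by the given surjection. On the other
  hand \<open>L / J L\<close> has finite injective dimension over \<open>R / J\<close>, and by Bass's argument such a non-zero module
  is not killed by a non-zero socle element of \<open>R / J\<close>. Hence \<open>s \<in> J\<close>; so \<open>\<mm>\<close> is not associated to \<open>R / J\<close> unless
  \<open>J = \<mm>\<close>, and prime avoidance yields a regular ideal \<open>J\<close> with \<open>depth L = dim R\<close> generators. Then \<open>\<mm>\<close> is the only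
  prime containing \<open>J\<close>, which forces \<open>J = \<mm>\<close>: the maximal ideal is generated by \<open>dim R\<close> elements.\<close>

text \<open>Depth only supplies sequences regular on \<open>L\<close>, whereas the argument needs
  three properties at once: regularity on \<open>R\<close> and on \<open>L\<close> for the control
  of Ext (R / J, L), and independence modulo \<mm>^2 for the injectivity on Tor and for bounding the
  number of generators by the embedding dimension. So the entries of a given
  \<open>L\<close>-regular sequence are traded one by one: an element regular modulo every proper
  prefix can be put in front if the last entry is dropped, and no length is lost. Independence is
  attainable while J differs from \<mm>: by Nakayama J + \<mm>^2 then differs from \<mm>, and prime
  avoidance tolerates this non-prime ideal because it contains \<mm>^2. No Ext, Tor or quotient
  module is formed. A module over R / J is an R-module killed by J, Hom (R / I, E) is the set of
  elements of E killed by I, and a homomorphism from R^n is a tuple. The resolution over R / J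
  consists of the elements killed by J in the given one, cut off at the degree j equal to the number
  of generators. Bass's argument applies Nakayama to Ext modules; they are shown to be finitely
  generated by dimension shifting, although the injective modules need not be.\<close>

section \<open>Elementary module theory: submodules, generators, homomorphisms\<close>

text \<open>Negation is multiplication by the scalar -1, so closure under inverses comes for free.
  This is the working criterion for submodules below.\<close>

lemma (in module) submodule_iff:
  "submodule H R M \<longleftrightarrow> H \<subseteq> carrier M \<and> \<zero>\<^bsub>M\<^esub> \<in> H \<and> (\<forall>x\<in>H. \<forall>y\<in>H. x \<oplus>\<^bsub>M\<^esub> y \<in> H) \<and>
    (\<forall>a\<in>carrier R. \<forall>x\<in>H. a \<odot>\<^bsub>M\<^esub> x \<in> H)"
proof
  assume "submodule H R M"
  then interpret H: submodule H R M .
  show "H \<subseteq> carrier M \<and> \<zero>\<^bsub>M\<^esub> \<in> H \<and> (\<forall>x\<in>H. \<forall>y\<in>H. x \<oplus>\<^bsub>M\<^esub> y \<in> H) \<and>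
    (\<forall>a\<in>carrier R. \<forall>x\<in>H. a \<odot>\<^bsub>M\<^esub> x \<in> H)"
    using H.subset H.one_closed H.m_closed H.smult_closed by simp
next
  assume *: "H \<subseteq> carrier M \<and> \<zero>\<^bsub>M\<^esub> \<in> H \<and> (\<forall>x\<in>H. \<forall>y\<in>H. x \<oplus>\<^bsub>M\<^esub> y \<in> H) \<and>
    (\<forall>a\<in>carrier R. \<forall>x\<in>H. a \<odot>\<^bsub>M\<^esub> x \<in> H)"
  have "\<ominus>\<^bsub>M\<^esub> x \<in> H" if "x \<in> H" for x
  proof -
    have "(\<ominus> \<one>) \<odot>\<^bsub>M\<^esub> x \<in> H" using * that by blast
    moreover have "(\<ominus> \<one>) \<odot>\<^bsub>M\<^esub> x = \<ominus>\<^bsub>M\<^esub> x" using that * smult_l_minus[of \<one> x] by auto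
    ultimately show ?thesis by simp
  qed
  then show "submodule H R M" using * by (intro submoduleI) auto
qed

context module begin

lemma submoduleD:
  assumes "submodule H R M"
  shows "H \<subseteq> carrier M" "\<zero>\<^bsub>M\<^esub> \<in> H" "\<And>x y. x \<in> H \<Longrightarrow> y \<in> H \<Longrightarrow> x \<oplus>\<^bsub>M\<^esub> y \<in> H"
    "\<And>a x. a \<in> carrier R \<Longrightarrow> x \<in> H \<Longrightarrow> a \<odot>\<^bsub>M\<^esub> x \<in> H"
    "\<And>x. x \<in> H \<Longrightarrow> \<ominus>\<^bsub>M\<^esub> x \<in> H" "\<And>x y. x \<in> H \<Longrightarrow> y \<in> H \<Longrightarrow> x \<ominus>\<^bsub>M\<^esub> y \<in> H"
    "\<And>x. x \<in> H \<Longrightarrow> x \<in> carrier M"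
proof -
  have *: "H \<subseteq> carrier M \<and> \<zero>\<^bsub>M\<^esub> \<in> H \<and> (\<forall>x\<in>H. \<forall>y\<in>H. x \<oplus>\<^bsub>M\<^esub> y \<in> H) \<and>
    (\<forall>a\<in>carrier R. \<forall>x\<in>H. a \<odot>\<^bsub>M\<^esub> x \<in> H)" using assms by (simp add: submodule_iff)
  show **: "\<And>x. x \<in> H \<Longrightarrow> \<ominus>\<^bsub>M\<^esub> x \<in> H" using assms by (rule submoduleE(3))
  show "H \<subseteq> carrier M" "\<zero>\<^bsub>M\<^esub> \<in> H" "\<And>x y. x \<in> H \<Longrightarrow> y \<in> H \<Longrightarrow> x \<oplus>\<^bsub>M\<^esub> y \<in> H"
    "\<And>a x. a \<in> carrier R \<Longrightarrow> x \<in> H \<Longrightarrow> a \<odot>\<^bsub>M\<^esub> x \<in> H" "\<And>x. x \<in> H \<Longrightarrow> x \<in> carrier M"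
    using * by blast+
  show "\<And>x y. x \<in> H \<Longrightarrow> y \<in> H \<Longrightarrow> x \<ominus>\<^bsub>M\<^esub> y \<in> H"
    using * ** by (simp add: a_minus_def)
qed

lemma submodule_diff_iff:
  assumes "submodule H R M" "x \<in> carrier M" "y \<in> H"
  shows "x \<oplus>\<^bsub>M\<^esub> y \<in> H \<longleftrightarrow> x \<in> H"
proof
  note H = submoduleD[OF assms(1)]
  assume "x \<oplus>\<^bsub>M\<^esub> y \<in> H"
  then have "(x \<oplus>\<^bsub>M\<^esub> y) \<ominus>\<^bsub>M\<^esub> y \<in> H" using assms by (intro H(6))
  moreover have "(x \<oplus>\<^bsub>M\<^esub> y) \<ominus>\<^bsub>M\<^esub> y = x"
    using assms H(7) by (simp add: a_minus_def M.a_assoc M.r_neg)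
  ultimately show "x \<in> H" by simp
qed (simp add: assms submoduleD(3)[OF assms(1)])

text \<open>The assumption on \<open>S\<close> keeps the defining intersection from running over an
  empty family: the whole module is then a member.\<close>

lemma gen_submodule_submodule:
  assumes "S \<subseteq> carrier M" shows "submodule (gen_submodule R M S) R M"
proof -
  have "carrier M \<in> {H. submodule H R M \<and> S \<subseteq> H}" using assms carrier_is_submodule by blast
  then show ?thesis
    unfolding gen_submodule_def submodule_iff by (simp add: Inter_iff) blast
qed

lemma gen_submodule_incl: "S \<subseteq> gen_submodule R M S"
  by (auto simp: gen_submodule_def)

lemma gen_submodule_min: "submodule H R M \<Longrightarrow> S \<subseteq> H \<Longrightarrow> gen_submodule R M S \<subseteq> H"
  by (auto simp: gen_submodule_def)

lemma gen_submodule_mono: "S \<subseteq> T \<Longrightarrow> gen_submodule R M S \<subseteq> gen_submodule R M T"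
  by (auto simp: gen_submodule_def)

lemma gen_submodule_self: "submodule H R M \<Longrightarrow> gen_submodule R M H = H"
  using gen_submodule_min gen_submodule_incl by blast

lemma zero_submodule: "submodule {\<zero>\<^bsub>M\<^esub>} R M"
  by (simp add: submodule_iff)

lemma gen_submodule_empty: "gen_submodule R M {} = {\<zero>\<^bsub>M\<^esub>}"
  using gen_submodule_min[OF zero_submodule, of "{}"] submoduleD(2)[OF gen_submodule_submodule[of "{}"]] by auto

lemma smult_minus_distr:
  "a \<in> carrier R \<Longrightarrow> x \<in> carrier M \<Longrightarrow> y \<in> carrier M \<Longrightarrow>
    a \<odot>\<^bsub>M\<^esub> (x \<ominus>\<^bsub>M\<^esub> y) = a \<odot>\<^bsub>M\<^esub> x \<ominus>\<^bsub>M\<^esub> a \<odot>\<^bsub>M\<^esub> y"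
  by (simp add: a_minus_def smult_r_distr smult_r_minus)

lemma add_minus_cancel:
  "x \<in> carrier M \<Longrightarrow> y \<in> carrier M \<Longrightarrow> (x \<ominus>\<^bsub>M\<^esub> y) \<oplus>\<^bsub>M\<^esub> y = x"
  by (simp add: a_minus_def M.a_assoc M.l_neg)

lemma minus_eq_zero_iff:
  "x \<in> carrier M \<Longrightarrow> y \<in> carrier M \<Longrightarrow> x \<ominus>\<^bsub>M\<^esub> y = \<zero>\<^bsub>M\<^esub> \<longleftrightarrow> x = y"
  using add_minus_cancel[of x y] by (auto simp: a_minus_def M.r_neg)

lemma smult_commute:
  "a \<in> carrier R \<Longrightarrow> b \<in> carrier R \<Longrightarrow> x \<in> carrier M \<Longrightarrow>
    a \<odot>\<^bsub>M\<^esub> (b \<odot>\<^bsub>M\<^esub> x) = b \<odot>\<^bsub>M\<^esub> (a \<odot>\<^bsub>M\<^esub> x)"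
  by (metis smult_assoc1 R.m_comm)

end

lemma hom_moduleD:
  assumes "f \<in> hom_module R M N"
  shows "x \<in> carrier M \<Longrightarrow> f x \<in> carrier N"
    "x \<in> carrier M \<Longrightarrow> y \<in> carrier M \<Longrightarrow> f (x \<oplus>\<^bsub>M\<^esub> y) = f x \<oplus>\<^bsub>N\<^esub> f y"
    "a \<in> carrier R \<Longrightarrow> x \<in> carrier M \<Longrightarrow> f (a \<odot>\<^bsub>M\<^esub> x) = a \<odot>\<^bsub>N\<^esub> f x"
  using assms by (auto simp: hom_module_def)

lemma hom_module_zero_minus:
  assumes f: "f \<in> hom_module R M N" and M: "module R M" and N: "module R N"
  shows hom_module_zero: "f \<zero>\<^bsub>M\<^esub> = \<zero>\<^bsub>N\<^esub>"
    and hom_module_minus: "x \<in> carrier M \<Longrightarrow> y \<in> carrier M \<Longrightarrow> f (x \<ominus>\<^bsub>M\<^esub> y) = f x \<ominus>\<^bsub>N\<^esub> f y"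
proof -
  interpret M: module R M by fact
  interpret N: module R N by fact
  note h = hom_moduleD[OF f]
  show "f \<zero>\<^bsub>M\<^esub> = \<zero>\<^bsub>N\<^esub>"
    using h(3)[of "\<zero>\<^bsub>R\<^esub>" "\<zero>\<^bsub>M\<^esub>"] h(1)[of "\<zero>\<^bsub>M\<^esub>"] by simp
  assume xy: "x \<in> carrier M" "y \<in> carrier M"
  have "f (\<ominus>\<^bsub>M\<^esub> y) = f ((\<ominus>\<^bsub>R\<^esub> \<one>\<^bsub>R\<^esub>) \<odot>\<^bsub>M\<^esub> y)" using xy by (simp add: M.smult_l_minus)
  also have "\<dots> = \<ominus>\<^bsub>N\<^esub> f y" using h(3)[of "\<ominus>\<^bsub>R\<^esub> \<one>\<^bsub>R\<^esub>" y] h(1) xy by (simp add: N.smult_l_minus)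
  finally show "f (x \<ominus>\<^bsub>M\<^esub> y) = f x \<ominus>\<^bsub>N\<^esub> f y" using h(2)[of x "\<ominus>\<^bsub>M\<^esub> y"] xy by (simp add: a_minus_def)
qed
lemma hom_submodule:
  assumes f: "f \<in> hom_module R M N" and M: "module R M" and N: "module R N"
  shows submodule_hom_image: "submodule H R M \<Longrightarrow> submodule (f ` H) R N"
    and submodule_hom_preimage: "submodule H' R N \<Longrightarrow> submodule {x \<in> carrier M. f x \<in> H'} R M"
proof -
  interpret M: module R M by fact
  interpret N: module R N by fact
  note h = hom_moduleD[OF f] and h0 = hom_module_zero[OF f M N]
  show "submodule (f ` H) R N" if "submodule H R M"
  proof -
    note H = M.submoduleD[OF that]
    have "f x \<oplus>\<^bsub>N\<^esub> f y \<in> f ` H" if "x \<in> H" "y \<in> H" for x y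
      using imageI[OF H(3)[OF that], of f] h(2) H(7) that by simp
    moreover have "a \<odot>\<^bsub>N\<^esub> f x \<in> f ` H" if "a \<in> carrier R" "x \<in> H" for a x
      using imageI[OF H(4)[OF that], of f] h(3) H(7) that by simp
    moreover have "\<zero>\<^bsub>N\<^esub> \<in> f ` H" using imageI[OF H(2), of f] h0 by simp
    ultimately show ?thesis unfolding N.submodule_iff using h(1) H(7) by auto
  qed
  show "submodule {x \<in> carrier M. f x \<in> H'} R M" if "submodule H' R N"
    unfolding M.submodule_iff using h h0 N.submoduleD(2-4)[OF that] by auto
qed

context module begin

lemma smult_hom: "a \<in> carrier R \<Longrightarrow> (\<lambda>x. a \<odot>\<^bsub>M\<^esub> x) \<in> hom_module R M M"
  by (simp add: hom_module_def smult_r_distr smult_commute[of a])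

lemma smult_hom_ring: "x \<in> carrier M \<Longrightarrow> (\<lambda>a. a \<odot>\<^bsub>M\<^esub> x) \<in> hom_module R (ring_as_module R) M"
  by (simp add: hom_module_def smult_l_distr smult_assoc1)

lemma submodule_Int: "submodule H R M \<Longrightarrow> submodule K R M \<Longrightarrow> submodule (H \<inter> K) R M"
  unfolding submodule_iff by blast

lemma submodule_sum:
  assumes "submodule H R M" "submodule K R M"
  shows "submodule {y \<oplus>\<^bsub>M\<^esub> z | y z. y \<in> H \<and> z \<in> K} R M" (is "submodule ?S R M")
proof -
  note H = submoduleD[OF assms(1)] and K = submoduleD[OF assms(2)]
  have I: "y \<oplus>\<^bsub>M\<^esub> z \<in> ?S" if "y \<in> H" "z \<in> K" for y z using that by blast
  have E: "\<exists>y z. x = y \<oplus>\<^bsub>M\<^esub> z \<and> y \<in> H \<and> z \<in> K" if "x \<in> ?S" for x using that by blast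
  have "\<zero>\<^bsub>M\<^esub> \<in> ?S" using I[OF H(2) K(2)] by simp
  moreover have "x \<oplus>\<^bsub>M\<^esub> x' \<in> ?S" if x: "x \<in> ?S" "x' \<in> ?S" for x x'
  proof -
    obtain y z where y: "x = y \<oplus>\<^bsub>M\<^esub> z" "y \<in> H" "z \<in> K" using E[OF x(1)] by blast
    obtain y' z' where y': "x' = y' \<oplus>\<^bsub>M\<^esub> z'" "y' \<in> H" "z' \<in> K" using E[OF x(2)] by blast
    have "x \<oplus>\<^bsub>M\<^esub> x' = (y \<oplus>\<^bsub>M\<^esub> y') \<oplus>\<^bsub>M\<^esub> (z \<oplus>\<^bsub>M\<^esub> z')"
      using y y' H(7) K(7) by (simp add: M.a_ac)
    then show ?thesis using I[OF H(3)[OF y(2) y'(2)] K(3)[OF y(3) y'(3)]] by simp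
  qed
  moreover have "a \<odot>\<^bsub>M\<^esub> x \<in> ?S" if a: "a \<in> carrier R" and x: "x \<in> ?S" for a x
  proof -
    obtain y z where y: "x = y \<oplus>\<^bsub>M\<^esub> z" "y \<in> H" "z \<in> K" using E[OF x] by blast
    then show ?thesis using I[OF H(4)[OF a y(2)] K(4)[OF a y(3)]] H(7) K(7) a by (simp add: smult_r_distr)
  qed
  moreover have "?S \<subseteq> carrier M" using H(7) K(7) by auto
  ultimately show ?thesis unfolding submodule_iff by simp
qed

lemma submodule_add_cyclic:
  assumes "submodule N R M" "submodule I R (ring_as_module R)" "s \<in> carrier M"
  shows "submodule {y \<oplus>\<^bsub>M\<^esub> a \<odot>\<^bsub>M\<^esub> s | y a. y \<in> N \<and> a \<in> I} R M"
proof -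
  have "{y \<oplus>\<^bsub>M\<^esub> a \<odot>\<^bsub>M\<^esub> s | y a. y \<in> N \<and> a \<in> I} =
      {y \<oplus>\<^bsub>M\<^esub> z | y z. y \<in> N \<and> z \<in> (\<lambda>a. a \<odot>\<^bsub>M\<^esub> s) ` I}" by blast
  then show ?thesis
    using submodule_sum[OF assms(1) submodule_hom_image[OF smult_hom_ring[OF assms(3)]
          ring_as_module_is_module[OF R.cring_axioms] module_axioms assms(2)]] by simp
qed

lemma add_cyclic_incl:
  assumes "submodule N R M" "s \<in> carrier M"
  shows "insert s N \<subseteq> {y \<oplus>\<^bsub>M\<^esub> a \<odot>\<^bsub>M\<^esub> s | y a. y \<in> N \<and> a \<in> carrier R}" (is "_ \<subseteq> ?H")
proof -
  note N = submoduleD[OF assms(1)]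
  have I: "y \<oplus>\<^bsub>M\<^esub> a \<odot>\<^bsub>M\<^esub> s \<in> ?H" if "y \<in> N" "a \<in> carrier R" for y a using that by blast
  have "y \<in> ?H" if "y \<in> N" for y using I[of y \<zero>] that assms N(7) by simp
  moreover have "s \<in> ?H" using I[of "\<zero>\<^bsub>M\<^esub>" \<one>] N(2) assms by simp
  ultimately show ?thesis by blast
qed

lemma gen_submodule_insert:
  assumes "S \<subseteq> carrier M" "s \<in> carrier M" "x \<in> gen_submodule R M (insert s S)"
  obtains y a where "y \<in> gen_submodule R M S" "a \<in> carrier R" "x = y \<oplus>\<^bsub>M\<^esub> a \<odot>\<^bsub>M\<^esub> s"
proof -
  note sG = gen_submodule_submodule[OF assms(1)]
  have "insert s S \<subseteq> {y \<oplus>\<^bsub>M\<^esub> a \<odot>\<^bsub>M\<^esub> s | y a. y \<in> gen_submodule R M S \<and> a \<in> carrier R}"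
    using add_cyclic_incl[OF sG assms(2)] gen_submodule_incl[of S] by blast
  moreover have "submodule {y \<oplus>\<^bsub>M\<^esub> a \<odot>\<^bsub>M\<^esub> s | y a. y \<in> gen_submodule R M S \<and> a \<in> carrier R} R M"
    using module.carrier_is_submodule[OF ring_as_module_is_module[OF R.cring_axioms]]
    by (intro submodule_add_cyclic[OF sG _ assms(2)]) simp
  ultimately show thesis using gen_submodule_min assms(3) that by blast
qed

end
section \<open>Ideals and Noetherian modules\<close>

text \<open>Through this bridge everything proved for submodules applies to ideals, with the ring
  regarded as a module over itself.\<close>

lemma ideal_iff_submodule:
  assumes "cring R" shows "ideal I R \<longleftrightarrow> submodule I R (ring_as_module R)"
proof -
  interpret cring R by fact
  interpret RM: module R "ring_as_module R" by (rule ring_as_module_is_module) fact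
  show ?thesis
  proof
    assume "ideal I R"
    then interpret ideal I R .
    show "submodule I R (ring_as_module R)"
      unfolding RM.submodule_iff using a_subset by (auto intro: I_l_closed)
  next
    assume I: "submodule I R (ring_as_module R)"
    note * = RM.submoduleD[OF I]
    have "\<ominus>\<^bsub>R\<^esub> x \<in> I" if "x \<in> I" for x
    proof -
      have "(\<ominus>\<^bsub>R\<^esub> \<one>\<^bsub>R\<^esub>) \<otimes>\<^bsub>R\<^esub> x \<in> I" using *(4)[of "\<ominus>\<^bsub>R\<^esub> \<one>\<^bsub>R\<^esub>" x] that by simp
      then show ?thesis using that *(7) by (simp add: l_minus)
    qed
    then show "ideal I R"
      using *(1-4) *(4)[simplified] m_comm[of x y for x y] *(7)[simplified]
      by (intro idealI ring_axioms) (force intro!: subgroup.intro simp flip: a_inv_def)+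
  qed
qed

lemma genideal_eq_gen_submodule:
  assumes "cring R" shows "Idl\<^bsub>R\<^esub> S = gen_submodule R (ring_as_module R) S"
  unfolding genideal_def gen_submodule_def using ideal_iff_submodule[OF assms] by simp

lemma (in noetherian_ring) maximal_ideal_in_family:
  assumes "\<F> \<noteq> {}" "\<And>I. I \<in> \<F> \<Longrightarrow> ideal I R"
  obtains I where "I \<in> \<F>" "\<And>J. J \<in> \<F> \<Longrightarrow> I \<subseteq> J \<Longrightarrow> J = I"
proof -
  have "\<exists>I\<in>\<F>. \<forall>J\<in>\<F>. I \<subseteq> J \<longrightarrow> J = I"
  proof (rule subset_Zorn_nonempty[OF assms(1)])
    fix C assume C: "C \<noteq> {}" "subset.chain \<F> C"
    then have "subset.chain {I. ideal I R} C" using assms(2) by (auto simp: subset_chain_def)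
    then have "\<Union>C \<in> C" using C ideal_chain_is_trivial by blast
    then show "\<Union>C \<in> \<F>" using C by (auto simp: subset_chain_def)
  qed
  then show thesis using that by blast
qed

lemma (in noetherian_ring) ideal_noetherian_induct [consumes 1, case_names step]:
  assumes "ideal I R" and "\<And>I. ideal I R \<Longrightarrow> (\<And>J. ideal J R \<Longrightarrow> I \<subset> J \<Longrightarrow> P J) \<Longrightarrow> P I"
  shows "P I"
proof (rule ccontr)
  assume "\<not> P I"
  then have "{I. ideal I R \<and> \<not> P I} \<noteq> {}" using assms(1) by blast
  then obtain J where "J \<in> {I. ideal I R \<and> \<not> P I}"
    and "\<And>K. K \<in> {I. ideal I R \<and> \<not> P I} \<Longrightarrow> J \<subseteq> K \<Longrightarrow> K = J"
    using maximal_ideal_in_family[of "{I. ideal I R \<and> \<not> P I}"] by blast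
  then show False using assms(2)[of J] by blast
qed

text \<open>The condition says that \<open>a s\<close> lies in \<open>G + H\<close>, so the set is
  the preimage of a submodule under \<open>a \<mapsto> a s\<close>. For the Noetherian argument it
  is the ideal of coefficients of a last generator \<open>s\<close>.\<close>

lemma (in module) submodule_coefficients:
  assumes "submodule G R M" "submodule H R M" "s \<in> carrier M"
  shows "submodule {a \<in> carrier R. \<exists>y\<in>G. y \<oplus>\<^bsub>M\<^esub> a \<odot>\<^bsub>M\<^esub> s \<in> H} R (ring_as_module R)" (is "submodule ?I _ _")
proof -
  note G = submoduleD[OF assms(1)] and H = submoduleD[OF assms(2)]
  have "(\<exists>y\<in>G. y \<oplus>\<^bsub>M\<^esub> x \<in> H) \<longleftrightarrow> x \<in> {y \<oplus>\<^bsub>M\<^esub> z | y z. y \<in> G \<and> z \<in> H}" (is "?l x \<longleftrightarrow> ?r x")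
    if x: "x \<in> carrier M" for x
  proof
    assume "?l x"
    then obtain y where y: "y \<in> G" "y \<oplus>\<^bsub>M\<^esub> x \<in> H" by blast
    then have "x = \<ominus>\<^bsub>M\<^esub> y \<oplus>\<^bsub>M\<^esub> (y \<oplus>\<^bsub>M\<^esub> x)"
      using x G(7) by (simp add: M.a_assoc[symmetric] M.l_neg)
    then show "?r x" using y G(5) by blast
  next
    assume "?r x"
    then obtain y z where y: "x = y \<oplus>\<^bsub>M\<^esub> z" "y \<in> G" "z \<in> H" by blast
    then have "\<ominus>\<^bsub>M\<^esub> y \<oplus>\<^bsub>M\<^esub> x = z" using G(7) H(7) by (simp add: M.a_assoc[symmetric] M.l_neg)
    then show "?l x" using y G(5) by blast
  qed
  then have "{a \<in> carrier R. ?l (a \<odot>\<^bsub>M\<^esub> s)} = {a \<in> carrier (ring_as_module R). ?r (a \<odot>\<^bsub>M\<^esub> s)}"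
    using assms(3) by (intro Collect_cong conj_cong) simp_all
  then show ?thesis
    using submodule_hom_preimage[OF smult_hom_ring[OF assms(3)] ring_as_module_is_module[OF R.cring_axioms]
        module_axioms submodule_sum[OF assms(1,2)]] by simp
qed

text \<open>Induction on the generators of the ambient span. The part of \<open>N\<close> inside the
  span of \<open>S\<close> is covered by the induction hypothesis; the coefficients of the extra
  generator \<open>s\<close> form an ideal, and lifts of its finitely many generators to
  \<open>N\<close> complete the generating set.\<close>

lemma submodule_finitely_generated:
  fixes R :: "('a, 'r) ring_scheme" and M :: "('a, 'b, 'm) module_scheme"
  assumes "noetherian_ring R" "module R M" "finite S" "S \<subseteq> carrier M"
    and "submodule N R M" "N \<subseteq> gen_submodule R M S"
  shows "\<exists>T. finite T \<and> T \<subseteq> N \<and> gen_submodule R M T = N"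
  using assms(3-6)
proof (induction S arbitrary: N)
  case empty
  interpret module R M by fact
  have "N = {\<zero>\<^bsub>M\<^esub>}" using empty gen_submodule_empty submoduleD(2)[OF empty(2)] by auto
  then show ?case using gen_submodule_empty by blast
next
  case (insert s S)
  interpret module R M by fact
  interpret noetherian_ring R by fact
  interpret RM: module R "ring_as_module R" by (rule ring_as_module_is_module) (rule R.cring_axioms)
  note N = submoduleD[OF insert.prems(2)]
  have S: "S \<subseteq> carrier M" "s \<in> carrier M" using insert.prems by auto
  let ?G = "gen_submodule R M S"
  have sG: "submodule ?G R M" using gen_submodule_submodule[OF S(1)] .
  note G = submoduleD[OF sG]
  have "submodule (N \<inter> ?G) R M" by (rule submodule_Int[OF insert.prems(2) sG])
  then obtain T where T: "finite T" "T \<subseteq> N \<inter> ?G" "gen_submodule R M T = N \<inter> ?G"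
    using insert.IH[OF S(1), of "N \<inter> ?G"] by auto
  define I where "I H = {a \<in> carrier R. \<exists>y\<in>?G. y \<oplus>\<^bsub>M\<^esub> a \<odot>\<^bsub>M\<^esub> s \<in> H}" for H
  have I: "submodule (I H) R (ring_as_module R)" if "submodule H R M" for H
    unfolding I_def by (rule submodule_coefficients[OF sG that S(2)])
  have "ideal (I N) R" using ideal_iff_submodule[OF R.cring_axioms] I[OF insert.prems(2)] by blast
  then obtain A where A: "A \<subseteq> carrier R" "finite A" "I N = Idl\<^bsub>R\<^esub> A" using finetely_gen by blast
  then have A_gen: "I N = gen_submodule R (ring_as_module R) A"
    using genideal_eq_gen_submodule[OF R.cring_axioms] by metis
  then have AI: "A \<subseteq> I N" using RM.gen_submodule_incl by blast
  have "\<forall>a\<in>A. \<exists>y\<in>?G. y \<oplus>\<^bsub>M\<^esub> a \<odot>\<^bsub>M\<^esub> s \<in> N" using AI by (auto simp: I_def)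
  then obtain f where f: "\<And>a. a \<in> A \<Longrightarrow> f a \<in> ?G" "\<And>a. a \<in> A \<Longrightarrow> f a \<oplus>\<^bsub>M\<^esub> a \<odot>\<^bsub>M\<^esub> s \<in> N" by metis
  define T' where "T' = T \<union> (\<lambda>a. f a \<oplus>\<^bsub>M\<^esub> a \<odot>\<^bsub>M\<^esub> s) ` A"
  have T': "finite T'" "T' \<subseteq> N" using T A f by (auto simp: T'_def)
  let ?H = "gen_submodule R M T'"
  have sH: "submodule ?H R M" using gen_submodule_submodule[OF subset_trans[OF T'(2) N(1)]] .
  note H = submoduleD[OF sH]
  have HN: "?H \<subseteq> N" by (rule gen_submodule_min[OF insert.prems(2) T'(2)])
  have NGH: "N \<inter> ?G \<subseteq> ?H" using gen_submodule_mono[of T T'] T by (auto simp: T'_def)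
  have T'H: "T' \<subseteq> ?H" by (rule gen_submodule_incl)
  have "A \<subseteq> I ?H"
  proof
    fix a assume a: "a \<in> A"
    then have "f a \<oplus>\<^bsub>M\<^esub> a \<odot>\<^bsub>M\<^esub> s \<in> ?H" using T'H by (auto simp: T'_def)
    then show "a \<in> I ?H" using f(1)[OF a] a A(1) by (auto simp: I_def)
  qed
  then have II': "I N \<subseteq> I ?H" using RM.gen_submodule_min[OF I[OF sH]] A_gen by simp
  \<comment> \<open>From \<open>x = y + a s\<close> subtract an element of \<open>?H\<close> with
    the same coefficient \<open>a\<close>. The difference lies in \<open>N\<close> and in the span
    of \<open>S\<close>, hence in \<open>?H\<close>.\<close>
  have "N \<subseteq> ?H"
  proof
    fix x assume x: "x \<in> N"
    then have "x \<in> gen_submodule R M (insert s S)" using insert.prems(3) by blast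
    then obtain y a where ya: "y \<in> ?G" "a \<in> carrier R" "x = y \<oplus>\<^bsub>M\<^esub> a \<odot>\<^bsub>M\<^esub> s"
      by (rule gen_submodule_insert[OF S])
    then have "a \<in> I N" using x by (auto simp: I_def)
    then obtain z where z: "z \<in> ?G" "z \<oplus>\<^bsub>M\<^esub> a \<odot>\<^bsub>M\<^esub> s \<in> ?H" using II' by (auto simp: I_def)
    let ?w = "z \<oplus>\<^bsub>M\<^esub> a \<odot>\<^bsub>M\<^esub> s"
    have cl: "y \<in> carrier M" "z \<in> carrier M" "a \<odot>\<^bsub>M\<^esub> s \<in> carrier M" using ya z G(7) S by auto
    then have xz: "x = (y \<ominus>\<^bsub>M\<^esub> z) \<oplus>\<^bsub>M\<^esub> ?w"
      using ya by (simp add: M.a_assoc[symmetric] add_minus_cancel)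
    have yz: "y \<ominus>\<^bsub>M\<^esub> z \<in> ?G" using G(6) ya z by simp
    have "?w \<in> N" using z HN by blast
    then have "y \<ominus>\<^bsub>M\<^esub> z \<in> N"
      using submodule_diff_iff[OF insert.prems(2), of "y \<ominus>\<^bsub>M\<^esub> z" ?w] x xz G(7)[OF yz] by simp
    then have "y \<ominus>\<^bsub>M\<^esub> z \<in> ?H" using yz NGH by blast
    then show "x \<in> ?H" using H(3)[OF _ z(2)] xz by simp
  qed
  then show ?case using T' HN by blast
qed

context cring begin

lemma ring_as_module: "module R (ring_as_module R)"
  by (rule ring_as_module_is_module) (rule cring_axioms)

lemma ideal_iff:
  "ideal I R \<longleftrightarrow> I \<subseteq> carrier R \<and> \<zero> \<in> I \<and> (\<forall>x\<in>I. \<forall>y\<in>I. x \<oplus> y \<in> I) \<and> (\<forall>a\<in>carrier R. \<forall>x\<in>I. a \<otimes> x \<in> I)"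
  unfolding ideal_iff_submodule[OF cring_axioms] module.submodule_iff[OF ring_as_module]
  by simp

lemma idealD:
  assumes "ideal I R"
  shows "I \<subseteq> carrier R" "\<zero> \<in> I" "\<And>x y. x \<in> I \<Longrightarrow> y \<in> I \<Longrightarrow> x \<oplus> y \<in> I"
    "\<And>a x. a \<in> carrier R \<Longrightarrow> x \<in> I \<Longrightarrow> a \<otimes> x \<in> I" "\<And>a x. a \<in> carrier R \<Longrightarrow> x \<in> I \<Longrightarrow> x \<otimes> a \<in> I"
    "\<And>x. x \<in> I \<Longrightarrow> \<ominus> x \<in> I" "\<And>x y. x \<in> I \<Longrightarrow> y \<in> I \<Longrightarrow> x \<ominus> y \<in> I"
    "\<And>x. x \<in> I \<Longrightarrow> x \<in> carrier R"
proof -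
  interpret I: ideal I R by fact
  show "I \<subseteq> carrier R" "\<zero> \<in> I" "\<And>x y. x \<in> I \<Longrightarrow> y \<in> I \<Longrightarrow> x \<oplus> y \<in> I"
    "\<And>a x. a \<in> carrier R \<Longrightarrow> x \<in> I \<Longrightarrow> a \<otimes> x \<in> I" "\<And>a x. a \<in> carrier R \<Longrightarrow> x \<in> I \<Longrightarrow> x \<otimes> a \<in> I"
    "\<And>x. x \<in> I \<Longrightarrow> \<ominus> x \<in> I" "\<And>x. x \<in> I \<Longrightarrow> x \<in> carrier R"
    using I.a_subset I.I_l_closed I.I_r_closed I.a_inv_closed by auto
  then show "\<And>x y. x \<in> I \<Longrightarrow> y \<in> I \<Longrightarrow> x \<ominus> y \<in> I" by (simp add: a_minus_def)
qed

lemma ideal_diff_iff: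
  assumes "ideal I R" "x \<in> carrier R" "y \<in> I"
  shows "x \<oplus> y \<in> I \<longleftrightarrow> x \<in> I"
  using module.submodule_diff_iff[OF ring_as_module] ideal_iff_submodule[OF cring_axioms] assms by simp

end

section \<open>The ideals J + R a and prime avoidance\<close>

definition adjoin :: "('a, 'r) ring_scheme \<Rightarrow> 'a set \<Rightarrow> 'a \<Rightarrow> 'a set"
  where "adjoin R J a = {x \<oplus>\<^bsub>R\<^esub> r \<otimes>\<^bsub>R\<^esub> a | x r. x \<in> J \<and> r \<in> carrier R}"

context cring begin

lemma adjoin:
  assumes "ideal J R" "a \<in> carrier R"
  shows adjoin_ideal: "ideal (adjoin R J a) R"
    and adjoin_incl: "J \<subseteq> adjoin R J a" and adjoin_elem: "a \<in> adjoin R J a"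
proof -
  interpret RM: module R "ring_as_module R" by (rule ring_as_module)
  have J: "submodule J R (ring_as_module R)" using assms ideal_iff_submodule[OF cring_axioms] by simp
  show "ideal (adjoin R J a) R"
    using RM.submodule_add_cyclic[OF J RM.carrier_is_submodule, of a] assms(2)
    by (simp add: adjoin_def ideal_iff_submodule[OF cring_axioms])
  show "J \<subseteq> adjoin R J a" "a \<in> adjoin R J a"
    using RM.add_cyclic_incl[OF J, of a] assms(2) by (simp_all add: adjoin_def)
qed

lemma adjoinE:
  assumes "z \<in> adjoin R J a"
  obtains x r where "x \<in> J" "r \<in> carrier R" "z = x \<oplus> r \<otimes> a"
  using assms by (auto simp: adjoin_def)

lemma adjoin_min:
  assumes "ideal I R" "J \<subseteq> I" "a \<in> I" shows "adjoin R J a \<subseteq> I"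
proof
  note I = idealD[OF assms(1)]
  fix z assume "z \<in> adjoin R J a"
  then obtain x r where "x \<in> J" "r \<in> carrier R" "z = x \<oplus> r \<otimes> a" by (rule adjoinE)
  moreover have "x \<in> I" using assms(2) \<open>x \<in> J\<close> by (rule subsetD)
  ultimately show "z \<in> I" using I(3)[of x "r \<otimes> a"] I(4)[of r a] assms(3) by simp
qed

lemma adjoin_commute:
  assumes "ideal J R" "a \<in> carrier R" "b \<in> carrier R"
  shows "adjoin R (adjoin R J a) b = adjoin R (adjoin R J b) a"
proof -
  have "adjoin R (adjoin R J a) b \<subseteq> adjoin R (adjoin R J b) a"
    if "a \<in> carrier R" "b \<in> carrier R" for a b
  proof (rule adjoin_min)
    have b: "ideal (adjoin R J b) R" using assms(1) that(2) by (rule adjoin_ideal)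
    show "ideal (adjoin R (adjoin R J b) a) R" using b that(1) by (rule adjoin_ideal)
    show "adjoin R J a \<subseteq> adjoin R (adjoin R J b) a"
    proof (rule adjoin_min)
      show "J \<subseteq> adjoin R (adjoin R J b) a"
        using adjoin_incl[OF assms(1) that(2)] adjoin_incl[OF b that(1)] by (rule subset_trans)
    qed (use adjoin_ideal[OF b that(1)] adjoin_elem[OF b that(1)] in auto)
    show "b \<in> adjoin R (adjoin R J b) a"
      using adjoin_elem[OF assms(1) that(2)] adjoin_incl[OF b that(1)] by (rule set_rev_mp)
  qed
  then show ?thesis using assms(2,3) by (intro subset_antisym)
qed

lemma genideal_insert:
  assumes "S \<subseteq> carrier R" "a \<in> carrier R"
  shows "Idl (insert a S) = adjoin R (Idl S) a"
proof
  have I: "ideal (Idl S) R" using assms genideal_ideal by blast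
  have "insert a S \<subseteq> adjoin R (Idl S) a"
    using adjoin_elem[OF I assms(2)] subset_trans[OF genideal_self[OF assms(1)] adjoin_incl[OF I assms(2)]]
    by (rule insert_subsetI)
  then show "Idl (insert a S) \<subseteq> adjoin R (Idl S) a"
    by (rule genideal_minimal[OF adjoin_ideal[OF I assms(2)]])
  have *: "insert a S \<subseteq> carrier R" using assms by simp
  show "adjoin R (Idl S) a \<subseteq> Idl (insert a S)"
    using genideal_self[OF *] subset_Idl_subset[OF *, of S]
    by (intro adjoin_min genideal_ideal *) auto
qed

lemma genideal_empty: "Idl {} = {\<zero>}"
  using genideal_eq_gen_submodule[OF cring_axioms] module.gen_submodule_empty[OF ring_as_module] by simp

text \<open>A product of elements outside \<open>P\<close>, one from each ideal, stays outside the
  prime \<open>P\<close> and lies in every ideal of the family.\<close>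

lemma prime_contains_factor:
  assumes "primeideal P R" "finite \<F>" "\<And>I. I \<in> \<F> \<Longrightarrow> ideal I R" "\<And>I. I \<in> \<F> \<Longrightarrow> \<not> I \<subseteq> P"
  obtains a where "a \<in> carrier R" "a \<notin> P" "\<And>I. I \<in> \<F> \<Longrightarrow> a \<in> I"
proof -
  interpret P: primeideal P R by fact
  have "\<exists>a\<in>carrier R. a \<notin> P \<and> (\<forall>I\<in>\<F>. a \<in> I)"
    using assms(2-4)
  proof (induction \<F>)
    case empty
    have "\<one> \<notin> P" using P.one_imp_carrier P.I_notcarr by blast
    then show ?case by auto
  next
    case (insert I \<F>)
    then obtain a where a: "a \<in> carrier R" "a \<notin> P" "\<forall>I\<in>\<F>. a \<in> I" by auto
    obtain b where b: "b \<in> I" "b \<notin> P" using insert.prems(2)[of I] by auto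
    note I = idealD[OF insert.prems(1)]
    have bR: "b \<in> carrier R" using I(8)[of I b] b by simp
    have "a \<otimes> b \<notin> P" using P.I_prime[OF a(1) bR] a b by blast
    moreover have "a \<otimes> b \<in> I'" if "I' \<in> insert I \<F>" for I'
      using that a b bR I(4)[of I a b] I(5)[of I' b a] by auto
    ultimately show ?case using a(1) bR by blast
  qed
  then show thesis using that by blast
qed

text \<open>Prime avoidance with one further ideal \<open>Q\<close> that need not be prime but
  contains all products of elements of \<open>I\<close>. The application is \<open>I = \<mm>\<close>
  with \<open>Q\<close> equal to J + \<mm>^2.\<close>

lemma prime_avoidance:
  assumes "finite \<P>" "\<And>P. P \<in> \<P> \<Longrightarrow> primeideal P R" "\<And>P. P \<in> \<P> \<Longrightarrow> \<not> I \<subseteq> P"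
    and I: "ideal I R" and Q: "ideal Q R" "Q \<subseteq> I" "Q \<noteq> I" "\<And>a b. a \<in> I \<Longrightarrow> b \<in> I \<Longrightarrow> a \<otimes> b \<in> Q"
  shows "\<exists>a\<in>I. a \<notin> Q \<and> (\<forall>P\<in>\<P>. a \<notin> P)"
  using assms(1-3)
proof (induction "card \<P>" arbitrary: \<P> rule: less_induct)
  case less
  \<comment> \<open>A prime contained in another member can be discarded, so the primes may be taken
    pairwise incomparable.\<close>
  show ?case
  proof (cases "\<exists>P\<in>\<P>. \<exists>P'\<in>\<P>. P \<noteq> P' \<and> P \<subseteq> P'")
    case True
    then obtain P P' where P: "P \<in> \<P>" "P' \<in> \<P>" "P \<noteq> P'" "P \<subseteq> P'" by blast
    have "card (\<P> - {P}) < card \<P>" using P less.prems(1) by (meson card_Diff1_less)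
    then obtain a where a: "a \<in> I" "a \<notin> Q" "\<forall>P\<in>\<P> - {P}. a \<notin> P"
      using less.hyps[of "\<P> - {P}"] less.prems by auto
    then have "a \<notin> P" using P by blast
    then show ?thesis using a by blast
  next
    case False
    show ?thesis
    proof (cases "\<P> = {}")
      case True
      then show ?thesis using Q by auto
    next
      case ne: False
      then obtain P where P: "P \<in> \<P>" by blast
      have "card (\<P> - {P}) < card \<P>" using P less.prems(1) by (meson card_Diff1_less)
      then obtain a where a: "a \<in> I" "a \<notin> Q" "\<forall>P\<in>\<P> - {P}. a \<notin> P"
        using less.hyps[of "\<P> - {P}"] less.prems by auto
      show ?thesis
      proof (cases "a \<in> P")
        case True
        have prime: "primeideal P R" using less.prems P by blast
        \<comment> \<open>This is where products matter: the square of every element of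
          \<open>I\<close> lies in \<open>Q\<close>, so \<open>Q\<close> inside the prime
          \<open>P\<close> would force \<open>I\<close> inside \<open>P\<close>.\<close>
        have "\<not> Q \<subseteq> P"
        proof
          assume "Q \<subseteq> P"
          have "x \<in> P" if "x \<in> I" for x
            using primeideal.I_prime[OF prime, of x x] that Q(4)[of x x] \<open>Q \<subseteq> P\<close> idealD(8)[OF I] by auto
          then show False using less.prems(3)[OF P] by blast
        qed
        have id: "ideal J R" if "J \<in> insert Q (\<P> - {P})" for J
          using that Q(1) less.prems(2) primeideal.axioms(1) by blast
        \<comment> \<open>Adding such a \<open>b\<close> moves \<open>a\<close> out of
          \<open>P\<close> and changes nothing about membership in \<open>Q\<close> or in the other
          primes.\<close>
        obtain b where b: "b \<in> carrier R" "b \<notin> P" "\<And>J. J \<in> insert Q (\<P> - {P}) \<Longrightarrow> b \<in> J"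
          using prime_contains_factor[OF prime, of "insert Q (\<P> - {P})"] id \<open>\<not> Q \<subseteq> P\<close> less.prems(1) False P
          by (metis finite.insertI finite_Diff insertE DiffE singletonI)
        have aR: "a \<in> carrier R" using a idealD(8)[OF I] by blast
        have "a \<oplus> b \<notin> J" if J: "J \<in> insert Q (\<P> - {P})" for J
          using ideal_diff_iff[OF id[OF J] aR b(3)[OF J]] a J by blast
        moreover have "a \<oplus> b \<notin> P"
          using ideal_diff_iff[OF primeideal.axioms(1)[OF prime] b(1) True] b(2) aR a_comm b(1) by simp
        moreover have "a \<oplus> b \<in> I" using idealD(3)[OF I a(1)] b(3)[of Q] Q(2) by blast
        ultimately show ?thesis by blast
      qed (use a in blast)
    qed
  qed
qed

end

section \<open>The submodules \<open>J M\<close> and zero divisors\<close>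

definition colon :: "('a, 'r) ring_scheme \<Rightarrow> ('a, 'b, 'm) module_scheme \<Rightarrow> 'b set \<Rightarrow> 'b \<Rightarrow> 'a set"
  where "colon R M N x = {a \<in> carrier R. a \<odot>\<^bsub>M\<^esub> x \<in> N}"

text \<open>Being a nonzerodivisor on M / N, on representatives. It holds trivially for
  \<open>N = carrier M\<close>; properness of \<open>N\<close> is always supplied
  separately.\<close>

definition regular_on :: "('a, 'b, 'm) module_scheme \<Rightarrow> 'b set \<Rightarrow> 'a \<Rightarrow> bool"
  where "regular_on M N a \<longleftrightarrow> (\<forall>x\<in>carrier M. a \<odot>\<^bsub>M\<^esub> x \<in> N \<longrightarrow> x \<in> N)"

context module begin

lemma colon_ideal:
  assumes "submodule N R M" "x \<in> carrier M" shows "ideal (colon R M N x) R"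
  using submoduleD[OF assms(1)] assms(2)
  by (auto simp: R.ideal_iff colon_def smult_l_distr smult_assoc1)

lemma ideal_smult_submodule:
  assumes "J \<subseteq> carrier R" shows "submodule (ideal_smult R J M) R M"
  unfolding ideal_smult_def using assms by (intro gen_submodule_submodule) auto

lemma ideal_smultI: "a \<in> J \<Longrightarrow> x \<in> carrier M \<Longrightarrow> a \<odot>\<^bsub>M\<^esub> x \<in> ideal_smult R J M"
  unfolding ideal_smult_def by (rule subsetD[OF gen_submodule_incl]) blast

lemma ideal_smult_min:
  assumes "submodule H R M" "\<And>a x. a \<in> J \<Longrightarrow> x \<in> carrier M \<Longrightarrow> a \<odot>\<^bsub>M\<^esub> x \<in> H"
  shows "ideal_smult R J M \<subseteq> H"
  unfolding ideal_smult_def using assms by (intro gen_submodule_min) auto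

lemma ideal_smult_mono: "J \<subseteq> J' \<Longrightarrow> ideal_smult R J M \<subseteq> ideal_smult R J' M"
  unfolding ideal_smult_def by (intro gen_submodule_mono) auto

lemma ideal_smult_zero: "ideal_smult R {\<zero>} M = {\<zero>\<^bsub>M\<^esub>}"
proof
  have "submodule {\<zero>\<^bsub>M\<^esub>} R M" by (rule zero_submodule)
  then show "ideal_smult R {\<zero>} M \<subseteq> {\<zero>\<^bsub>M\<^esub>}" by (rule ideal_smult_min) simp
  show "{\<zero>\<^bsub>M\<^esub>} \<subseteq> ideal_smult R {\<zero>} M"
    using submoduleD(2)[OF ideal_smult_submodule[of "{\<zero>}"]] by simp
qed

text \<open>Since (J + R a) M = J M + a M, one summand \<open>a x\<close> with a single
  \<open>x\<close> suffices; this makes inductions along a sequence possible.\<close>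

lemma ideal_smult_adjoin:
  assumes J: "ideal J R" and a: "a \<in> carrier R"
  shows "ideal_smult R (adjoin R J a) M = {u \<oplus>\<^bsub>M\<^esub> a \<odot>\<^bsub>M\<^esub> x | u x. u \<in> ideal_smult R J M \<and> x \<in> carrier M}"
    (is "?L = ?H")
proof
  note JR = R.idealD[OF J] and aJ = R.adjoin[OF J a]
  have I: "u \<oplus>\<^bsub>M\<^esub> a \<odot>\<^bsub>M\<^esub> x \<in> ?H" if "u \<in> ideal_smult R J M" "x \<in> carrier M" for u x using that by blast
  have E: "\<exists>u x. z = u \<oplus>\<^bsub>M\<^esub> a \<odot>\<^bsub>M\<^esub> x \<and> u \<in> ideal_smult R J M \<and> x \<in> carrier M" if "z \<in> ?H" for z using that by blast
  have "?H = {u \<oplus>\<^bsub>M\<^esub> z | u z. u \<in> ideal_smult R J M \<and> z \<in> (\<lambda>x. a \<odot>\<^bsub>M\<^esub> x) ` carrier M}" by blast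
  then have sH: "submodule ?H R M"
    using submodule_sum[OF ideal_smult_submodule[OF JR(1)]
        submodule_hom_image[OF smult_hom[OF a] module_axioms module_axioms carrier_is_submodule]] by simp
  show "?L \<subseteq> ?H"
  proof (rule ideal_smult_min[OF sH])
    fix c x assume c: "c \<in> adjoin R J a" and x: "x \<in> carrier M"
    obtain y r where y: "y \<in> J" "r \<in> carrier R" "c = y \<oplus> r \<otimes> a" using c by (rule R.adjoinE)
    then have "c \<odot>\<^bsub>M\<^esub> x = y \<odot>\<^bsub>M\<^esub> x \<oplus>\<^bsub>M\<^esub> a \<odot>\<^bsub>M\<^esub> (r \<odot>\<^bsub>M\<^esub> x)"
      using x a JR(8) by (simp add: smult_l_distr smult_assoc1 smult_commute[of r a])
    then show "c \<odot>\<^bsub>M\<^esub> x \<in> ?H" using I[OF ideal_smultI[OF y(1) x], of "r \<odot>\<^bsub>M\<^esub> x"] y x by simp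
  qed
  show "?H \<subseteq> ?L"
  proof
    fix z assume "z \<in> ?H"
    then obtain u x where u: "z = u \<oplus>\<^bsub>M\<^esub> a \<odot>\<^bsub>M\<^esub> x" "u \<in> ideal_smult R J M" "x \<in> carrier M" using E by blast
    note L = submoduleD[OF ideal_smult_submodule[OF R.idealD(1)[OF aJ(1)]]]
    have "u \<in> ?L" using ideal_smult_mono[OF aJ(2)] u by blast
    then show "z \<in> ?L" using L(3) ideal_smultI[OF aJ(3) u(3)] u by simp
  qed
qed

lemma smult_in_ideal_smult_adjoin:
  assumes J: "ideal J R" and a: "a \<in> carrier R"
  shows "u \<in> ideal_smult R J M \<Longrightarrow> x \<in> carrier M \<Longrightarrow> u \<oplus>\<^bsub>M\<^esub> a \<odot>\<^bsub>M\<^esub> x \<in> ideal_smult R (adjoin R J a) M"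
  unfolding ideal_smult_adjoin[OF assms] by blast

lemma ideal_smult_adjoinE:
  assumes J: "ideal J R" and a: "a \<in> carrier R" and z: "z \<in> ideal_smult R (adjoin R J a) M"
  obtains u x where "u \<in> ideal_smult R J M" "x \<in> carrier M" "z = u \<oplus>\<^bsub>M\<^esub> a \<odot>\<^bsub>M\<^esub> x"
  using z unfolding ideal_smult_adjoin[OF J a] by blast

text \<open>The elements that need only finitely many generators already form a submodule containing
  \<open>S\<close>.\<close>

lemma gen_submodule_finite_support:
  assumes "S \<subseteq> carrier M" "x \<in> gen_submodule R M S"
  obtains T where "finite T" "T \<subseteq> S" "x \<in> gen_submodule R M T"
proof -
  let ?H = "{x. \<exists>T. finite T \<and> T \<subseteq> S \<and> x \<in> gen_submodule R M T}"
  have I: "x \<in> ?H" if "finite T" "T \<subseteq> S" "x \<in> gen_submodule R M T" for x T using that by blast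
  have T: "submodule (gen_submodule R M T) R M" if "T \<subseteq> S" for T
    using gen_submodule_submodule that assms(1) by blast
  have "x \<oplus>\<^bsub>M\<^esub> y \<in> ?H" if x: "x \<in> ?H" and y: "y \<in> ?H" for x y
  proof -
    obtain A where A: "finite A" "A \<subseteq> S" "x \<in> gen_submodule R M A" using x by blast
    obtain B where B: "finite B" "B \<subseteq> S" "y \<in> gen_submodule R M B" using y by blast
    have "x \<in> gen_submodule R M (A \<union> B)" "y \<in> gen_submodule R M (A \<union> B)"
      using gen_submodule_mono[of A "A \<union> B"] gen_submodule_mono[of B "A \<union> B"] A B by auto
    then show ?thesis using I[of "A \<union> B"] A B submoduleD(3)[OF T[of "A \<union> B"]] by simp
  qed
  moreover have "a \<odot>\<^bsub>M\<^esub> x \<in> ?H" if a: "a \<in> carrier R" and x: "x \<in> ?H" for a x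
  proof -
    obtain A where A: "finite A" "A \<subseteq> S" "x \<in> gen_submodule R M A" using x by blast
    then show ?thesis using I[of A] submoduleD(4)[OF T a] by simp
  qed
  moreover have "\<zero>\<^bsub>M\<^esub> \<in> ?H" using I[of "{}"] submoduleD(2)[OF T[of "{}"]] by simp
  moreover have "?H \<subseteq> carrier M" using submoduleD(7)[OF T] by auto
  ultimately have sH: "submodule ?H R M" unfolding submodule_iff by simp
  have "S \<subseteq> ?H"
  proof
    fix s assume "s \<in> S"
    then show "s \<in> ?H" using I[of "{s}" s] gen_submodule_incl[of "{s}"] by simp
  qed
  then have "x \<in> ?H" using gen_submodule_min[OF sH] assms(2) by blast
  then show thesis using that by blast
qed

end

lemma hom_ideal_smult:
  assumes f: "f \<in> hom_module R M N" and M: "module R M" and N: "module R N" and J: "J \<subseteq> carrier R"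
    and x: "x \<in> ideal_smult R J M"
  shows "f x \<in> ideal_smult R J N"
proof -
  interpret M: module R M by fact
  interpret N: module R N by fact
  note h = hom_moduleD[OF f]
  have "submodule {x \<in> carrier M. f x \<in> ideal_smult R J N} R M"
    by (rule submodule_hom_preimage[OF f M N N.ideal_smult_submodule[OF J]])
  then have "ideal_smult R J M \<subseteq> {x \<in> carrier M. f x \<in> ideal_smult R J N}"
  proof (rule M.ideal_smult_min)
    fix a x assume "a \<in> J" "x \<in> carrier M"
    then show "a \<odot>\<^bsub>M\<^esub> x \<in> {x \<in> carrier M. f x \<in> ideal_smult R J N}"
      using h(1,3) J N.ideal_smultI[of a J "f x"] by auto
  qed
  then show ?thesis using x by blast
qed

text \<open>The primes are the maximal ones among the annihilators of non-zero elements of M / N.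
  Every zero divisor lies in such an annihilator because ascending chains of ideals stop; that there
  are only finitely many comes from finite generation of the span of their witnesses.\<close>

lemma zero_divisors_finite_primes:
  fixes R :: "('a, 'r) ring_scheme" (structure) and M :: "('a, 'b, 'm) module_scheme"
  assumes noeth: "noetherian_ring R" and fg: "finitely_generated_module R M" and N: "submodule N R M"
  obtains \<P> where "finite \<P>" "\<And>P. P \<in> \<P> \<Longrightarrow> primeideal P R"
    "\<And>P. P \<in> \<P> \<Longrightarrow> \<exists>x\<in>carrier M - N. P = colon R M N x"
    "\<And>a. a \<in> carrier R \<Longrightarrow> \<not> regular_on M N a \<Longrightarrow> \<exists>P\<in>\<P>. a \<in> P"
proof -
  interpret noetherian_ring R by fact
  interpret module R M using fg by (simp add: finitely_generated_module_def)
  note Ns = submoduleD[OF N]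
  define \<A> where "\<A> = colon R M N ` (carrier M - N)"
  define \<P> where "\<P> = {P \<in> \<A>. \<forall>Q\<in>\<A>. P \<subseteq> Q \<longrightarrow> Q = P}"
  have id: "ideal I R" if "I \<in> \<A>" for I using that colon_ideal[OF N] by (auto simp: \<A>_def)
  have prime: "primeideal P R" if P: "P \<in> \<P>" for P
  proof (rule primeidealI)
    show "ideal P R" using id P by (simp add: \<P>_def)
    show "cring R" by (rule R.cring_axioms)
    obtain x where x: "x \<in> carrier M" "x \<notin> N" "P = colon R M N x" using P by (auto simp: \<P>_def \<A>_def)
    then have "\<one> \<notin> P" by (simp add: colon_def)
    then show "carrier R \<noteq> P" by blast
    fix a b assume ab: "a \<in> carrier R" "b \<in> carrier R" "a \<otimes> b \<in> P"
    show "a \<in> P \<or> b \<in> P"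
    proof (rule disjCI)
      assume b: "b \<notin> P"
      then have bx: "b \<odot>\<^bsub>M\<^esub> x \<notin> N" using ab x by (simp add: colon_def)
      then have "colon R M N (b \<odot>\<^bsub>M\<^esub> x) \<in> \<A>" using x ab by (auto simp: \<A>_def)
      moreover have "P \<subseteq> colon R M N (b \<odot>\<^bsub>M\<^esub> x)"
        using x ab Ns(4) by (auto simp: colon_def smult_commute[of _ b])
      ultimately have "P = colon R M N (b \<odot>\<^bsub>M\<^esub> x)" using P unfolding \<P>_def by blast
      moreover have "a \<in> colon R M N (b \<odot>\<^bsub>M\<^esub> x)"
        using ab x(1) unfolding x(3) by (simp add: colon_def smult_assoc1)
      ultimately show "a \<in> P" by simp
    qed
  qed
  have "\<forall>P\<in>\<P>. \<exists>x. x \<in> carrier M - N \<and> P = colon R M N x" by (auto simp: \<P>_def \<A>_def)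
  then obtain l where l': "\<forall>P\<in>\<P>. l P \<in> carrier M - N \<and> P = colon R M N (l P)" by (rule bchoice[THEN exE])
  have l: "l P \<in> carrier M - N" "P = colon R M N (l P)" if "P \<in> \<P>" for P using l' that by simp_all
  \<comment> \<open>The witnesses of all members of \<open>\<P>\<close> span a finitely generated
    submodule, so finitely many of them, those of \<open>\<P>0\<close>, span it already.\<close>
  let ?G = "gen_submodule R M (l ` \<P>)"
  have lM: "l ` \<P> \<subseteq> carrier M" using l by auto
  obtain S where S: "finite S" "S \<subseteq> carrier M" "gen_submodule R M S = carrier M"
    using fg by (auto simp: finitely_generated_module_def)
  have "?G \<subseteq> gen_submodule R M S" using submoduleD(1)[OF gen_submodule_submodule[OF lM]] S by simp
  then obtain T where T: "finite T" "T \<subseteq> ?G" "gen_submodule R M T = ?G"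
    using submodule_finitely_generated[OF noeth module_axioms S(1,2) gen_submodule_submodule[OF lM]] by blast
  have "\<forall>t\<in>T. \<exists>A. finite A \<and> A \<subseteq> l ` \<P> \<and> t \<in> gen_submodule R M A"
  proof
    fix t assume "t \<in> T"
    then have "t \<in> ?G" using T(2) by blast
    then show "\<exists>A. finite A \<and> A \<subseteq> l ` \<P> \<and> t \<in> gen_submodule R M A"
      by (rule gen_submodule_finite_support[OF lM]) auto
  qed
  then obtain A where A': "\<forall>t\<in>T. finite (A t) \<and> A t \<subseteq> l ` \<P> \<and> t \<in> gen_submodule R M (A t)"
    by (rule bchoice[THEN exE])
  then have A: "finite (A t)" "A t \<subseteq> l ` \<P>" "t \<in> gen_submodule R M (A t)" if "t \<in> T" for t
    using that by simp_all
  have "finite (\<Union>t\<in>T. A t)" "(\<Union>t\<in>T. A t) \<subseteq> l ` \<P>" using T(1) A(1) UN_least[of T A "l ` \<P>", OF A(2)] by auto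
  then obtain \<P>0 where P0: "\<P>0 \<subseteq> \<P>" "finite \<P>0" "(\<Union>t\<in>T. A t) = l ` \<P>0"
    by (meson finite_subset_image)
  have lP0: "l ` \<P>0 \<subseteq> carrier M" using lM P0 by blast
  have "T \<subseteq> gen_submodule R M (l ` \<P>0)"
  proof
    fix t assume "t \<in> T"
    then show "t \<in> gen_submodule R M (l ` \<P>0)"
      using A(3) gen_submodule_mono[of "A t" "l ` \<P>0"] P0(3) by blast
  qed
  then have GP0: "?G \<subseteq> gen_submodule R M (l ` \<P>0)"
    using gen_submodule_min[OF gen_submodule_submodule[OF lP0], of T] T(3) by simp
  have "\<P> \<subseteq> \<P>0"
  proof (rule subsetI, rule ccontr)
    fix P assume P: "P \<in> \<P>" and nP: "P \<notin> \<P>0"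
    have sub: "\<not> Q \<subseteq> P" if "Q \<in> \<P>0" for Q
    proof
      assume "Q \<subseteq> P"
      then have "P = Q" using that P P0(1) unfolding \<P>_def by blast
      then show False using that nP by simp
    qed
    \<comment> \<open>Modulo \<open>N\<close> such an \<open>a\<close> kills the witnesses of
      \<open>\<P>0\<close>, hence their span, hence the witness of \<open>P\<close>. But then
      \<open>a\<close> lies in its annihilator \<open>P\<close>.\<close>
    obtain a where a: "a \<in> carrier R" "a \<notin> P" "\<And>I. I \<in> \<P>0 \<Longrightarrow> a \<in> I"
    proof (rule R.prime_contains_factor[OF prime[OF P] P0(2) _ sub])
      show "ideal I R" if "I \<in> \<P>0" for I using id that P0(1) unfolding \<P>_def by blast
    qed (assumption | rule that)+
    have "submodule {x \<in> carrier M. a \<odot>\<^bsub>M\<^esub> x \<in> N} R M"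
      by (rule submodule_hom_preimage[OF smult_hom[OF a(1)] module_axioms module_axioms N])
    moreover have "l ` \<P>0 \<subseteq> {x \<in> carrier M. a \<odot>\<^bsub>M\<^esub> x \<in> N}"
    proof (intro image_subsetI CollectI conjI)
      fix Q assume Q: "Q \<in> \<P>0"
      then have "Q \<in> \<P>" using P0(1) by blast
      then show "l Q \<in> carrier M" "a \<odot>\<^bsub>M\<^esub> l Q \<in> N"
        using l[of Q] a(3)[OF Q] by (auto simp: colon_def)
    qed
    ultimately have "gen_submodule R M (l ` \<P>0) \<subseteq> {x \<in> carrier M. a \<odot>\<^bsub>M\<^esub> x \<in> N}"
      by (rule gen_submodule_min)
    then have "?G \<subseteq> {x \<in> carrier M. a \<odot>\<^bsub>M\<^esub> x \<in> N}" by (rule subset_trans[OF GP0])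
    then have "a \<odot>\<^bsub>M\<^esub> l P \<in> N" using gen_submodule_incl[of "l ` \<P>"] P by blast
    then have "a \<in> P" using l(2)[OF P] a(1) by (auto simp: colon_def)
    then show False using a by blast
  qed
  then have "finite \<P>" using P0 finite_subset by blast
  moreover have "\<exists>P\<in>\<P>. a \<in> P" if a: "a \<in> carrier R" and nr: "\<not> regular_on M N a" for a
  proof -
    obtain x where x: "x \<in> carrier M - N" "a \<odot>\<^bsub>M\<^esub> x \<in> N" using nr by (auto simp: regular_on_def)
    define \<F> where "\<F> = {I \<in> \<A>. colon R M N x \<subseteq> I}"
    have "\<F> \<noteq> {}" using x by (auto simp: \<F>_def \<A>_def)
    then obtain P where P: "P \<in> \<F>" "\<And>J. J \<in> \<F> \<Longrightarrow> P \<subseteq> J \<Longrightarrow> J = P"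
      using maximal_ideal_in_family[of \<F>] id by (auto simp: \<F>_def)
    have "Q = P" if "Q \<in> \<A>" "P \<subseteq> Q" for Q
      using P(2)[of Q] that P(1) by (auto simp: \<F>_def)
    then have "P \<in> \<P>" using P(1) by (auto simp: \<F>_def \<P>_def)
    moreover have "a \<in> P" using P(1) x a by (auto simp: \<F>_def colon_def)
    ultimately show ?thesis by blast
  qed
  moreover have "\<exists>x\<in>carrier M - N. P = colon R M N x" if "P \<in> \<P>" for P using l that by blast
  ultimately show thesis using that prime by blast
qed

section \<open>Noetherian local rings\<close>

locale noetherian_local = cring R + noetherian_ring R for R (structure) +
  assumes unique_maximal: "\<exists>!m. maximalideal m R"
begin

abbreviation "\<mm> \<equiv> max_ideal R"

lemma maximalideal_max_ideal: "maximalideal \<mm> R"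
  unfolding max_ideal_def by (rule theI') (rule unique_maximal)

lemma ideal_max_ideal: "ideal \<mm> R"
  using maximalideal_max_ideal by (rule maximalideal.axioms(1))

lemmas max_idealD = idealD[OF ideal_max_ideal]

lemma one_notin_max_ideal: "\<one> \<notin> \<mm>"
  using ideal.one_imp_carrier[OF ideal_max_ideal] maximalideal.I_notcarr[OF maximalideal_max_ideal] by blast

lemma proper_ideal_le_max_ideal:
  assumes "ideal I R" "I \<noteq> carrier R" shows "I \<subseteq> \<mm>"
proof -
  define \<F> where "\<F> = {J. ideal J R \<and> J \<noteq> carrier R \<and> I \<subseteq> J}"
  have ne: "\<F> \<noteq> {}" using assms by (auto simp: \<F>_def)
  have id: "ideal J R" if "J \<in> \<F>" for J using that by (simp add: \<F>_def)
  obtain J where J: "J \<in> \<F>" "\<And>K. K \<in> \<F> \<Longrightarrow> J \<subseteq> K \<Longrightarrow> K = J"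
    using maximal_ideal_in_family[OF ne id] by blast
  have "maximalideal J R"
  proof (rule maximalidealI)
    show "ideal J R" "carrier R \<noteq> J" using J(1) by (auto simp: \<F>_def)
    fix K assume K: "ideal K R" "J \<subseteq> K" "K \<subseteq> carrier R"
    have "K \<in> \<F>" if "K \<noteq> carrier R"
      using that K(1) subset_trans[OF _ K(2), of I] J(1) by (simp add: \<F>_def)
    then show "K = J \<or> K = carrier R" using J(2) K(2) by blast
  qed
  then have "J = \<mm>" using maximalideal_max_ideal unique_maximal by blast
  then show ?thesis using J(1) by (auto simp: \<F>_def)
qed

lemma inverse_notin_max_ideal:
  assumes "a \<in> carrier R" "a \<notin> \<mm>" obtains b where "b \<in> carrier R" "b \<otimes> a = \<one>"
proof -
  have "\<not> PIdl a \<subseteq> \<mm>" using assms cgenideal_self by blast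
  then have "PIdl a = carrier R" using proper_ideal_le_max_ideal[OF cgenideal_ideal[OF assms(1)]] by blast
  then have "\<one> \<in> PIdl a" by simp
  then obtain b where "b \<in> carrier R" "b \<otimes> a = \<one>" unfolding cgenideal_def by force
  then show thesis by (rule that)
qed

lemma primeideal_max_ideal: "primeideal \<mm> R"
  by (rule maximalideal_prime) (rule maximalideal_max_ideal)

lemma primeideal_le_max_ideal: "primeideal P R \<Longrightarrow> P \<subseteq> \<mm>"
  using proper_ideal_le_max_ideal primeideal.axioms(1) primeideal.I_notcarr by metis

lemma nakayama:
  fixes M :: "('a, 'c, 'm) module_scheme"
  assumes M: "module R M" and W: "submodule W R M" and "finite S" "S \<subseteq> carrier M"
    and "gen_submodule R M (W \<union> S)
      \<subseteq> gen_submodule R M (W \<union> {c \<odot>\<^bsub>M\<^esub> z | c z. c \<in> \<mm> \<and> z \<in> gen_submodule R M (W \<union> S)})"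
  shows "gen_submodule R M (W \<union> S) \<subseteq> W"
  using assms(3-5)
proof (induction S)
  case empty
  interpret M: module R M by fact
  show ?case using M.gen_submodule_self[OF W] by simp
next
  case (insert s S)
  interpret M: module R M by fact
  have WS: "W \<union> S \<subseteq> carrier M" "s \<in> carrier M" using insert.prems(1) M.submoduleD(1)[OF W] by auto
  define H where "H = gen_submodule R M (W \<union> S)"
  define Z where "Z = gen_submodule R M (W \<union> insert s S)"
  have Z_eq: "Z = gen_submodule R M (insert s (W \<union> S))" by (simp add: Z_def)
  have sH: "submodule H R M" unfolding H_def by (rule M.gen_submodule_submodule[OF WS(1)])
  note H = M.submoduleD[OF sH]
  define K where "K = {y \<oplus>\<^bsub>M\<^esub> c \<odot>\<^bsub>M\<^esub> s | y c. y \<in> H \<and> c \<in> \<mm>}"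
  have KI: "x \<in> K" if "y \<in> H" "c \<in> \<mm>" "x = y \<oplus>\<^bsub>M\<^esub> c \<odot>\<^bsub>M\<^esub> s" for x y c using that by (auto simp: K_def)
  have KE: "\<exists>y c. y \<in> H \<and> c \<in> \<mm> \<and> x = y \<oplus>\<^bsub>M\<^esub> c \<odot>\<^bsub>M\<^esub> s" if "x \<in> K" for x using that by (auto simp: K_def)
  have sK: "submodule K R M"
    unfolding K_def using ideal_max_ideal ideal_iff_submodule[OF cring_axioms]
    by (intro M.submodule_add_cyclic[OF sH _ WS(2)]) blast
  have "W \<union> {c \<odot>\<^bsub>M\<^esub> z | c z. c \<in> \<mm> \<and> z \<in> Z} \<subseteq> K"
  proof (rule Un_least)
    have "W \<subseteq> H" using M.gen_submodule_incl[of "W \<union> S"] by (simp add: H_def)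
    show "W \<subseteq> K"
    proof
      fix x assume "x \<in> W"
      then have "x \<in> H" using \<open>W \<subseteq> H\<close> by blast
      then show "x \<in> K" by (rule KI[OF _ max_idealD(2)]) (use WS H(7)[OF \<open>x \<in> H\<close>] in simp)
    qed
    show "{c \<odot>\<^bsub>M\<^esub> z | c z. c \<in> \<mm> \<and> z \<in> Z} \<subseteq> K"
    proof clarify
      fix c z assume c: "c \<in> \<mm>" and z: "z \<in> Z"
      obtain y a where y: "y \<in> H" "a \<in> carrier R" "z = y \<oplus>\<^bsub>M\<^esub> a \<odot>\<^bsub>M\<^esub> s"
        using z unfolding Z_eq H_def by (rule M.gen_submodule_insert[OF WS])
      have cR: "c \<in> carrier R" using max_idealD(8)[OF c] .
      show "c \<odot>\<^bsub>M\<^esub> z \<in> K"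
        by (rule KI[OF H(4)[OF cR y(1)] max_idealD(5)[OF y(2) c]])
          (use y cR H(7) WS in \<open>simp add: M.smult_r_distr M.smult_assoc1\<close>)
    qed
  qed
  then have "gen_submodule R M (W \<union> {c \<odot>\<^bsub>M\<^esub> z | c z. c \<in> \<mm> \<and> z \<in> Z}) \<subseteq> K"
    by (rule M.gen_submodule_min[OF sK])
  then have ZK: "Z \<subseteq> K" using insert.prems(2) by (simp add: Z_def)
  have "s \<in> Z" using M.gen_submodule_incl[of "W \<union> insert s S"] by (simp add: Z_def)
  then obtain y c where y: "y \<in> H" "c \<in> \<mm>" "s = y \<oplus>\<^bsub>M\<^esub> c \<odot>\<^bsub>M\<^esub> s" using ZK KE by blast
  have cR: "c \<in> carrier R" using max_idealD(8)[OF y(2)] .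
  have "\<one> \<ominus> c \<notin> \<mm>"
  proof
    assume "\<one> \<ominus> c \<in> \<mm>"
    then have "(\<one> \<ominus> c) \<oplus> c \<in> \<mm>" using max_idealD(3) y(2) by blast
    then show False using one_notin_max_ideal cR by (simp add: a_minus_def a_assoc l_neg)
  qed
  then obtain b where b: "b \<in> carrier R" "b \<otimes> (\<one> \<ominus> c) = \<one>"
    using inverse_notin_max_ideal[of "\<one> \<ominus> c"] cR by auto
  have "(\<one> \<ominus> c) \<odot>\<^bsub>M\<^esub> s = s \<ominus>\<^bsub>M\<^esub> c \<odot>\<^bsub>M\<^esub> s"
    using cR WS(2) by (simp add: a_minus_def M.smult_l_distr M.smult_l_minus)
  also have "\<dots> = (y \<oplus>\<^bsub>M\<^esub> c \<odot>\<^bsub>M\<^esub> s) \<ominus>\<^bsub>M\<^esub> c \<odot>\<^bsub>M\<^esub> s" using y(3) by simp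
  also have "\<dots> = y" using H(7)[OF y(1)] cR WS(2) by (simp add: a_minus_def M.M.a_assoc M.M.r_neg)
  finally have "b \<odot>\<^bsub>M\<^esub> ((\<one> \<ominus> c) \<odot>\<^bsub>M\<^esub> s) \<in> H" using H(4)[OF b(1) y(1)] by simp
  then have "s \<in> H" using b cR WS(2) by (simp add: M.smult_assoc1[symmetric])
  then have "insert s (W \<union> S) \<subseteq> H" using M.gen_submodule_incl[of "W \<union> S"] by (simp add: H_def)
  then have "Z \<subseteq> H" unfolding Z_eq by (rule M.gen_submodule_min[OF sH])
  moreover have "H \<subseteq> Z" unfolding H_def Z_eq by (rule M.gen_submodule_mono) blast
  ultimately have "Z = H" by (rule subset_antisym)
  have "H \<subseteq> gen_submodule R M (W \<union> {c \<odot>\<^bsub>M\<^esub> z | c z. c \<in> \<mm> \<and> z \<in> H})"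
    using insert.prems(2) unfolding Z_def[symmetric] \<open>Z = H\<close> .
  then have "H \<subseteq> W" using insert.IH insert.prems(1) by (simp add: H_def)
  then show ?case using \<open>Z = H\<close> by (simp add: Z_def)
qed

lemma ideal_smult_neq_carrier:
  assumes fg: "finitely_generated_module R M" and ne: "carrier M \<noteq> {\<zero>\<^bsub>M\<^esub>}" and J: "J \<subseteq> \<mm>"
  shows "ideal_smult R J M \<noteq> carrier M"
proof
  assume eq: "ideal_smult R J M = carrier M"
  interpret M: module R M using fg by (simp add: finitely_generated_module_def)
  obtain S where S: "finite S" "S \<subseteq> carrier M" "gen_submodule R M S = carrier M"
    using fg by (auto simp: finitely_generated_module_def)
  have z: "submodule {\<zero>\<^bsub>M\<^esub>} R M" by (rule M.zero_submodule)
  have "carrier M \<subseteq> gen_submodule R M ({\<zero>\<^bsub>M\<^esub>} \<union> S)" using M.gen_submodule_mono[of S "{\<zero>\<^bsub>M\<^esub>} \<union> S"] S(3) by blast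
  moreover have "gen_submodule R M ({\<zero>\<^bsub>M\<^esub>} \<union> S) \<subseteq> carrier M"
    using M.gen_submodule_submodule[of "{\<zero>\<^bsub>M\<^esub>} \<union> S"] S by (intro M.submoduleD(1)) auto
  ultimately have gen: "gen_submodule R M ({\<zero>\<^bsub>M\<^esub>} \<union> S) = carrier M" by (rule subset_antisym[rotated])
  have "carrier M \<subseteq> gen_submodule R M ({\<zero>\<^bsub>M\<^esub>} \<union> {c \<odot>\<^bsub>M\<^esub> z | c z. c \<in> \<mm> \<and> z \<in> carrier M})"
    unfolding eq[symmetric] unfolding ideal_smult_def using J
    by (intro M.gen_submodule_mono) (auto simp: eq[unfolded ideal_smult_def])
  then have "gen_submodule R M ({\<zero>\<^bsub>M\<^esub>} \<union> S) \<subseteq> {\<zero>\<^bsub>M\<^esub>}"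
    by (intro nakayama M.module_axioms z S) (simp only: gen)
  then show False using ne gen M.M.zero_closed by auto
qed

end

lemma noetherian_local_ring_iff: "noetherian_local_ring R \<longleftrightarrow> noetherian_local R"
  unfolding noetherian_local_ring_def noetherian_local_def noetherian_local_axioms_def by blast

section \<open>Independence modulo \<mm>^2 and ideals generated by regular sequences\<close>

text \<open>The argument may be any set, because the exchange argument below applies it to an ideal
  together with some generators of \<open>\<mm>\<close>.\<close>

definition add_max_square :: "('a, 'r) ring_scheme \<Rightarrow> 'a set \<Rightarrow> 'a set"
  where "add_max_square R J =
    Idl\<^bsub>R\<^esub> (J \<union> {a \<otimes>\<^bsub>R\<^esub> b | a b. a \<in> max_ideal R \<and> b \<in> max_ideal R})"

context noetherian_local begin

lemma max_square_carrier: "J \<subseteq> carrier R \<Longrightarrow> J \<union> {a \<otimes> b | a b. a \<in> \<mm> \<and> b \<in> \<mm>} \<subseteq> carrier R"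
  using max_idealD(8) by auto

lemma add_max_square:
  assumes "J \<subseteq> carrier R"
  shows add_max_square_ideal: "ideal (add_max_square R J) R"
    and add_max_square_incl: "J \<subseteq> add_max_square R J"
    and add_max_square_prod: "a \<in> \<mm> \<Longrightarrow> b \<in> \<mm> \<Longrightarrow> a \<otimes> b \<in> add_max_square R J"
proof -
  note * = max_square_carrier[OF assms]
  show "ideal (add_max_square R J) R" unfolding add_max_square_def by (rule genideal_ideal[OF *])
  show "J \<subseteq> add_max_square R J" "a \<in> \<mm> \<Longrightarrow> b \<in> \<mm> \<Longrightarrow> a \<otimes> b \<in> add_max_square R J"
    using genideal_self[OF *] unfolding add_max_square_def by blast+
qed

lemma add_max_square_min:
  assumes "ideal I R" "J \<subseteq> I" "\<And>a b. a \<in> \<mm> \<Longrightarrow> b \<in> \<mm> \<Longrightarrow> a \<otimes> b \<in> I"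
  shows "add_max_square R J \<subseteq> I"
  unfolding add_max_square_def by (rule genideal_minimal[OF assms(1)]) (use assms in auto)

lemma finitely_generated_ring_as_module: "finitely_generated_module R (ring_as_module R)"
proof -
  have "Idl {\<one>} = carrier R" by (rule genideal_one)
  then have "gen_submodule R (ring_as_module R) {\<one>} = carrier R"
    using genideal_eq_gen_submodule[OF cring_axioms] by metis
  then show ?thesis unfolding finitely_generated_module_def
    by (intro conjI ring_as_module exI[of _ "{\<one>}"]) auto
qed

text \<open>Otherwise \<mm> / J would equal \<mm> times itself and vanish by Nakayama. So there is
  always room for a further element outside J + \<mm>^2.\<close>

lemma add_max_square_neq_max_ideal:
  assumes J: "ideal J R" "J \<subseteq> \<mm>" "J \<noteq> \<mm>" shows "add_max_square R J \<noteq> \<mm>"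
proof
  assume eq: "add_max_square R J = \<mm>"
  interpret RM: module R "ring_as_module R" by (rule ring_as_module)
  obtain S where S: "S \<subseteq> carrier R" "finite S" "\<mm> = Idl S" using finetely_gen[OF ideal_max_ideal] by blast
  note gen = genideal_eq_gen_submodule[OF cring_axioms]
  have "S \<subseteq> \<mm>" using genideal_self[OF S(1)] S(3) by simp
  have JS: "gen_submodule R (ring_as_module R) (J \<union> S) = \<mm>"
  proof
    show "gen_submodule R (ring_as_module R) (J \<union> S) \<subseteq> \<mm>"
      unfolding gen[symmetric] using J \<open>S \<subseteq> \<mm>\<close> by (intro genideal_minimal ideal_max_ideal) auto
    show "\<mm> \<subseteq> gen_submodule R (ring_as_module R) (J \<union> S)"
      unfolding S(3) gen by (rule RM.gen_submodule_mono) blast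
  qed
  have "gen_submodule R (ring_as_module R) (J \<union> S) \<subseteq> J"
  proof (rule nakayama[OF ring_as_module _ S(2)])
    show "submodule J R (ring_as_module R)" using J(1) ideal_iff_submodule[OF cring_axioms] by blast
    show "S \<subseteq> carrier (ring_as_module R)" using S by simp
    show "gen_submodule R (ring_as_module R) (J \<union> S) \<subseteq> gen_submodule R (ring_as_module R)
       (J \<union> {c \<odot>\<^bsub>ring_as_module R\<^esub> z |c z. c \<in> \<mm> \<and> z \<in> gen_submodule R (ring_as_module R) (J \<union> S)})"
      unfolding JS unfolding ring_as_module_simps gen[symmetric] using eq by (simp add: add_max_square_def)
  qed
  then show False using J JS by blast
qed

end

text \<open>The ideals \<open>(x\<^sub>1, \<dots>, x\<^sub>j)\<close> for sequences \<open>x\<close> in \<open>\<mm>\<close> that are regular on \<open>R\<close> and on \<open>M\<close> and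
  linearly independent modulo \<open>\<mm>\<^sup>2\<close>.\<close>

inductive regular_ideal :: "('a, 'r) ring_scheme \<Rightarrow> ('a, 'b, 'm) module_scheme \<Rightarrow> nat \<Rightarrow> 'a set \<Rightarrow> bool"
  for R M where
  zero: "regular_ideal R M 0 {\<zero>\<^bsub>R\<^esub>}"
| step: "regular_ideal R M j J \<Longrightarrow> a \<in> max_ideal R \<Longrightarrow> a \<notin> add_max_square R J \<Longrightarrow>
    regular_on (ring_as_module R) J a \<Longrightarrow> regular_on M (ideal_smult R J M) a \<Longrightarrow>
    regular_ideal R M (Suc j) (adjoin R J a)"

context noetherian_local begin

lemma regular_ideal:
  assumes "regular_ideal R M j J" shows "ideal J R" "J \<subseteq> \<mm>"
  using assms
proof (induction rule: regular_ideal.induct)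
  case zero
  { case 1 show ?case by (rule zeroideal) }
  { case 2 show ?case using max_idealD(2) by blast }
next
  case (step j J a)
  { case 1 show ?case using step.IH(1) max_idealD(8)[OF step.hyps(2)] by (rule adjoin_ideal) }
  { case 2 show ?case using ideal_max_ideal step.IH(2) step.hyps(2) by (rule adjoin_min) }
qed

lemma regular_ideal_generators:
  assumes "regular_ideal R M j J"
  shows "\<exists>S. finite S \<and> card S \<le> j \<and> S \<subseteq> carrier R \<and> Idl S = J"
  using assms
proof (induction rule: regular_ideal.induct)
  case zero
  then show ?case by (intro exI[of _ "{}"]) (simp add: genideal_empty)
next
  case (step j J a)
  then obtain S where S: "finite S" "card S \<le> j" "S \<subseteq> carrier R" "Idl S = J" by blast
  have a: "a \<in> carrier R" using max_idealD(8)[OF step.hyps(2)] .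
  show ?case
    by (rule exI[of _ "insert a S"]) (use S a in \<open>auto simp: genideal_insert card_insert_if\<close>)
qed

text \<open>Steinitz exchange in \<mm> / \<mm>^2: each element adjoined to \<open>J\<close> replaces
  one generator in \<open>S\<close>. The consequence needed is that \<open>j\<close> is at most the
  number of generators of \<open>\<mm>\<close>.\<close>

lemma regular_ideal_le_card:
  assumes "regular_ideal R M j J" and S: "finite S" "S \<subseteq> carrier R" "Idl S = \<mm>"
  shows "\<exists>T\<subseteq>S. card T + j = card S \<and> \<mm> \<subseteq> add_max_square R (J \<union> T)"
  using assms(1)
proof (induction rule: regular_ideal.induct)
  case zero
  have c: "{\<zero>} \<union> S \<subseteq> carrier R" using S by simp
  have "Idl S \<subseteq> add_max_square R ({\<zero>} \<union> S)"
    using add_max_square_incl[OF c] by (intro genideal_minimal add_max_square_ideal[OF c]) auto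
  then show ?case using S(3) by (intro exI[of _ S]) simp
next
  case (step j J a)
  then obtain T where T: "T \<subseteq> S" "card T + j = card S" "\<mm> \<subseteq> add_max_square R (J \<union> T)" by blast
  note J = regular_ideal[OF step.hyps(1)]
  have JR: "J \<subseteq> carrier R" by (rule idealD(1)[OF J(1)])
  have TR: "T \<subseteq> carrier R" using T(1) S(2) by (rule subset_trans)
  have fT: "finite T" using T(1) S(1) by (rule finite_subset)
  have aR: "a \<in> carrier R" using max_idealD(8)[OF step.hyps(2)] .
  \<comment> \<open>For an \<open>A\<close> of least size, every \<open>t\<close> in
    \<open>A\<close> really occurs in the expression of \<open>a\<close>, so \<open>t\<close> can be
    exchanged for \<open>a\<close>. \<open>A\<close> is non-empty because \<open>a\<close> avoids J
    + \<mm>^2.\<close>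
  define Q where "Q A \<longleftrightarrow> A \<subseteq> T \<and> a \<in> add_max_square R (J \<union> A)" for A
  have "Q T" using T(3) step.hyps(2) by (auto simp: Q_def)
  then obtain A where A: "Q A" "\<And>B. Q B \<Longrightarrow> card A \<le> card B"
    using ex_has_least_nat[of Q T card] by blast
  have AT: "A \<subseteq> T" using A(1) by (simp add: Q_def)
  have fA: "finite A" using AT fT by (rule finite_subset)
  have "A \<noteq> {}" using A(1) step.hyps(3) by (auto simp: Q_def)
  then obtain t where t: "t \<in> A" by blast
  define B where "B = add_max_square R (J \<union> (A - {t}))"
  have BR: "J \<union> (A - {t}) \<subseteq> carrier R" using JR TR AT by blast
  have idB: "ideal B R" unfolding B_def by (rule add_max_square_ideal[OF BR])
  have tT: "t \<in> T" using t AT by blast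
  have tR: "t \<in> carrier R" using tT TR by blast
  have tm: "t \<in> \<mm>" using genideal_self[OF S(2)] tT T(1) S(3) by blast
  have "\<not> Q (A - {t})"
    using A(2)[of "A - {t}"] card_Diff1_less[OF fA t] by auto
  then have aB: "a \<notin> B" using AT unfolding Q_def B_def by blast
  have "J \<union> A \<union> {a \<otimes> b |a b. a \<in> \<mm> \<and> b \<in> \<mm>} =
      insert t (J \<union> (A - {t}) \<union> {a \<otimes> b |a b. a \<in> \<mm> \<and> b \<in> \<mm>})" using t by blast
  then have "add_max_square R (J \<union> A) = adjoin R B t"
    unfolding add_max_square_def B_def using genideal_insert[OF max_square_carrier[OF BR] tR] by simp
  then have "a \<in> adjoin R B t" using A(1) by (simp add: Q_def)
  then obtain b r where b: "b \<in> B" "r \<in> carrier R" "a = b \<oplus> r \<otimes> t" by (rule adjoinE)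
  \<comment> \<open>Otherwise \<open>r t\<close> would lie in \<mm>^2, and \<open>t\<close> could be
    removed from \<open>A\<close>. So \<open>r\<close> is a unit and the equation can be solved for
    \<open>t\<close>.\<close>
  have "r \<notin> \<mm>"
  proof
    assume "r \<in> \<mm>"
    then have "r \<otimes> t \<in> B" using tm add_max_square_prod[OF BR] by (simp add: B_def)
    then show False using aB b idealD(3)[OF idB] by blast
  qed
  then obtain u where u: "u \<in> carrier R" "u \<otimes> r = \<one>" using inverse_notin_max_ideal[OF b(2)] by blast
  define C where "C = add_max_square R (adjoin R J a \<union> (T - {t}))"
  have CR: "adjoin R J a \<union> (T - {t}) \<subseteq> carrier R"
    using idealD(1)[OF adjoin_ideal[OF J(1) aR]] TR by blast
  have idC: "ideal C R" unfolding C_def by (rule add_max_square_ideal[OF CR])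
  have inC: "adjoin R J a \<union> (T - {t}) \<subseteq> C" unfolding C_def by (rule add_max_square_incl[OF CR])
  have JC: "J \<subseteq> C" using inC adjoin_incl[OF J(1) aR] by blast
  have aC: "a \<in> C" using inC adjoin_elem[OF J(1) aR] by blast
  have pC: "x \<otimes> y \<in> C" if "x \<in> \<mm>" "y \<in> \<mm>" for x y
    using that add_max_square_prod[OF CR] by (simp add: C_def)
  have "J \<union> (A - {t}) \<subseteq> C" using JC inC AT by blast
  then have BC: "B \<subseteq> C" unfolding B_def using pC by (rule add_max_square_min[OF idC])
  have bR: "b \<in> carrier R" using idealD(8)[OF idB b(1)] .
  have "a \<ominus> b = r \<otimes> t" using b bR tR by (simp add: a_minus_def a_assoc a_comm[of b] r_neg)
  then have "r \<otimes> t \<in> C" using idealD(7)[OF idC aC, of b] b(1) BC by auto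
  then have "u \<otimes> (r \<otimes> t) \<in> C" by (rule idealD(4)[OF idC u(1)])
  then have "t \<in> C" using u b(2) tR by (simp add: m_assoc[symmetric])
  then have "J \<union> T \<subseteq> C" using JC inC by blast
  then have "add_max_square R (J \<union> T) \<subseteq> C" using pC by (rule add_max_square_min[OF idC])
  then have "\<mm> \<subseteq> C" using T(3) by (rule subset_trans[rotated])
  moreover have "card (T - {t}) + Suc j = card S"
    using T(2) card_Suc_Diff1[OF fT tT] by simp
  ultimately show ?case using T(1) unfolding C_def by (intro exI[of _ "T - {t}"]) auto
qed

text \<open>An ideal over \<open>J\<close> maximal among those disjoint from the multiplicative set
  of all c a^n with c outside \<open>P\<close> is prime. It lies in \<open>P\<close> (take n = 0)
  and misses \<open>a\<close> (take c = 1, n = 1). Regularity of \<open>a\<close> makes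
  \<open>J\<close> itself disjoint from the set: c a^n in \<open>J\<close> gives c in
  \<open>J\<close>, hence in \<open>P\<close>.\<close>

lemma prime_below_regular_element:
  assumes J: "ideal J R" and a: "a \<in> carrier R" "regular_on (ring_as_module R) J a"
    and P: "primeideal P R" "J \<subseteq> P" "a \<in> P"
  obtains Q where "primeideal Q R" "J \<subseteq> Q" "Q \<subset> P"
proof -
  interpret P: primeideal P R by fact
  define S where "S = {c \<otimes> a [^] n | c n. c \<in> carrier R - P \<and> n \<in> (UNIV :: nat set)}"
  have SI: "x \<in> S" if "c \<in> carrier R" "c \<notin> P" "x = c \<otimes> a [^] (n::nat)" for c n x
    using that by (auto simp: S_def)
  have SE: "\<exists>c (n::nat). c \<in> carrier R \<and> c \<notin> P \<and> x = c \<otimes> a [^] n" if "x \<in> S" for x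
    using that by (auto simp: S_def)
  have one: "\<one> \<notin> P" using P.one_imp_carrier P.I_notcarr by blast
  define \<F> where "\<F> = {I. ideal I R \<and> J \<subseteq> I \<and> I \<inter> S = {}}"
  have reg: "c \<in> J" if "c \<in> carrier R" "c \<otimes> a [^] n \<in> J" for c and n :: nat
    using that
  proof (induction n)
    case (Suc n)
    have "c \<otimes> a [^] Suc n = a \<otimes> (c \<otimes> a [^] n)"
      using Suc.prems(1) a(1) by (simp add: m_ac)
    then have "c \<otimes> a [^] n \<in> J" using Suc.prems a by (simp add: regular_on_def)
    then show ?case using Suc by blast
  qed simp
  have "J \<inter> S = {}" using SE reg P(2) by blast
  then have "J \<in> \<F>" using J by (simp add: \<F>_def)
  then have ne: "\<F> \<noteq> {}" by blast
  have id: "ideal I R" if "I \<in> \<F>" for I using that by (simp add: \<F>_def)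
  obtain Q where Q: "Q \<in> \<F>" "\<And>I. I \<in> \<F> \<Longrightarrow> Q \<subseteq> I \<Longrightarrow> I = Q"
    using maximal_ideal_in_family[OF ne id] by blast
  have idQ: "ideal Q R" and JQ: "J \<subseteq> Q" and QS: "Q \<inter> S = {}" using Q(1) by (auto simp: \<F>_def)
  note Qd = idealD[OF idQ]
  have meets: "\<exists>q r c (n::nat). q \<in> Q \<and> r \<in> carrier R \<and> c \<in> carrier R \<and> c \<notin> P \<and> q \<oplus> r \<otimes> x = c \<otimes> a [^] n"
    if x: "x \<in> carrier R" "x \<notin> Q" for x
  proof -
    have "adjoin R Q x \<notin> \<F>"
      using Q(2)[of "adjoin R Q x"] adjoin_incl[OF idQ x(1)] adjoin_elem[OF idQ x(1)] x(2) by blast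
    then have "adjoin R Q x \<inter> S \<noteq> {}"
      using adjoin_ideal[OF idQ x(1)] subset_trans[OF JQ adjoin_incl[OF idQ x(1)]] by (simp add: \<F>_def)
    then obtain z where z: "z \<in> adjoin R Q x" "z \<in> S" by blast
    obtain q r where q: "q \<in> Q" "r \<in> carrier R" "z = q \<oplus> r \<otimes> x" using z(1) by (rule adjoinE)
    then show ?thesis using SE[OF z(2)] by metis
  qed
  have "primeideal Q R"
  proof (rule primeidealI)
    have "\<one> \<in> S" by (rule SI[of \<one> _ 0]) (use one in auto)
    then show "carrier R \<noteq> Q" using QS by blast
    fix x y assume xy: "x \<in> carrier R" "y \<in> carrier R" "x \<otimes> y \<in> Q"
    show "x \<in> Q \<or> y \<in> Q"
    proof (rule ccontr)
      assume "\<not> (x \<in> Q \<or> y \<in> Q)"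
      then have n: "x \<notin> Q" "y \<notin> Q" by auto
      obtain q r c and n :: nat where 1: "q \<in> Q" "r \<in> carrier R" "c \<in> carrier R" "c \<notin> P" "q \<oplus> r \<otimes> x = c \<otimes> a [^] n"
        using meets[OF xy(1) n(1)] by blast
      obtain q' r' c' and n' :: nat where 2: "q' \<in> Q" "r' \<in> carrier R" "c' \<in> carrier R" "c' \<notin> P" "q' \<oplus> r' \<otimes> y = c' \<otimes> a [^] n'"
        using meets[OF xy(2) n(2)] by blast
      have qR: "q \<in> carrier R" "q' \<in> carrier R" using 1 2 Qd(8) by auto
      have "(q \<oplus> r \<otimes> x) \<otimes> (q' \<oplus> r' \<otimes> y) = (q \<otimes> (q' \<oplus> r' \<otimes> y) \<oplus> (r \<otimes> x) \<otimes> q') \<oplus> (r \<otimes> r') \<otimes> (x \<otimes> y)"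
        using qR 1(2) 2(2) xy(1,2) by (simp add: l_distr r_distr a_ac m_ac)
      also have "\<dots> \<in> Q"
        by (rule Qd(3)[OF Qd(3)[OF Qd(5)[OF _ 1(1)] Qd(4)[OF _ 2(1)]] Qd(4)[OF _ xy(3)]])
          (use 1(2) 2(2) qR xy(1,2) in simp_all)
      finally have "(q \<oplus> r \<otimes> x) \<otimes> (q' \<oplus> r' \<otimes> y) \<in> Q" .
      moreover have "(c \<otimes> a [^] n) \<otimes> (c' \<otimes> a [^] n') \<in> S"
      proof (rule SI)
        show "c \<otimes> c' \<in> carrier R" using 1 2 by simp
        show "c \<otimes> c' \<notin> P" using P.I_prime[OF 1(3) 2(3)] 1 2 by blast
        show "(c \<otimes> a [^] n) \<otimes> (c' \<otimes> a [^] n') = (c \<otimes> c') \<otimes> a [^] (n + n')"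
          using 1(3) 2(3) a(1) by (simp add: nat_pow_mult[symmetric] m_ac)
      qed
      ultimately show False using QS 1 2 by auto
    qed
  qed (use idQ cring_axioms in auto)
  moreover have "Q \<subseteq> P"
  proof
    fix x assume x: "x \<in> Q"
    show "x \<in> P"
    proof (rule ccontr)
      assume "x \<notin> P"
      then have "x \<in> S" by (intro SI[of x x 0]) (use Qd(8)[OF x] in auto)
      then show False using QS x by blast
    qed
  qed
  moreover have "a \<notin> Q"
  proof -
    have "a \<in> S" by (rule SI[of \<one> _ 1]) (use one a in auto)
    then show ?thesis using QS by blast
  qed
  ultimately show thesis using that JQ P(3) by blast
qed

text \<open>Each regular element allows one proper step down, so a prime over \<open>J\<close> has
  height at least \<open>j\<close>. This is the link with the Krull dimension.\<close>

lemma prime_chain_regular_ideal: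
  assumes "regular_ideal R M j J" "primeideal P R" "J \<subseteq> P"
  shows "\<exists>Q. (\<forall>i\<le>j. primeideal (Q i) R) \<and> (\<forall>i<j. Q i \<subset> Q (Suc i)) \<and> Q j = P"
  using assms
proof (induction arbitrary: P rule: regular_ideal.induct)
  case zero
  then show ?case by (intro exI[of _ "\<lambda>_. P"]) simp
next
  case (step j J a)
  note J = regular_ideal[OF step.hyps(1)]
  have aR: "a \<in> carrier R" using max_idealD(8)[OF step.hyps(2)] .
  have "J \<subseteq> P" "a \<in> P" using step.prems(2) adjoin_incl[OF J(1) aR] adjoin_elem[OF J(1) aR] by auto
  then obtain P' where P': "primeideal P' R" "J \<subseteq> P'" "P' \<subset> P"
    using prime_below_regular_element[OF J(1) aR step.hyps(4) step.prems(1)] by blast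
  then obtain Q where Q: "\<forall>i\<le>j. primeideal (Q i) R" "\<forall>i<j. Q i \<subset> Q (Suc i)" "Q j = P'"
    using step.IH by blast
  show ?case
    by (rule exI[of _ "Q(Suc j := P)"]) (use Q P' step.prems(1) in \<open>auto simp: le_Suc_eq less_Suc_eq\<close>)
qed

text \<open>R / J is non-zero, so some annihilator of a non-zero class is prime; it contains
  \<open>J\<close> and therefore can only be \<open>\<mm>\<close>.\<close>

lemma exists_socle_element:
  assumes J: "ideal J R" "J \<noteq> carrier R" and P: "\<And>P. primeideal P R \<Longrightarrow> J \<subseteq> P \<Longrightarrow> P = \<mm>"
  shows "\<exists>s\<in>carrier R - J. colon R (ring_as_module R) J s = \<mm>"
proof -
  interpret RM: module R "ring_as_module R" by (rule ring_as_module)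
  have sJ: "submodule J R (ring_as_module R)" using J(1) ideal_iff_submodule[OF cring_axioms] by blast
  obtain \<P> where \<P>: "\<And>P. P \<in> \<P> \<Longrightarrow> primeideal P R"
    "\<And>P. P \<in> \<P> \<Longrightarrow> \<exists>x\<in>carrier (ring_as_module R) - J. P = colon R (ring_as_module R) J x"
    "\<And>a. a \<in> carrier R \<Longrightarrow> \<not> regular_on (ring_as_module R) J a \<Longrightarrow> \<exists>P\<in>\<P>. a \<in> P"
    using zero_divisors_finite_primes[OF noetherian_ring_axioms finitely_generated_ring_as_module sJ] by metis
  have "\<one> \<notin> J" using ideal.one_imp_carrier[OF J(1)] J(2) by blast
  \<comment> \<open>Zero is a zero divisor on R / J; this serves to produce a member of
    \<open>\<P>\<close>.\<close>
  then have "\<not> regular_on (ring_as_module R) J \<zero>"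
    using idealD(2)[OF J(1)] by (auto simp: regular_on_def intro!: bexI[of _ \<one>])
  then obtain p where p: "p \<in> \<P>" using \<P>(3)[of \<zero>] by blast
  then obtain s where s: "s \<in> carrier R - J" "p = colon R (ring_as_module R) J s" using \<P>(2)[OF p] by auto
  have "J \<subseteq> p" using s idealD(5)[OF J(1)] idealD(8)[OF J(1)] by (auto simp: colon_def)
  then show ?thesis using P[OF \<P>(1)[OF p]] s by blast
qed

end

section \<open>Exchange in regular sequences and the reduction to socles\<close>

text \<open>Regular sequences on M / J M, read from the front with a growing base ideal and without
  the properness clause, so that inductions may change \<open>J\<close>.\<close>

fun regular_list :: "('a, 'r) ring_scheme \<Rightarrow> ('a, 'b, 'm) module_scheme \<Rightarrow> 'a set \<Rightarrow> 'a list \<Rightarrow> bool" where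
  "regular_list R M J [] \<longleftrightarrow> True"
| "regular_list R M J (y # ys) \<longleftrightarrow>
    regular_on M (ideal_smult R J M) y \<and> regular_list R M (adjoin R J y) ys"

text \<open>These are the ideals modulo which the successive entries are required to be regular; the
  ideal generated by \<open>J\<close> and the complete list is left out.\<close>

fun prefix_ideals :: "('a, 'r) ring_scheme \<Rightarrow> 'a set \<Rightarrow> 'a list \<Rightarrow> 'a set list" where
  "prefix_ideals R J [] = []"
| "prefix_ideals R J (y # ys) = J # prefix_ideals R (adjoin R J y) ys"

context noetherian_local begin

lemma prefix_ideals_regular:
  assumes "ideal J R" "regular_list R M J ys" "set ys \<subseteq> carrier R" "I \<in> set (prefix_ideals R J ys)"
  shows "ideal I R \<and> (\<exists>y\<in>set ys. regular_on M (ideal_smult R I M) y)"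
  using assms
proof (induction ys arbitrary: J)
  case (Cons y ys)
  show ?case
  proof (cases "I = J")
    case False
    then show ?thesis using Cons.IH[of "adjoin R J y"] Cons.prems adjoin_ideal[OF Cons.prems(1), of y] by auto
  qed (use Cons.prems in auto)
qed simp

text \<open>Suppose \<open>y x = u + a z\<close>. Then \<open>a z\<close> vanishes modulo (J, y), so
  \<open>z = v + y w\<close> by regularity of \<open>a\<close>. Now \<open>y (x - a w)\<close> lies
  in J M, and regularity of \<open>y\<close> modulo \<open>J\<close> gives \<open>x\<close> in (J,
  a) M.\<close>

lemma regular_on_swap:
  fixes M :: "('a, 'c, 'm) module_scheme"
  assumes M: "module R M" and J: "ideal J R" and ab: "a \<in> carrier R" "y \<in> carrier R"
    and y: "regular_on M (ideal_smult R J M) y" and a: "regular_on M (ideal_smult R (adjoin R J y) M) a"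
  shows "regular_on M (ideal_smult R (adjoin R J a) M) y"
  unfolding regular_on_def
proof (intro ballI impI)
  interpret M: module R M by fact
  note U = M.submoduleD[OF M.ideal_smult_submodule[OF idealD(1)[OF J]]]
  fix x assume x: "x \<in> carrier M" and "y \<odot>\<^bsub>M\<^esub> x \<in> ideal_smult R (adjoin R J a) M"
  then obtain u z where uz: "u \<in> ideal_smult R J M" "z \<in> carrier M" "y \<odot>\<^bsub>M\<^esub> x = u \<oplus>\<^bsub>M\<^esub> a \<odot>\<^bsub>M\<^esub> z"
    using M.ideal_smult_adjoinE[OF J ab(1)] by metis
  have uM: "u \<in> carrier M" using U(7) uz(1) .
  have "a \<odot>\<^bsub>M\<^esub> z = \<ominus>\<^bsub>M\<^esub> u \<oplus>\<^bsub>M\<^esub> y \<odot>\<^bsub>M\<^esub> x"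
    using uz uM ab by (simp add: M.M.a_assoc[symmetric] M.M.l_neg)
  also have "\<dots> \<in> ideal_smult R (adjoin R J y) M"
    using U(5)[OF uz(1)] x by (rule M.smult_in_ideal_smult_adjoin[OF J ab(2)])
  finally have "z \<in> ideal_smult R (adjoin R J y) M" using a uz(2) by (simp add: regular_on_def)
  then obtain v w where vw: "v \<in> ideal_smult R J M" "w \<in> carrier M" "z = v \<oplus>\<^bsub>M\<^esub> y \<odot>\<^bsub>M\<^esub> w"
    by (rule M.ideal_smult_adjoinE[OF J ab(2)])
  have vM: "v \<in> carrier M" using U(7) vw(1) .
  have "y \<odot>\<^bsub>M\<^esub> x = (u \<oplus>\<^bsub>M\<^esub> a \<odot>\<^bsub>M\<^esub> v) \<oplus>\<^bsub>M\<^esub> y \<odot>\<^bsub>M\<^esub> (a \<odot>\<^bsub>M\<^esub> w)"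
    using uz(3) vw uM vM ab by (simp add: M.smult_r_distr M.M.a_assoc M.smult_commute[of a y])
  then have "y \<odot>\<^bsub>M\<^esub> (x \<ominus>\<^bsub>M\<^esub> a \<odot>\<^bsub>M\<^esub> w) = u \<oplus>\<^bsub>M\<^esub> a \<odot>\<^bsub>M\<^esub> v"
    using x vw uM vM ab by (simp add: M.smult_minus_distr) (simp add: a_minus_def M.M.a_assoc M.M.r_neg)
  also have "\<dots> \<in> ideal_smult R J M" using U(3)[OF uz(1) U(4)[OF ab(1) vw(1)]] .
  finally have "x \<ominus>\<^bsub>M\<^esub> a \<odot>\<^bsub>M\<^esub> w \<in> ideal_smult R J M"
    using y x vw(2) ab by (simp add: regular_on_def)
  then have "(x \<ominus>\<^bsub>M\<^esub> a \<odot>\<^bsub>M\<^esub> w) \<oplus>\<^bsub>M\<^esub> a \<odot>\<^bsub>M\<^esub> w \<in> ideal_smult R (adjoin R J a) M"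
    using vw(2) by (rule M.smult_in_ideal_smult_adjoin[OF J ab(1)])
  then show "x \<in> ideal_smult R (adjoin R J a) M" using x vw(2) ab by (simp add: M.add_minus_cancel)
qed

text \<open>Swapping \<open>a\<close> past each entry moves it to the front. The last entry has to
  go because nothing is known about \<open>a\<close> modulo the ideal of the complete list.\<close>

lemma regular_list_exchange:
  fixes M :: "('a, 'c, 'm) module_scheme"
  assumes "module R M" "ideal J R" "a \<in> carrier R" "set ys \<subseteq> carrier R" "regular_list R M J ys"
    and "\<And>I. I \<in> set (prefix_ideals R J ys) \<Longrightarrow> regular_on M (ideal_smult R I M) a"
  shows "regular_list R M (adjoin R J a) (butlast ys)"
  using assms(2-)
proof (induction ys arbitrary: J)
  case (Cons y ys)
  show ?case
  proof (cases ys)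
    case (Cons y' ys')
    have y: "y \<in> carrier R" using Cons.prems by simp
    have "regular_on M (ideal_smult R (adjoin R J y) M) a" using Cons.prems(5) Cons by simp
    then have "regular_on M (ideal_smult R (adjoin R J a) M) y"
      using Cons.prems(4) by (intro regular_on_swap[OF assms(1) Cons.prems(1,2) y]) auto
    moreover have "regular_list R M (adjoin R (adjoin R J y) a) (butlast ys)"
      using Cons.prems adjoin_ideal[OF Cons.prems(1) y] by (intro Cons.IH) auto
    ultimately show ?thesis using Cons adjoin_commute[OF Cons.prems(1,2) y] by simp
  qed simp
qed simp

lemma regular_list_of_regular_sequence:
  assumes "regular_sequence R M xs"
  shows "regular_list R M {\<zero>} xs"
proof -
  have xs: "set xs \<subseteq> carrier R" using assms by (simp add: regular_sequence_def)
  \<comment> \<open>Downward induction on the length of the prefix, starting from the empty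
    remainder.\<close>
  have "regular_list R M (Idl (set (take i xs))) (drop i xs)" if "i \<le> length xs" for i
    using that
  proof (induction rule: inc_induct)
    case (step i)
    have i: "xs ! i \<in> carrier R" "set (take i xs) \<subseteq> carrier R"
      using step.hyps xs set_take_subset[of i xs] nth_mem[of i xs] by auto
    have "set (take (Suc i) xs) = insert (xs ! i) (set (take i xs))"
      using step.hyps by (simp add: take_Suc_conv_app_nth)
    then have "Idl (set (take (Suc i) xs)) = adjoin R (Idl (set (take i xs))) (xs ! i)"
      using genideal_insert[OF i(2,1)] by simp
    moreover have "drop i xs = xs ! i # drop (Suc i) xs" using step.hyps by (simp add: Cons_nth_drop_Suc)
    ultimately show ?case
      using step assms by (auto simp: regular_sequence_def regular_on_def)
  qed simp
  from this[of 0] show ?thesis by (simp add: genideal_empty)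
qed

text \<open>Prime avoidance against the maximal annihilator primes of R / J and of all M / I M. None
  of them is \<open>\<mm>\<close>: for R / J by the hypothesis on socles, for M / I M because
  \<open>\<mm>\<close> contains an element regular there.\<close>

lemma exists_regular_element:
  fixes M :: "('a, 'c, 'm) module_scheme"
  assumes fg: "finitely_generated_module R M"
    and J: "ideal J R" "J \<subseteq> \<mm>" "J \<noteq> \<mm>"
    and socle: "\<And>s. s \<in> carrier R - J \<Longrightarrow> colon R (ring_as_module R) J s \<noteq> \<mm>"
    and "finite \<I>" "\<And>I. I \<in> \<I> \<Longrightarrow> ideal I R"
      "\<And>I. I \<in> \<I> \<Longrightarrow> \<exists>y\<in>\<mm>. regular_on M (ideal_smult R I M) y"
  shows "\<exists>a\<in>\<mm>. a \<notin> add_max_square R J \<and> regular_on (ring_as_module R) J a \<and>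
    (\<forall>I\<in>\<I>. regular_on M (ideal_smult R I M) a)"
proof -
  interpret M: module R M using fg by (simp add: finitely_generated_module_def)
  have sJ: "submodule J R (ring_as_module R)" using J(1) ideal_iff_submodule[OF cring_axioms] by blast
  have prime_neq: "\<not> \<mm> \<subseteq> P" if "primeideal P R" "P \<noteq> \<mm>" for P
    using that primeideal_le_max_ideal by blast
  have "\<exists>\<P>. finite \<P> \<and> (\<forall>P\<in>\<P>. primeideal P R \<and> \<not> \<mm> \<subseteq> P) \<and>
      (\<forall>a\<in>carrier R. \<not> regular_on (ring_as_module R) J a \<longrightarrow> (\<exists>P\<in>\<P>. a \<in> P))"
  proof -
    obtain \<P> where \<P>: "finite \<P>" "\<And>P. P \<in> \<P> \<Longrightarrow> primeideal P R"
      "\<And>P. P \<in> \<P> \<Longrightarrow> \<exists>x\<in>carrier (ring_as_module R) - J. P = colon R (ring_as_module R) J x"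
      "\<And>a. a \<in> carrier R \<Longrightarrow> \<not> regular_on (ring_as_module R) J a \<Longrightarrow> \<exists>P\<in>\<P>. a \<in> P"
      using zero_divisors_finite_primes[OF noetherian_ring_axioms finitely_generated_ring_as_module sJ] by metis
    have "P \<noteq> \<mm>" if "P \<in> \<P>" for P using \<P>(3)[OF that] socle by auto
    then show ?thesis using \<P> prime_neq by (intro exI[of _ \<P>]) auto
  qed
  then obtain \<P> where \<P>: "finite \<P>" "\<forall>P\<in>\<P>. primeideal P R \<and> \<not> \<mm> \<subseteq> P"
      "\<forall>a\<in>carrier R. \<not> regular_on (ring_as_module R) J a \<longrightarrow> (\<exists>P\<in>\<P>. a \<in> P)" by blast
  have ex2: "\<exists>\<Q>. finite \<Q> \<and> (\<forall>P\<in>\<Q>. primeideal P R \<and> \<not> \<mm> \<subseteq> P) \<and>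
      (\<forall>a\<in>carrier R. \<not> regular_on M (ideal_smult R I M) a \<longrightarrow> (\<exists>P\<in>\<Q>. a \<in> P))" if I: "I \<in> \<I>" for I
  proof -
    have sI: "submodule (ideal_smult R I M) R M"
      using M.ideal_smult_submodule idealD(1) assms(7)[OF I] by blast
    obtain \<Q> where \<Q>: "finite \<Q>" "\<And>P. P \<in> \<Q> \<Longrightarrow> primeideal P R"
      "\<And>P. P \<in> \<Q> \<Longrightarrow> \<exists>x\<in>carrier M - ideal_smult R I M. P = colon R M (ideal_smult R I M) x"
      "\<And>a. a \<in> carrier R \<Longrightarrow> \<not> regular_on M (ideal_smult R I M) a \<Longrightarrow> \<exists>P\<in>\<Q>. a \<in> P"
      using zero_divisors_finite_primes[OF noetherian_ring_axioms fg sI] by metis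
    obtain y where y: "y \<in> \<mm>" "regular_on M (ideal_smult R I M) y" using assms(8)[OF I] by blast
    have "P \<noteq> \<mm>" if "P \<in> \<Q>" for P using \<Q>(3)[OF that] y by (auto simp: regular_on_def colon_def)
    then show ?thesis using \<Q> prime_neq by (intro exI[of _ \<Q>]) auto
  qed
  have "\<forall>I\<in>\<I>. \<exists>\<Q>. finite \<Q> \<and> (\<forall>P\<in>\<Q>. primeideal P R \<and> \<not> \<mm> \<subseteq> P) \<and>
      (\<forall>a\<in>carrier R. \<not> regular_on M (ideal_smult R I M) a \<longrightarrow> (\<exists>P\<in>\<Q>. a \<in> P))" using ex2 by blast
  then obtain \<Q> where \<Q>: "\<forall>I\<in>\<I>. finite (\<Q> I) \<and> (\<forall>P\<in>\<Q> I. primeideal P R \<and> \<not> \<mm> \<subseteq> P) \<and>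
      (\<forall>a\<in>carrier R. \<not> regular_on M (ideal_smult R I M) a \<longrightarrow> (\<exists>P\<in>\<Q> I. a \<in> P))"
    by (rule bchoice[THEN exE])
  have JR: "J \<subseteq> carrier R" by (rule idealD(1)[OF J(1)])
  have "\<exists>a\<in>\<mm>. a \<notin> add_max_square R J \<and> (\<forall>P\<in>\<P> \<union> (\<Union>I\<in>\<I>. \<Q> I). a \<notin> P)"
  proof (rule prime_avoidance)
    show "finite (\<P> \<union> (\<Union>I\<in>\<I>. \<Q> I))" using \<P>(1) \<Q> assms(6) by blast
    show "add_max_square R J \<subseteq> \<mm>"
      using J(2) max_idealD(4,8) by (intro add_max_square_min ideal_max_ideal) auto
    show "add_max_square R J \<noteq> \<mm>" by (rule add_max_square_neq_max_ideal[OF J])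
  qed (use \<P>(2) \<Q> ideal_max_ideal add_max_square_ideal[OF JR] add_max_square_prod[OF JR] in blast)+
  then obtain a where a: "a \<in> \<mm>" "a \<notin> add_max_square R J" "\<forall>P\<in>\<P> \<union> (\<Union>I\<in>\<I>. \<Q> I). a \<notin> P" by blast
  have aR: "a \<in> carrier R" using max_idealD(8)[OF a(1)] .
  show ?thesis
  proof (intro bexI[OF _ a(1)] conjI a(2) ballI)
    show "regular_on (ring_as_module R) J a" using \<P>(3) aR a(3) by blast
    show "regular_on M (ideal_smult R I M) a" if "I \<in> \<I>" for I using \<Q> that aR a(3) by blast
  qed
qed

text \<open>Each step adjoins an element with all the required properties and drops the last entry
  of \<open>ys\<close>, so the sum of \<open>j\<close> and the length is preserved until the list is
  used up.\<close>

lemma regular_ideal_extend: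
  fixes M :: "('a, 'c, 'm) module_scheme"
  assumes fg: "finitely_generated_module R M" and ne: "carrier M \<noteq> {\<zero>\<^bsub>M\<^esub>}"
    and socle: "\<And>j J s. regular_ideal R M j J \<Longrightarrow> J \<noteq> \<mm> \<Longrightarrow> s \<in> carrier R - J \<Longrightarrow>
      colon R (ring_as_module R) J s \<noteq> \<mm>"
    and "regular_ideal R M j J" "regular_list R M J ys" "set ys \<subseteq> \<mm>"
  shows "\<exists>J'. regular_ideal R M (j + length ys) J'"
  using assms(4-)
proof (induction "length ys" arbitrary: j J ys)
  case (Suc n)
  interpret M: module R M using fg by (simp add: finitely_generated_module_def)
  note J = regular_ideal[OF Suc.prems(1)]
  have ysR: "set ys \<subseteq> carrier R" using Suc.prems(3) max_idealD(1) by blast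
  obtain y ys' where ys: "ys = y # ys'" using Suc.hyps(2) by (cases ys) auto
  \<comment> \<open>Otherwise the first entry \<open>y\<close> lies in \<open>J\<close>, so
    \<open>y M\<close> is contained in J M, and regularity of \<open>y\<close> forces M = J M
    against Nakayama.\<close>
  have "J \<noteq> \<mm>"
  proof
    assume Jm: "J = \<mm>"
    have y: "y \<in> \<mm>" "regular_on M (ideal_smult R J M) y" using Suc.prems ys by auto
    have "ideal_smult R J M = carrier M"
    proof
      show "ideal_smult R J M \<subseteq> carrier M"
        using M.submoduleD(1)[OF M.ideal_smult_submodule[OF idealD(1)[OF J(1)]]] .
      show "carrier M \<subseteq> ideal_smult R J M"
        using y M.ideal_smultI[of y J] Jm by (auto simp: regular_on_def)
    qed
    then show False using ideal_smult_neq_carrier[OF fg ne J(2)] by simp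
  qed
  have pI: "ideal I R \<and> (\<exists>y\<in>\<mm>. regular_on M (ideal_smult R I M) y)" if "I \<in> set (prefix_ideals R J ys)" for I
    using prefix_ideals_regular[OF J(1) Suc.prems(2) ysR that] Suc.prems(3) by blast
  obtain a where a: "a \<in> \<mm>" "a \<notin> add_max_square R J" "regular_on (ring_as_module R) J a"
    "\<forall>I\<in>set (prefix_ideals R J ys). regular_on M (ideal_smult R I M) a"
    using exists_regular_element[OF fg J \<open>J \<noteq> \<mm>\<close> socle[OF Suc.prems(1) \<open>J \<noteq> \<mm>\<close>],
        of "set (prefix_ideals R J ys)"] pI by blast
  have aR: "a \<in> carrier R" using max_idealD(8)[OF a(1)] .
  have "regular_on M (ideal_smult R J M) a" using a(4) ys by simp
  then have 1: "regular_ideal R M (Suc j) (adjoin R J a)"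
    by (rule regular_ideal.step[OF Suc.prems(1) a(1-3)])
  have 2: "regular_list R M (adjoin R J a) (butlast ys)"
    using a(4) by (intro regular_list_exchange[OF M.module_axioms J(1) aR ysR Suc.prems(2)]) blast
  have 3: "set (butlast ys) \<subseteq> \<mm>" using Suc.prems(3) by (auto dest: in_set_butlastD)
  have "\<exists>J'. regular_ideal R M (Suc j + length (butlast ys)) J'"
    by (rule Suc.hyps(1)[OF _ 1 2 3]) (use Suc.hyps(2) in simp)
  moreover have "Suc j + length (butlast ys) = j + length ys" using ys by simp
  ultimately show ?case by (simp only:)
qed auto

lemma embedding_dim_le:
  assumes "finite S" "S \<subseteq> carrier R" "Idl S = \<mm>" shows "embedding_dim R \<le> card S"
  unfolding embedding_dim_def by (rule Least_le) (use assms in blast)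

lemma embedding_dim_attained:
  obtains S where "finite S" "S \<subseteq> carrier R" "Idl S = \<mm>" "card S = embedding_dim R"
proof -
  obtain T where "T \<subseteq> carrier R" "finite T" "\<mm> = Idl T" using finetely_gen[OF ideal_max_ideal] by blast
  then have "\<exists>S. finite S \<and> card S = card T \<and> S \<subseteq> carrier R \<and> Idl S = \<mm>" by blast
  then have "\<exists>S. finite S \<and> card S = embedding_dim R \<and> S \<subseteq> carrier R \<and> Idl S = \<mm>"
    unfolding embedding_dim_def by (rule LeastI)
  then show thesis using that by blast
qed

text \<open>This isolates the ring theory: all that remains for the homological part is the
  hypothesis \<open>socle\<close>. A regular ideal with depth many generators exists, and dimension
  forces \<open>\<mm>\<close> to be the only prime over it; then R / J has a socle, so
  \<open>J = \<mm>\<close>.\<close>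

theorem regular_if_no_socle:
  fixes M :: "('a, 'c, 'm) module_scheme"
  assumes mcm: "maximal_cohen_macaulay R M" and ne: "carrier M \<noteq> {\<zero>\<^bsub>M\<^esub>}"
    and socle: "\<And>j J s. regular_ideal R M j J \<Longrightarrow> J \<noteq> \<mm> \<Longrightarrow> s \<in> carrier R - J \<Longrightarrow>
      colon R (ring_as_module R) J s \<noteq> \<mm>"
  shows "regular_local_ring R"
proof -
  have fg: "finitely_generated_module R M" and dim: "krull_dim R = depth R M"
    using mcm by (auto simp: maximal_cohen_macaulay_def)
  interpret M: module R M using fg by (simp add: finitely_generated_module_def)
  obtain S where S: "finite S" "S \<subseteq> carrier R" "Idl S = \<mm>" "card S = embedding_dim R"
    by (rule embedding_dim_attained)
  \<comment> \<open>The bound by the embedding dimension makes \<open>D\<close> finite, and the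
    empty sequence makes it non-empty, so the supremum defining depth is attained.\<close>
  define D where "D = {length xs | xs. set xs \<subseteq> \<mm> \<and> regular_sequence R M xs}"
  have reg: "\<exists>J. regular_ideal R M n J" if n: "n \<in> D" for n
  proof -
    obtain xs where xs: "n = length xs" "set xs \<subseteq> \<mm>" "regular_sequence R M xs" using n by (auto simp: D_def)
    show ?thesis
      using regular_ideal_extend[OF fg ne socle regular_ideal.zero
          regular_list_of_regular_sequence[OF xs(3)] xs(2)] xs(1) by simp
  qed
  have le: "n \<le> embedding_dim R" if n: "n \<in> D" for n
  proof -
    obtain J where J: "regular_ideal R M n J" using reg[OF n] by blast
    have "\<exists>T\<subseteq>S. card T + n = card S \<and> \<mm> \<subseteq> add_max_square R (J \<union> T)"
      by (rule regular_ideal_le_card[OF J S(1-3)])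
    then have "n \<le> card S" by auto
    then show ?thesis using S(4) by simp
  qed
  have "D \<subseteq> {..embedding_dim R}" using le by auto
  then have fD: "finite D" by (rule finite_subset) simp
  have "regular_sequence R M []"
    using ne by (simp add: regular_sequence_def genideal_empty M.ideal_smult_zero eq_commute)
  then have "0 \<in> D" by (auto simp: D_def intro!: exI[of _ "[]"])
  then have "D \<noteq> {}" by blast
  define d where "d = Max D"
  have dD: "d \<in> D" unfolding d_def by (rule Max_in[OF fD \<open>D \<noteq> {}\<close>])
  have "depth R M = Sup (enat ` D)" unfolding depth_def D_def by (rule arg_cong[of _ _ Sup]) auto
  also have "\<dots> = Max (enat ` D)" using fD \<open>D \<noteq> {}\<close> by (simp add: Sup_enat_def)
  also have "\<dots> = enat d" unfolding d_def
    by (rule mono_Max_commute[symmetric, OF _ fD \<open>D \<noteq> {}\<close>]) (simp add: mono_def)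
  finally have kd: "krull_dim R = enat d" using dim by simp
  obtain J where J: "regular_ideal R M d J" using reg[OF dD] by blast
  note Ji = regular_ideal[OF J]
  \<comment> \<open>Below a prime over \<open>J\<close> there is a chain with \<open>d\<close>
    steps. If the prime were not \<open>\<mm>\<close>, putting \<open>\<mm>\<close> on top would
    give \<open>d + 1\<close> steps in a ring of dimension \<open>d\<close>.\<close>
  have prime: "P = \<mm>" if P: "primeideal P R" "J \<subseteq> P" for P
  proof (rule ccontr)
    assume "P \<noteq> \<mm>"
    then have Pm: "P \<subset> \<mm>" using primeideal_le_max_ideal[OF P(1)] by blast
    obtain Q where Q: "\<forall>i\<le>d. primeideal (Q i) R" "\<forall>i<d. Q i \<subset> Q (Suc i)" "Q d = P"
      using prime_chain_regular_ideal[OF J P] by blast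
    define Q' where "Q' = Q(Suc d := \<mm>)"
    have 1: "primeideal (Q' i) R" if "i \<le> Suc d" for i
      using Q(1) that primeideal_max_ideal by (auto simp: Q'_def le_Suc_eq)
    have 2: "Q' i \<subset> Q' (Suc i)" if "i < Suc d" for i
      using Q that Pm by (auto simp: Q'_def less_Suc_eq)
    have 3: "{\<zero>} \<subseteq> Q' i" if "i \<le> Suc d" for i
      using idealD(2)[OF primeideal.axioms(1)[OF 1[OF that]]] by simp
    have "enat (Suc d) \<le> krull_dim R"
      unfolding krull_dim_def krull_dim_over_def
      by (intro Sup_upper CollectI exI[of _ "Suc d"] exI[of _ Q'] conjI allI impI refl 1 2 3)
    then show False using kd by simp
  qed
  have "J \<noteq> carrier R" using Ji(2) one_notin_max_ideal by blast
  then obtain s where "s \<in> carrier R - J" "colon R (ring_as_module R) J s = \<mm>"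
    using exists_socle_element[OF Ji(1) _ prime] by blast
  then have "J = \<mm>" using socle[OF J] by blast
  obtain T where T: "finite T" "card T \<le> d" "T \<subseteq> carrier R" "Idl T = J"
    using regular_ideal_generators[OF J] by blast
  have "embedding_dim R \<le> d" using embedding_dim_le[OF T(1,3)] T(2,4) \<open>J = \<mm>\<close> by simp
  then have "embedding_dim R = d" using le[OF dD] by simp
  then show ?thesis
    using kd noetherian_local_ring_iff[of R] noetherian_local_axioms by (simp add: regular_local_ring_def)
qed

end

section \<open>Finite powers and linear combinations\<close>

lemma direct_sum_simps:
  "x \<oplus>\<^bsub>direct_sum I M\<^esub> y = (\<lambda>i\<in>I. x i \<oplus>\<^bsub>M i\<^esub> y i)" "\<zero>\<^bsub>direct_sum I M\<^esub> = (\<lambda>i\<in>I. \<zero>\<^bsub>M i\<^esub>)"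
  "a \<odot>\<^bsub>direct_sum I M\<^esub> x = (\<lambda>i\<in>I. a \<odot>\<^bsub>M i\<^esub> x i)"
  by (simp_all add: direct_sum_def Let_def)

lemma direct_sum_carrier:
  assumes "finite I" "\<And>i. i \<in> I \<Longrightarrow> module R (M i)"
  shows "carrier (direct_sum I M) = (\<Pi>\<^sub>E i\<in>I. carrier (M i))"
proof -
  have "group (add_monoid (M i))" if "i \<in> I" for i
    using assms(2)[OF that] by (simp add: module_def abelian_group.a_group)
  then show ?thesis using assms(1) by (simp add: direct_sum_def Let_def carrier_sum_group)
qed

definition power_module :: "nat \<Rightarrow> ('a, 'b, 'm) module_scheme \<Rightarrow> ('a, nat \<Rightarrow> 'b) module"
  where "power_module n M = direct_sum {..<n} (\<lambda>_. M)"

lemma power_module_simps: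
  "x \<oplus>\<^bsub>power_module n M\<^esub> y = (\<lambda>i\<in>{..<n}. x i \<oplus>\<^bsub>M\<^esub> y i)"
  "\<zero>\<^bsub>power_module n M\<^esub> = (\<lambda>i\<in>{..<n}. \<zero>\<^bsub>M\<^esub>)"
  "a \<odot>\<^bsub>power_module n M\<^esub> x = (\<lambda>i\<in>{..<n}. a \<odot>\<^bsub>M\<^esub> x i)"
  by (simp_all add: power_module_def direct_sum_simps)

text \<open>An \<open>x\<close> in \<open>M^n\<close> stands for the homomorphism from
  \<open>R^n\<close> that sends the unit vectors to its entries; \<open>lincomb M n b x\<close> is
  its value at \<open>b\<close>. Recursion on \<open>n\<close> reduces bilinearity to plain
  inductions.\<close>

primrec lincomb :: "('a, 'b, 'm) module_scheme \<Rightarrow> nat \<Rightarrow> (nat \<Rightarrow> 'a) \<Rightarrow> (nat \<Rightarrow> 'b) \<Rightarrow> 'b" where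
  "lincomb M 0 b x = \<zero>\<^bsub>M\<^esub>"
| "lincomb M (Suc n) b x = lincomb M n b x \<oplus>\<^bsub>M\<^esub> b n \<odot>\<^bsub>M\<^esub> x n"

lemma lincomb_cong:
  "(\<And>k. k < n \<Longrightarrow> b k = c k) \<Longrightarrow> (\<And>k. k < n \<Longrightarrow> x k = y k) \<Longrightarrow> lincomb M n b x = lincomb M n c y"
  by (induction n) auto

context module begin

lemma power_module_carrier: "carrier (power_module n M) = ({..<n} \<rightarrow>\<^sub>E carrier M)"
  unfolding power_module_def by (rule direct_sum_carrier[where R = R]) (auto intro: module_axioms)

lemma power_module_module: "module R (power_module n M)"
  unfolding power_module_def by (rule direct_sum_module) (auto intro: module_axioms R.cring_axioms)

lemma lincomb_closed:
  "(\<And>k. k < n \<Longrightarrow> b k \<in> carrier R) \<Longrightarrow> (\<And>k. k < n \<Longrightarrow> x k \<in> carrier M) \<Longrightarrow> lincomb M n b x \<in> carrier M"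
  by (induction n) auto

lemma lincomb_add_left:
  assumes "\<And>k. k < n \<Longrightarrow> b k \<in> carrier R" "\<And>k. k < n \<Longrightarrow> c k \<in> carrier R" "\<And>k. k < n \<Longrightarrow> x k \<in> carrier M"
  shows "lincomb M n (\<lambda>k. b k \<oplus> c k) x = lincomb M n b x \<oplus>\<^bsub>M\<^esub> lincomb M n c x"
  using assms
proof (induction n)
  case (Suc n)
  then show ?case using lincomb_closed[of n b x] lincomb_closed[of n c x] by (simp add: smult_l_distr M.a_ac)
qed simp

lemma lincomb_smult_left:
  assumes "a \<in> carrier R" "\<And>k. k < n \<Longrightarrow> b k \<in> carrier R" "\<And>k. k < n \<Longrightarrow> x k \<in> carrier M"
  shows "lincomb M n (\<lambda>k. a \<otimes> b k) x = a \<odot>\<^bsub>M\<^esub> lincomb M n b x"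
  using assms
proof (induction n)
  case (Suc n)
  then show ?case using lincomb_closed[of n b x] by (simp add: smult_r_distr smult_assoc1)
qed simp

lemma lincomb_add_right:
  assumes "\<And>k. k < n \<Longrightarrow> b k \<in> carrier R" "\<And>k. k < n \<Longrightarrow> x k \<in> carrier M" "\<And>k. k < n \<Longrightarrow> y k \<in> carrier M"
  shows "lincomb M n b (\<lambda>k. x k \<oplus>\<^bsub>M\<^esub> y k) = lincomb M n b x \<oplus>\<^bsub>M\<^esub> lincomb M n b y"
  using assms
proof (induction n)
  case (Suc n)
  then show ?case using lincomb_closed[of n b x] lincomb_closed[of n b y] by (simp add: smult_r_distr M.a_ac)
qed simp

lemma lincomb_smult_right:
  assumes "a \<in> carrier R" "\<And>k. k < n \<Longrightarrow> b k \<in> carrier R" "\<And>k. k < n \<Longrightarrow> x k \<in> carrier M"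
  shows "lincomb M n b (\<lambda>k. a \<odot>\<^bsub>M\<^esub> x k) = a \<odot>\<^bsub>M\<^esub> lincomb M n b x"
  using assms
proof (induction n)
  case (Suc n)
  then show ?case using lincomb_closed[of n b x] by (simp add: smult_r_distr smult_commute[of a])
qed simp

lemma lincomb_zero_left:
  assumes "\<And>k. k < n \<Longrightarrow> b k \<in> carrier R" "\<And>k. k < n \<Longrightarrow> b k \<odot>\<^bsub>M\<^esub> x k = \<zero>\<^bsub>M\<^esub>"
  shows "lincomb M n b x = \<zero>\<^bsub>M\<^esub>"
  using assms by (induction n) auto

lemma lincomb_unit:
  assumes "j < n" "\<And>k. k < n \<Longrightarrow> x k \<in> carrier M"
  shows "lincomb M n (\<lambda>k. if k = j then \<one> else \<zero>) x = x j"
proof -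
  have "lincomb M m (\<lambda>k. if k = j then \<one> else \<zero>) x = (if j < m then x j else \<zero>\<^bsub>M\<^esub>)" if "m \<le> n" for m
    using that by (induction m) (use assms in \<open>auto simp: less_Suc_eq\<close>)
  then show ?thesis using assms(1) by simp
qed

lemma lincomb_hom_left:
  assumes "\<And>k. k < n \<Longrightarrow> x k \<in> carrier M"
  shows "(\<lambda>b. lincomb M n b x) \<in> hom_module R (power_module n (ring_as_module R)) M"
proof -
  have car: "carrier (power_module n (ring_as_module R)) = ({..<n} \<rightarrow>\<^sub>E carrier R)"
    using module.power_module_carrier[OF ring_as_module_is_module[OF R.cring_axioms]] by simp
  have "lincomb M n (\<lambda>k\<in>{..<n}. b k \<oplus> c k) x = lincomb M n b x \<oplus>\<^bsub>M\<^esub> lincomb M n c x"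
    if "b \<in> {..<n} \<rightarrow>\<^sub>E carrier R" "c \<in> {..<n} \<rightarrow>\<^sub>E carrier R" for b c
    using that assms by (subst lincomb_add_left[symmetric]) (auto intro: lincomb_cong)
  moreover have "lincomb M n (\<lambda>k\<in>{..<n}. a \<otimes> b k) x = a \<odot>\<^bsub>M\<^esub> lincomb M n b x"
    if "a \<in> carrier R" "b \<in> {..<n} \<rightarrow>\<^sub>E carrier R" for a b
    using that assms by (subst lincomb_smult_left[symmetric]) (auto intro: lincomb_cong)
  ultimately show ?thesis
    using assms by (auto simp: hom_module_def car power_module_simps intro!: lincomb_closed)
qed

lemma lincomb_hom_right:
  assumes "\<And>k. k < n \<Longrightarrow> b k \<in> carrier R"
  shows "(\<lambda>x. lincomb M n b x) \<in> hom_module R (power_module n M) M"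
proof -
  have "lincomb M n b (\<lambda>k\<in>{..<n}. x k \<oplus>\<^bsub>M\<^esub> y k) = lincomb M n b x \<oplus>\<^bsub>M\<^esub> lincomb M n b y"
    if "x \<in> {..<n} \<rightarrow>\<^sub>E carrier M" "y \<in> {..<n} \<rightarrow>\<^sub>E carrier M" for x y
    using that assms by (subst lincomb_add_right[symmetric]) (auto intro: lincomb_cong)
  moreover have "lincomb M n b (\<lambda>k\<in>{..<n}. a \<odot>\<^bsub>M\<^esub> x k) = a \<odot>\<^bsub>M\<^esub> lincomb M n b x"
    if "a \<in> carrier R" "x \<in> {..<n} \<rightarrow>\<^sub>E carrier M" for a x
    using that assms by (subst lincomb_smult_right[symmetric]) (auto intro: lincomb_cong)
  ultimately show ?thesis
    using assms by (auto simp: hom_module_def power_module_carrier power_module_simps intro!: lincomb_closed)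
qed

lemma power_hom:
  assumes "\<And>k. k < n \<Longrightarrow> f k \<in> hom_module R N M"
  shows "(\<lambda>x. \<lambda>k\<in>{..<n}. f k x) \<in> hom_module R N (power_module n M)"
  using hom_moduleD[OF assms]
  by (auto simp: hom_module_def power_module_carrier power_module_simps intro!: restrict_ext)

lemma power_submodule:
  assumes "submodule H R M"
  shows "submodule {v \<in> carrier (power_module n M). \<forall>k<n. v k \<in> H} R (power_module n M)"
proof -
  interpret P: module R "power_module n M" by (rule power_module_module)
  show ?thesis
    unfolding P.submodule_iff using submoduleD[OF assms]
    by (auto simp: power_module_simps power_module_carrier PiE_iff extensional_def)
qed

end

lemma lincomb_hom:
  assumes f: "f \<in> hom_module R M N" and M: "module R M" and N: "module R N"
    and "\<And>k. k < n \<Longrightarrow> b k \<in> carrier R" "\<And>k. k < n \<Longrightarrow> x k \<in> carrier M"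
  shows "f (lincomb M n b x) = lincomb N n b (\<lambda>k. f (x k))"
  using assms(4,5)
proof (induction n)
  case 0
  then show ?case using hom_module_zero[OF f M N] by simp
next
  case (Suc n)
  then show ?case
    using hom_moduleD[OF f] module.lincomb_closed[OF M, of n b x] module.smult_closed[OF M] by simp
qed

text \<open>The composite of two homomorphisms, from R^m to R^n and on to M, evaluated in both
  ways.\<close>

lemma (in module) lincomb_swap:
  assumes "\<And>j. j < m \<Longrightarrow> b j \<in> carrier R"
    and "\<And>j. j < m \<Longrightarrow> u j \<in> carrier (power_module n (ring_as_module R))" "\<And>k. k < n \<Longrightarrow> w k \<in> carrier M"
  shows "lincomb M n (lincomb (power_module n (ring_as_module R)) m b u) w = lincomb M m b (\<lambda>j. lincomb M n (u j) w)"
proof -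
  interpret RM: module R "ring_as_module R" by (rule ring_as_module_is_module) (rule R.cring_axioms)
  interpret P: module R "power_module n (ring_as_module R)" by (rule RM.power_module_module)
  have "(\<lambda>b. lincomb M n b w) \<in> hom_module R (power_module n (ring_as_module R)) M"
    by (rule lincomb_hom_left) (rule assms(3))
  from lincomb_hom[OF this P.module_axioms module_axioms, of m b u] show ?thesis using assms(1,2) by simp
qed

definition unit_vector :: "('a, 'r) ring_scheme \<Rightarrow> nat \<Rightarrow> nat \<Rightarrow> nat \<Rightarrow> 'a"
  where "unit_vector R n j = (\<lambda>k\<in>{..<n}. if k = j then \<one>\<^bsub>R\<^esub> else \<zero>\<^bsub>R\<^esub>)"

lemma (in cring) power_module_lincomb_unit:
  assumes "u \<in> carrier (power_module n (ring_as_module R))"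
  shows "lincomb (power_module n (ring_as_module R)) n u (unit_vector R n) = u"
proof -
  interpret RM: module R "ring_as_module R" by (rule ring_as_module)
  note car = RM.power_module_carrier[simplified]
  have u: "u k \<in> carrier R" if "k < n" for k using assms that by (auto simp: car PiE_iff)
  have "lincomb (power_module n (ring_as_module R)) m u (unit_vector R n)
      = (\<lambda>k\<in>{..<n}. if k < m then u k else \<zero>)" if "m \<le> n" for m
    using that
  proof (induction m)
    case (Suc m)
    show ?case
      using Suc u by (auto simp: power_module_simps unit_vector_def less_Suc_eq intro!: restrict_ext)
  qed (auto simp: power_module_simps)
  from this[of n] show ?thesis
    using assms by (auto simp: car PiE_iff extensional_def fun_eq_iff)
qed

text \<open>Each generator is placed in each single coordinate; a tuple is then assembled coordinate
  by coordinate.\<close>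

lemma (in module) power_finitely_generated:
  assumes S: "finite S" "S \<subseteq> carrier M"
  obtains T where "finite T" "T \<subseteq> carrier (power_module n M)"
    "{v \<in> carrier (power_module n M). \<forall>k<n. v k \<in> gen_submodule R M S} \<subseteq> gen_submodule R (power_module n M) T"
proof -
  interpret P: module R "power_module n M" by (rule power_module_module)
  define sng where "sng j x = (\<lambda>k\<in>{..<n}. if k = j then x else \<zero>\<^bsub>M\<^esub>)" for j and x
  define T where "T = (\<lambda>(j, x). sng j x) ` ({..<n} \<times> S)"
  have sng: "sng j x \<in> carrier (power_module n M)" if "x \<in> carrier M" for j x
    using that by (auto simp: sng_def power_module_carrier)
  have T: "finite T" "T \<subseteq> carrier (power_module n M)"
    unfolding T_def using S sng by auto
  let ?G = "gen_submodule R (power_module n M) T"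
  note G = P.submoduleD[OF P.gen_submodule_submodule[OF T(2)]]
  have N: "gen_submodule R M S \<subseteq> {x \<in> carrier M. sng j x \<in> ?G}" if j: "j < n" for j
  proof (rule gen_submodule_min)
    have "sng j (x \<oplus>\<^bsub>M\<^esub> y) = sng j x \<oplus>\<^bsub>power_module n M\<^esub> sng j y" if "x \<in> carrier M" "y \<in> carrier M" for x y
      using that by (auto simp: sng_def power_module_simps intro!: restrict_ext)
    moreover have "sng j (a \<odot>\<^bsub>M\<^esub> x) = a \<odot>\<^bsub>power_module n M\<^esub> sng j x" if "a \<in> carrier R" "x \<in> carrier M" for a x
      using that by (auto simp: sng_def power_module_simps intro!: restrict_ext)
    moreover have "sng j \<zero>\<^bsub>M\<^esub> = \<zero>\<^bsub>power_module n M\<^esub>"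
      by (auto simp: sng_def power_module_simps intro!: restrict_ext)
    ultimately show "submodule {x \<in> carrier M. sng j x \<in> ?G} R M"
      using G(2-4) by (auto simp: submodule_iff)
    have "sng j x \<in> T" if "x \<in> S" for x using that j by (auto simp: T_def)
    then show "S \<subseteq> {x \<in> carrier M. sng j x \<in> ?G}" using S(2) P.gen_submodule_incl[of T] by auto
  qed
  have "v \<in> ?G" if v: "v \<in> carrier (power_module n M)" "\<forall>k<n. v k \<in> gen_submodule R M S" for v
  proof -
    have vk: "v k \<in> carrier M" if "k < n" for k using v(1) that by (auto simp: power_module_carrier PiE_iff)
    have "(\<lambda>k\<in>{..<n}. if k < m then v k else \<zero>\<^bsub>M\<^esub>) \<in> ?G" if "m \<le> n" for m
      using that
    proof (induction m)
      case 0
      have "(\<lambda>k\<in>{..<n}. if k < 0 then v k else \<zero>\<^bsub>M\<^esub>) = \<zero>\<^bsub>power_module n M\<^esub>"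
        by (simp add: power_module_simps)
      then show ?case using G(2) by (simp only:)
    next
      case (Suc m)
      have "(\<lambda>k\<in>{..<n}. if k < Suc m then v k else \<zero>\<^bsub>M\<^esub>)
          = (\<lambda>k\<in>{..<n}. if k < m then v k else \<zero>\<^bsub>M\<^esub>) \<oplus>\<^bsub>power_module n M\<^esub> sng m (v m)"
        using vk by (auto simp: sng_def power_module_simps less_Suc_eq intro!: restrict_ext)
      moreover have "sng m (v m) \<in> ?G"
      proof -
        have "m < n" using Suc.prems by simp
        then have "v m \<in> gen_submodule R M S" using v(2) by blast
        then show ?thesis using N[OF \<open>m < n\<close>] by blast
      qed
      moreover have "(\<lambda>k\<in>{..<n}. if k < m then v k else \<zero>\<^bsub>M\<^esub>) \<in> ?G"
        by (rule Suc.IH) (use Suc.prems in simp)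
      ultimately show ?case using G(3) by metis
    qed
    from this[of n] have "(\<lambda>k\<in>{..<n}. v k) \<in> ?G" by (simp cong: restrict_cong)
    then show ?thesis using v(1) by (simp add: power_module_carrier PiE_iff extensional_restrict)
  qed
  then show thesis using that T by blast
qed

section \<open>Relative injectivity\<close>

text \<open>If \<open>J\<close> annihilates \<open>E\<close>, this says that \<open>E\<close> is injective over \<open>R / J\<close>. A homomorphism
  from a submodule of \<open>(R / J)\<^sup>n\<close> to \<open>E\<close> is given by its graph.\<close>

definition relatively_injective :: "('a, 'r) ring_scheme \<Rightarrow> 'a set \<Rightarrow> ('a, 'e, 'm) module_scheme \<Rightarrow> bool"
  where "relatively_injective R J E \<longleftrightarrow> (\<forall>n G.
    G \<subseteq> carrier (power_module n (ring_as_module R)) \<times> carrier E \<longrightarrow>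
    (\<forall>u y u' y'. (u, y) \<in> G \<longrightarrow> (u', y') \<in> G \<longrightarrow> (u \<oplus>\<^bsub>power_module n (ring_as_module R)\<^esub> u', y \<oplus>\<^bsub>E\<^esub> y') \<in> G) \<longrightarrow>
    (\<forall>a u y. a \<in> carrier R \<longrightarrow> (u, y) \<in> G \<longrightarrow> (a \<odot>\<^bsub>power_module n (ring_as_module R)\<^esub> u, a \<odot>\<^bsub>E\<^esub> y) \<in> G) \<longrightarrow>
    (\<forall>u y. (u, y) \<in> G \<longrightarrow> (\<forall>k<n. u k \<in> J) \<longrightarrow> y = \<zero>\<^bsub>E\<^esub>) \<longrightarrow>
    (\<exists>w\<in>{..<n} \<rightarrow> carrier E. \<forall>u y. (u, y) \<in> G \<longrightarrow> y = lincomb E n u w))"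

lemma relatively_injectiveD:
  assumes "relatively_injective R J E"
    and "G \<subseteq> carrier (power_module n (ring_as_module R)) \<times> carrier E"
    and "\<And>u y u' y'. (u, y) \<in> G \<Longrightarrow> (u', y') \<in> G \<Longrightarrow> (u \<oplus>\<^bsub>power_module n (ring_as_module R)\<^esub> u', y \<oplus>\<^bsub>E\<^esub> y') \<in> G"
    and "\<And>a u y. a \<in> carrier R \<Longrightarrow> (u, y) \<in> G \<Longrightarrow> (a \<odot>\<^bsub>power_module n (ring_as_module R)\<^esub> u, a \<odot>\<^bsub>E\<^esub> y) \<in> G"
    and "\<And>u y. (u, y) \<in> G \<Longrightarrow> (\<And>k. k < n \<Longrightarrow> u k \<in> J) \<Longrightarrow> y = \<zero>\<^bsub>E\<^esub>"
  shows "\<exists>w\<in>{..<n} \<rightarrow> carrier E. \<forall>u y. (u, y) \<in> G \<longrightarrow> y = lincomb E n u w"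
proof -
  have "\<forall>u y u' y'. (u, y) \<in> G \<longrightarrow> (u', y') \<in> G \<longrightarrow> (u \<oplus>\<^bsub>power_module n (ring_as_module R)\<^esub> u', y \<oplus>\<^bsub>E\<^esub> y') \<in> G"
    "\<forall>a u y. a \<in> carrier R \<longrightarrow> (u, y) \<in> G \<longrightarrow> (a \<odot>\<^bsub>power_module n (ring_as_module R)\<^esub> u, a \<odot>\<^bsub>E\<^esub> y) \<in> G"
    "\<forall>u y. (u, y) \<in> G \<longrightarrow> (\<forall>k<n. u k \<in> J) \<longrightarrow> y = \<zero>\<^bsub>E\<^esub>"
    using assms(3-5) by simp_all
  then show ?thesis using assms(1)[unfolded relatively_injective_def, rule_format, OF assms(2)] by blast
qed

text \<open>This is Hom (R / J, E), a homomorphism being given by its value at 1.\<close>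

definition annihilated :: "('a, 'e, 'm) module_scheme \<Rightarrow> 'a set \<Rightarrow> 'e set"
  where "annihilated E J = {y \<in> carrier E. \<forall>c\<in>J. c \<odot>\<^bsub>E\<^esub> y = \<zero>\<^bsub>E\<^esub>}"

lemma (in module) annihilated_submodule:
  assumes "J \<subseteq> carrier R" shows "submodule (annihilated M J) R M"
proof -
  have "c \<odot>\<^bsub>M\<^esub> (a \<odot>\<^bsub>M\<^esub> y) = \<zero>\<^bsub>M\<^esub>" if "a \<in> carrier R" "y \<in> annihilated M J" "c \<in> J" for a y c
    using that assms smult_commute[of c a y] by (auto simp: annihilated_def)
  then show ?thesis
    using assms by (auto simp: annihilated_def submodule_iff smult_r_distr subset_iff)
qed

lemma lincomb_carrier_update: "lincomb (E\<lparr>carrier := H\<rparr>) n b x = lincomb E n b x"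
  by (induction n) auto

lemma annihilatedD: "y \<in> annihilated M J \<Longrightarrow> y \<in> carrier M"
  "y \<in> annihilated M J \<Longrightarrow> c \<in> J \<Longrightarrow> c \<odot>\<^bsub>M\<^esub> y = \<zero>\<^bsub>M\<^esub>"
  by (auto simp: annihilated_def)

lemma annihilated_mono: "J \<subseteq> J' \<Longrightarrow> annihilated M J' \<subseteq> annihilated M J"
  by (auto simp: annihilated_def)

lemma (in module) annihilated_adjoinI:
  assumes "w \<in> annihilated M J" "a \<in> carrier R" "a \<odot>\<^bsub>M\<^esub> w = \<zero>\<^bsub>M\<^esub>" "J \<subseteq> carrier R"
  shows "w \<in> annihilated M (adjoin R J a)"
proof -
  have "c \<odot>\<^bsub>M\<^esub> w = \<zero>\<^bsub>M\<^esub>" if c: "c \<in> adjoin R J a" for c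
  proof -
    obtain x r where x: "x \<in> J" "r \<in> carrier R" "c = x \<oplus> r \<otimes> a" using c by (rule R.adjoinE)
    have "x \<in> carrier R" using x(1) assms(4) by blast
    then show ?thesis using x assms(2,3) annihilatedD[OF assms(1)] by (simp add: smult_l_distr smult_assoc1)
  qed
  then show ?thesis using assms(1) by (simp add: annihilated_def)
qed

lemma hom_annihilated:
  assumes f: "f \<in> hom_module R M N" and M: "module R M" and N: "module R N"
    and w: "w \<in> annihilated M J" and J: "J \<subseteq> carrier R"
  shows "f w \<in> annihilated N J"
proof -
  have "c \<odot>\<^bsub>N\<^esub> f w = \<zero>\<^bsub>N\<^esub>" if "c \<in> J" for c
    using hom_moduleD(3)[OF f subsetD[OF J that] annihilatedD(1)[OF w]] annihilatedD(2)[OF w that]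
      hom_module_zero[OF f M N] by simp
  then show ?thesis using hom_moduleD(1)[OF f annihilatedD(1)[OF w]] by (simp add: annihilated_def)
qed

text \<open>Change of rings: Hom (R / J, E) is injective over R / J. A partial map on R^n that
  vanishes on J^n is extended by injectivity of \<open>E\<close>; the extension also vanishes on
  J^n, so its values on unit vectors are killed by \<open>J\<close>.\<close>

lemma relatively_injective_annihilated:
  fixes R :: "('a, 'r) ring_scheme" and E :: "('a, 'e, 'm) module_scheme"
  assumes inj: "injective_module R E" and J: "ideal J R"
  shows "relatively_injective R J (E\<lparr>carrier := annihilated E J\<rparr>)"
proof -
  interpret E: module R E using inj by (simp add: injective_module_def)
  interpret RM: module R "ring_as_module R" by (rule E.R.ring_as_module)
  note Jd = E.R.idealD[OF J]
  note ann = E.submoduleD[OF E.annihilated_submodule[OF Jd(1)]]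
  show ?thesis
    unfolding relatively_injective_def
  proof (intro allI impI)
    fix n G
    let ?P = "power_module n (ring_as_module R)"
    interpret P: module R ?P by (rule RM.power_module_module)
    assume G: "G \<subseteq> carrier ?P \<times> carrier (E\<lparr>carrier := annihilated E J\<rparr>)"
      "\<forall>u y u' y'. (u, y) \<in> G \<longrightarrow> (u', y') \<in> G \<longrightarrow> (u \<oplus>\<^bsub>?P\<^esub> u', y \<oplus>\<^bsub>E\<lparr>carrier := annihilated E J\<rparr>\<^esub> y') \<in> G"
      "\<forall>a u y. a \<in> carrier R \<longrightarrow> (u, y) \<in> G \<longrightarrow> (a \<odot>\<^bsub>?P\<^esub> u, a \<odot>\<^bsub>E\<lparr>carrier := annihilated E J\<rparr>\<^esub> y) \<in> G"
      "\<forall>u y. (u, y) \<in> G \<longrightarrow> (\<forall>k<n. u k \<in> J) \<longrightarrow> y = \<zero>\<^bsub>E\<lparr>carrier := annihilated E J\<rparr>\<^esub>"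
    have G_car: "u \<in> carrier ?P" "y \<in> annihilated E J" "y \<in> carrier E" if "(u, y) \<in> G" for u y
      using that G(1) ann(7) by auto
    have G_add: "(u \<oplus>\<^bsub>?P\<^esub> u', y \<oplus>\<^bsub>E\<^esub> y') \<in> G" if "(u, y) \<in> G" "(u', y') \<in> G" for u y u' y'
      using that G(2) by simp
    have G_smult: "(a \<odot>\<^bsub>?P\<^esub> u, a \<odot>\<^bsub>E\<^esub> y) \<in> G" if "a \<in> carrier R" "(u, y) \<in> G" for a u y
      using that G(3) by simp
    have G_0: "y = \<zero>\<^bsub>E\<^esub>" if "(u, y) \<in> G" "\<And>k. k < n \<Longrightarrow> u k \<in> J" for u y
      using that G(4) by simp
    note car = RM.power_module_carrier[simplified]
    show "\<exists>w\<in>{..<n} \<rightarrow> carrier (E\<lparr>carrier := annihilated E J\<rparr>).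
        \<forall>u y. (u, y) \<in> G \<longrightarrow> y = lincomb (E\<lparr>carrier := annihilated E J\<rparr>) n u w"
    \<comment> \<open>The closure conditions admit the empty graph, which lacks the pair of zeros
      used below.\<close>
    proof (cases "G = {}")
      case True
      then show ?thesis using ann(2) by (intro bexI[of _ "\<lambda>_. \<zero>\<^bsub>E\<^esub>"]) auto
    next
      case False
      then obtain u0 y0 where "(u0, y0) \<in> G" by auto
      then have "(\<zero>\<^bsub>R\<^esub> \<odot>\<^bsub>?P\<^esub> u0, \<zero>\<^bsub>R\<^esub> \<odot>\<^bsub>E\<^esub> y0) \<in> G" by (intro G_smult) auto
      then have G00: "(\<zero>\<^bsub>?P\<^esub>, \<zero>\<^bsub>E\<^esub>) \<in> G" using G_car[OF \<open>(u0, y0) \<in> G\<close>] by simp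
      define JP where "JP = {x \<in> carrier ?P. \<forall>k<n. x k \<in> J}"
      have sJP: "submodule JP R ?P"
        using Jd(2-4,8) by (auto simp: P.submodule_iff JP_def power_module_simps car PiE_iff extensional_def)
      note JP = P.submoduleD[OF sJP]
      \<comment> \<open>Extending by 0 on J^n keeps the graph single-valued: if zero is u + x with x
        in J^n, then u lies in J^n and its value vanishes by hypothesis. It also forces the
        extension to vanish on J^n.\<close>
      define G' where "G' = {(u \<oplus>\<^bsub>?P\<^esub> x, y) | u x y. (u, y) \<in> G \<and> x \<in> JP}"
      have G'I: "(z, y) \<in> G'" if "(u, y) \<in> G" "x \<in> JP" "z = u \<oplus>\<^bsub>?P\<^esub> x" for u x y z
        using that by (auto simp: G'_def)
      have G'E: "\<exists>u x. (u, y) \<in> G \<and> x \<in> JP \<and> z = u \<oplus>\<^bsub>?P\<^esub> x" if "(z, y) \<in> G'" for z y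
        using that by (auto simp: G'_def)
      have G'_car: "z \<in> carrier ?P" "y \<in> carrier E" if "(z, y) \<in> G'" for z y
        using G'E[OF that] G_car JP(7) by auto
      have G'_add: "(z \<oplus>\<^bsub>?P\<^esub> z', y \<oplus>\<^bsub>E\<^esub> y') \<in> G'" if zy: "(z, y) \<in> G'" and zy': "(z', y') \<in> G'" for z y z' y'
      proof -
        obtain u x where 1: "(u, y) \<in> G" "x \<in> JP" "z = u \<oplus>\<^bsub>?P\<^esub> x" using G'E[OF zy] by blast
        obtain u' x' where 2: "(u', y') \<in> G" "x' \<in> JP" "z' = u' \<oplus>\<^bsub>?P\<^esub> x'" using G'E[OF zy'] by blast
        show ?thesis
          by (rule G'I[OF G_add[OF 1(1) 2(1)] JP(3)[OF 1(2) 2(2)]])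
            (use 1 2 G_car(1)[OF 1(1)] G_car(1)[OF 2(1)] JP(7) in \<open>simp add: P.M.a_ac\<close>)
      qed
      have G'_smult: "(a \<odot>\<^bsub>?P\<^esub> z, a \<odot>\<^bsub>E\<^esub> y) \<in> G'" if a: "a \<in> carrier R" and zy: "(z, y) \<in> G'" for a z y
      proof -
        obtain u x where 1: "(u, y) \<in> G" "x \<in> JP" "z = u \<oplus>\<^bsub>?P\<^esub> x" using G'E[OF zy] by blast
        show ?thesis
          by (rule G'I[OF G_smult[OF a 1(1)] JP(4)[OF a 1(2)]])
            (use 1 a G_car(1)[OF 1(1)] JP(7) in \<open>simp add: P.smult_r_distr\<close>)
      qed
      have G'_0: "y = \<zero>\<^bsub>E\<^esub>" if zy: "(\<zero>\<^bsub>?P\<^esub>, y) \<in> G'" for y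
      proof -
        obtain u x where 1: "(u, y) \<in> G" "x \<in> JP" "\<zero>\<^bsub>?P\<^esub> = u \<oplus>\<^bsub>?P\<^esub> x" using G'E[OF zy] by blast
        have "u \<oplus>\<^bsub>?P\<^esub> x \<in> JP" using 1(3) JP(2) by simp
        then have "u \<in> JP" using P.submodule_diff_iff[OF sJP G_car(1)[OF 1(1)] 1(2)] by simp
        then show ?thesis using G_0[OF 1(1)] by (simp add: JP_def)
      qed
      have G'_fun: "y = y'" if "(z, y) \<in> G'" "(z, y') \<in> G'" for z y y'
      proof -
        have c: "z \<in> carrier ?P" "y \<in> carrier E" "y' \<in> carrier E" using G'_car that by auto
        have "(z \<oplus>\<^bsub>?P\<^esub> (\<ominus>\<^bsub>R\<^esub> \<one>\<^bsub>R\<^esub>) \<odot>\<^bsub>?P\<^esub> z, y \<oplus>\<^bsub>E\<^esub> (\<ominus>\<^bsub>R\<^esub> \<one>\<^bsub>R\<^esub>) \<odot>\<^bsub>E\<^esub> y') \<in> G'"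
          using that by (intro G'_add G'_smult) auto
        then have "(\<zero>\<^bsub>?P\<^esub>, y \<ominus>\<^bsub>E\<^esub> y') \<in> G'"
          using c by (simp add: P.smult_l_minus E.smult_l_minus P.M.r_neg a_minus_def)
        then show ?thesis using G'_0 E.minus_eq_zero_iff[OF c(2,3)] by blast
      qed
      define N where "N = fst ` G'"
      define f where "f z = (THE y. (z, y) \<in> G')" for z
      have f: "f z = y" if "(z, y) \<in> G'" for z y unfolding f_def using that G'_fun by blast
      have fN: "(z, f z) \<in> G'" if "z \<in> N" for z using that f by (auto simp: N_def)
      have NI: "z \<in> N" if "(z, y) \<in> G'" for z y using that by (force simp: N_def)
      have JPG': "(x, \<zero>\<^bsub>E\<^esub>) \<in> G'" if "x \<in> JP" for x
        by (rule G'I[OF G00 that]) (use JP(7)[OF that] in simp)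
      have sN: "submodule N R ?P"
        unfolding P.submodule_iff
      proof (intro conjI ballI)
        show "N \<subseteq> carrier ?P" using G'_car(1) by (auto simp: N_def)
        show "\<zero>\<^bsub>?P\<^esub> \<in> N" using NI JPG'[OF JP(2)] by blast
        show "x \<oplus>\<^bsub>?P\<^esub> y \<in> N" if "x \<in> N" "y \<in> N" for x y using NI[OF G'_add[OF fN fN]] that by blast
        show "a \<odot>\<^bsub>?P\<^esub> x \<in> N" if "a \<in> carrier R" "x \<in> N" for a x using NI[OF G'_smult[OF _ fN]] that by blast
      qed
      have "f \<in> hom_module R (?P\<lparr>carrier := N\<rparr>) E"
        using f[OF G'_add[OF fN fN]] f[OF G'_smult[OF _ fN]] G'_car(2)[OF fN]
        by (auto simp: hom_module_def)
      then obtain g where g: "g \<in> hom_module R ?P E" "\<forall>x\<in>N. g x = f x"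
        using injective_module_extend[OF inj P.module_axioms sN] by blast
      note gh = hom_moduleD[OF g(1)]
      have gG': "g z = y" if "(z, y) \<in> G'" for z y using g(2) NI[OF that] f[OF that] by simp
      let ?e = "unit_vector R n"
      have e: "?e k \<in> carrier ?P" for k by (auto simp: car unit_vector_def)
      have w: "g (?e k) \<in> annihilated E J" for k
      proof -
        have "c \<odot>\<^bsub>E\<^esub> g (?e k) = \<zero>\<^bsub>E\<^esub>" if c: "c \<in> J" for c
        proof -
          have cR: "c \<in> carrier R" using Jd(8)[OF c] .
          have "c \<odot>\<^bsub>?P\<^esub> ?e k \<in> JP"
            using c cR Jd(2) P.smult_closed[OF cR e] by (auto simp: JP_def power_module_simps unit_vector_def)
          then have "g (c \<odot>\<^bsub>?P\<^esub> ?e k) = \<zero>\<^bsub>E\<^esub>" by (rule gG'[OF JPG'])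
          then show ?thesis using gh(3)[OF cR e] by simp
        qed
        then show ?thesis using gh(1)[OF e] by (simp add: annihilated_def)
      qed
      have "y = lincomb E n u (\<lambda>k. g (?e k))" if uy: "(u, y) \<in> G" for u y
      proof -
        have u: "u \<in> carrier ?P" using G_car(1)[OF uy] .
        then have uk: "u k \<in> carrier R" if "k < n" for k using that by (auto simp: car PiE_iff)
        have "(u, y) \<in> G'" by (rule G'I[OF uy JP(2)]) (use u in simp)
        then have "y = g (lincomb ?P n u ?e)" using gG' E.R.power_module_lincomb_unit[OF u] by simp
        then show ?thesis using lincomb_hom[OF g(1) P.module_axioms E.module_axioms uk e] by simp
      qed
      then show ?thesis
        using w by (intro bexI[of _ "\<lambda>k. g (?e k)"]) (auto simp: lincomb_carrier_update)
    qed
  qed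
qed

text \<open>A direct summand of an injective module is injective: apply the projection to the tuple
  \<open>w\<close> found for \<open>E\<close>.\<close>

lemma relatively_injective_retract:
  assumes inj: "relatively_injective R J E" and E: "module R E"
    and p: "p \<in> hom_module R E E" "\<And>y. y \<in> carrier E \<Longrightarrow> p (p y) = p y"
  shows "relatively_injective R J (E\<lparr>carrier := {y \<in> carrier E. p y = y}\<rparr>)"
proof -
  interpret E: module R E by fact
  interpret RM: module R "ring_as_module R" by (rule E.R.ring_as_module)
  note ph = hom_moduleD[OF p(1)]
  show ?thesis
    unfolding relatively_injective_def
  proof (intro allI impI)
    fix n G
    let ?P = "power_module n (ring_as_module R)" and ?E = "E\<lparr>carrier := {y \<in> carrier E. p y = y}\<rparr>"
    assume G: "G \<subseteq> carrier ?P \<times> carrier ?E"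
      "\<forall>u y u' y'. (u, y) \<in> G \<longrightarrow> (u', y') \<in> G \<longrightarrow> (u \<oplus>\<^bsub>?P\<^esub> u', y \<oplus>\<^bsub>?E\<^esub> y') \<in> G"
      "\<forall>a u y. a \<in> carrier R \<longrightarrow> (u, y) \<in> G \<longrightarrow> (a \<odot>\<^bsub>?P\<^esub> u, a \<odot>\<^bsub>?E\<^esub> y) \<in> G"
      "\<forall>u y. (u, y) \<in> G \<longrightarrow> (\<forall>k<n. u k \<in> J) \<longrightarrow> y = \<zero>\<^bsub>?E\<^esub>"
    have "\<exists>w\<in>{..<n} \<rightarrow> carrier E. \<forall>u y. (u, y) \<in> G \<longrightarrow> y = lincomb E n u w"
      by (rule relatively_injectiveD[OF inj]) (use G in auto)
    then obtain w where w: "w \<in> {..<n} \<rightarrow> carrier E" "\<forall>u y. (u, y) \<in> G \<longrightarrow> y = lincomb E n u w" by blast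
    have wk: "w k \<in> carrier E" if "k < n" for k using w(1) that by auto
    have "y = lincomb E n u (\<lambda>k. p (w k))" if uy: "(u, y) \<in> G" for u y
    proof -
      have uk: "u k \<in> carrier R" if "k < n" for k
        using that uy G(1) by (auto simp: RM.power_module_carrier[simplified] PiE_iff)
      have "y = p y" using uy G(1) by auto
      moreover have "y = lincomb E n u w" using w(2) uy by blast
      ultimately show ?thesis using lincomb_hom[OF p(1) E E, of n u w] uk wk by simp
    qed
    then show "\<exists>w\<in>{..<n} \<rightarrow> carrier ?E. \<forall>u y. (u, y) \<in> G \<longrightarrow> y = lincomb ?E n u w"
      using wk ph(1) p(2) by (intro bexI[of _ "\<lambda>k. p (w k)"]) (auto simp: lincomb_carrier_update)
  qed
qed

context cring begin

text \<open>The last hypothesis makes \<open>b a + c \<mapsto> b y\<close> well defined on (R a + I)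
  / I, and \<open>w\<close> is the value at 1 of its extension to R / I. Equivalently, Hom (R / I,
  E) maps onto Hom (R / (I : a), E) by multiplication with \<open>a\<close>.\<close>

lemma relatively_injective_cyclic_lift:
  fixes E :: "('a, 'e, 'm) module_scheme"
  assumes inj: "relatively_injective R J E" and E: "module R E"
    and I: "ideal I R" "J \<subseteq> I" and a: "a \<in> carrier R" and y: "y \<in> carrier E"
    and "\<And>b. b \<in> carrier R \<Longrightarrow> b \<otimes> a \<in> I \<Longrightarrow> b \<odot>\<^bsub>E\<^esub> y = \<zero>\<^bsub>E\<^esub>"
  obtains w where "w \<in> annihilated E I" "a \<odot>\<^bsub>E\<^esub> w = y"
proof -
  let ?P = "power_module 1 (ring_as_module R)"
  interpret E: module R E by fact
  interpret RM: module R "ring_as_module R" by (rule ring_as_module)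
  interpret P: module R ?P by (rule RM.power_module_module)
  note Id = idealD[OF I(1)] and P_car = RM.power_module_carrier[simplified]
  define G where "G = {(u, b \<odot>\<^bsub>E\<^esub> y) | u b c. u \<in> carrier ?P \<and> b \<in> carrier R \<and> c \<in> I \<and> u 0 = b \<otimes> a \<oplus> c}"
  have GI: "(u, z) \<in> G" if "u \<in> carrier ?P" "b \<in> carrier R" "c \<in> I" "u 0 = b \<otimes> a \<oplus> c" "z = b \<odot>\<^bsub>E\<^esub> y" for u z b c
    using that by (auto simp: G_def)
  have GE: "\<exists>b c. u \<in> carrier ?P \<and> b \<in> carrier R \<and> c \<in> I \<and> u 0 = b \<otimes> a \<oplus> c \<and> z = b \<odot>\<^bsub>E\<^esub> y" if "(u, z) \<in> G" for u z
    using that by (auto simp: G_def)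
  have "\<exists>w\<in>{..<1} \<rightarrow> carrier E. \<forall>u z. (u, z) \<in> G \<longrightarrow> z = lincomb E 1 u w"
  proof (rule relatively_injectiveD[OF inj])
    show "G \<subseteq> carrier ?P \<times> carrier E" using y by (auto simp: G_def)
  next
    fix u z u' z' assume 1: "(u, z) \<in> G" and 2: "(u', z') \<in> G"
    obtain b c where bc: "u \<in> carrier ?P" "b \<in> carrier R" "c \<in> I" "u 0 = b \<otimes> a \<oplus> c" "z = b \<odot>\<^bsub>E\<^esub> y" using GE[OF 1] by blast
    obtain b' c' where bc': "u' \<in> carrier ?P" "b' \<in> carrier R" "c' \<in> I" "u' 0 = b' \<otimes> a \<oplus> c'" "z' = b' \<odot>\<^bsub>E\<^esub> y" using GE[OF 2] by blast
    show "(u \<oplus>\<^bsub>?P\<^esub> u', z \<oplus>\<^bsub>E\<^esub> z') \<in> G"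
    proof (rule GI[OF P.M.add.m_closed[OF bc(1) bc'(1)] a_closed[OF bc(2) bc'(2)] Id(3)[OF bc(3) bc'(3)]])
      show "(u \<oplus>\<^bsub>?P\<^esub> u') 0 = (b \<oplus> b') \<otimes> a \<oplus> (c \<oplus> c')"
        using bc bc' a Id(8) by (simp add: power_module_simps l_distr a_ac)
    qed (use bc bc' y in \<open>simp add: E.smult_l_distr\<close>)
  next
    fix e u z assume e: "e \<in> carrier R" and 1: "(u, z) \<in> G"
    obtain b c where bc: "u \<in> carrier ?P" "b \<in> carrier R" "c \<in> I" "u 0 = b \<otimes> a \<oplus> c" "z = b \<odot>\<^bsub>E\<^esub> y" using GE[OF 1] by blast
    show "(e \<odot>\<^bsub>?P\<^esub> u, e \<odot>\<^bsub>E\<^esub> z) \<in> G"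
    proof (rule GI[OF P.smult_closed[OF e bc(1)] m_closed[OF e bc(2)] Id(4)[OF e bc(3)]])
      show "(e \<odot>\<^bsub>?P\<^esub> u) 0 = (e \<otimes> b) \<otimes> a \<oplus> e \<otimes> c"
        using bc a e Id(8) by (simp add: power_module_simps r_distr m_assoc)
    qed (use bc e y in \<open>simp add: E.smult_assoc1\<close>)
  next
    fix u z assume 1: "(u, z) \<in> G" and 2: "\<And>k. k < 1 \<Longrightarrow> u k \<in> J"
    obtain b c where bc: "u \<in> carrier ?P" "b \<in> carrier R" "c \<in> I" "u 0 = b \<otimes> a \<oplus> c" "z = b \<odot>\<^bsub>E\<^esub> y" using GE[OF 1] by blast
    have "b \<otimes> a \<oplus> c \<in> I" using 2[of 0] bc(4) I(2) by auto
    then have "b \<otimes> a \<in> I" using ideal_diff_iff[OF I(1) _ bc(3), of "b \<otimes> a"] bc(2) a by simp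
    then show "z = \<zero>\<^bsub>E\<^esub>" using assms(7) bc by simp
  qed
  then obtain w where w: "w \<in> {..<1} \<rightarrow> carrier E" "\<forall>u z. (u, z) \<in> G \<longrightarrow> z = lincomb E 1 u w" by blast
  have w0: "w 0 \<in> carrier E" using w(1) by auto
  have val: "z = r \<odot>\<^bsub>E\<^esub> w 0" if "b \<in> carrier R" "c \<in> I" "r = b \<otimes> a \<oplus> c" "z = b \<odot>\<^bsub>E\<^esub> y" for r z b c
  proof -
    have r: "r \<in> carrier R" using that Id(8) a by simp
    have "(\<lambda>k\<in>{..<1}. r, z) \<in> G" by (rule GI[OF _ that(1,2)]) (use that r in \<open>auto simp: P_car\<close>)
    then have "z = lincomb E 1 (\<lambda>k\<in>{..<1}. r) w" using w(2) by blast
    then show ?thesis using w0 r by simp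
  qed
  have "y = a \<odot>\<^bsub>E\<^esub> w 0" by (rule val[of \<one> \<zero>]) (use Id(2) a y in simp_all)
  moreover have "c \<odot>\<^bsub>E\<^esub> w 0 = \<zero>\<^bsub>E\<^esub>" if "c \<in> I" for c
    by (rule val[of \<zero> c, symmetric]) (use that Id(8) a y in simp_all)
  ultimately show thesis using that[of "w 0"] w0 by (simp add: annihilated_def)
qed

end

section \<open>Finite relatively injective resolutions\<close>

text \<open>A finite injective resolution over R / J, with modules over R / J given as R-modules
  killed by \<open>J\<close>. The resolved module is the kernel of \<open>\<delta> 0\<close>; it has
  no name of its own and is only required to be finitely generated.\<close>

locale relatively_injective_resolution = noetherian_local R for R (structure) +
  fixes J :: "'a set" and K :: "nat \<Rightarrow> ('a, 'e) module" and \<delta> :: "nat \<Rightarrow> 'e \<Rightarrow> 'e"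
  assumes ideal_J: "ideal J R"
    and module_K: "\<And>i. module R (K i)"
    and J_K: "\<And>i c y. c \<in> J \<Longrightarrow> y \<in> carrier (K i) \<Longrightarrow> c \<odot>\<^bsub>K i\<^esub> y = \<zero>\<^bsub>K i\<^esub>"
    and inj_K: "\<And>i. relatively_injective R J (K i)"
    and hom_\<delta>: "\<And>i. \<delta> i \<in> hom_module R (K i) (K (Suc i))"
    and exact: "\<And>i. \<delta> i ` carrier (K i) = module_ker (K (Suc i)) (K (Suc (Suc i))) (\<delta> (Suc i))"
    and finite_length: "\<exists>n. \<forall>i\<ge>n. carrier (K i) = {\<zero>\<^bsub>K i\<^esub>}"
    and fg_kernel: "\<exists>S. finite S \<and> S \<subseteq> carrier (K 0) \<and> gen_submodule R (K 0) S = module_ker (K 0) (K 1) (\<delta> 0)"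
begin

interpretation K: module R "K i" for i by (rule module_K)
interpretation RM: module R "ring_as_module R" by (rule ring_as_module)

abbreviation "P n \<equiv> power_module n (ring_as_module R)"

interpretation P: module R "P n" for n by (rule RM.power_module_module)
interpretation PK: module R "power_module n (K i)" for n i by (rule K.power_module_module)

lemmas J_ideal = idealD[OF ideal_J]
lemmas \<delta>_hom = hom_moduleD[OF hom_\<delta>]
lemmas \<delta>_zero = hom_module_zero[OF hom_\<delta> module_K module_K]
lemmas \<delta>_minus = hom_module_minus[OF hom_\<delta> module_K module_K]
lemmas P_car = RM.power_module_carrier[simplified]
lemmas PK_car = K.power_module_carrier

lemma \<delta>_\<delta>: "y \<in> carrier (K i) \<Longrightarrow> \<delta> (Suc i) (\<delta> i y) = \<zero>\<^bsub>K (Suc (Suc i))\<^esub>"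
  using exact[of i] by (auto simp: module_ker_def)

lemma exactE:
  assumes "y \<in> carrier (K (Suc i))" "\<delta> (Suc i) y = \<zero>\<^bsub>K (Suc (Suc i))\<^esub>"
  obtains w where "w \<in> carrier (K i)" "y = \<delta> i w"
  using exact[of i] assms by (auto simp: module_ker_def)

lemma P_apply: "u \<in> carrier (P n) \<Longrightarrow> k < n \<Longrightarrow> u k \<in> carrier R"
  by (auto simp: P_car PiE_iff)

lemma PK_apply: "v \<in> carrier (power_module n (K i)) \<Longrightarrow> k < n \<Longrightarrow> v k \<in> carrier (K i)"
  by (auto simp: PK_car PiE_iff)

lemma lincomb_J:
  "(\<And>k. k < n \<Longrightarrow> u k \<in> J) \<Longrightarrow> v \<in> carrier (power_module n (K i)) \<Longrightarrow> lincomb (K i) n u v = \<zero>\<^bsub>K i\<^esub>"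
  by (rule K.lincomb_zero_left) (use J_ideal(8) J_K PK_apply in auto)

lemma lincomb_\<delta>:
  "(\<And>k. k < n \<Longrightarrow> u k \<in> carrier R) \<Longrightarrow> (\<And>k. k < n \<Longrightarrow> v k \<in> carrier (K i)) \<Longrightarrow>
    lincomb (K (Suc i)) n u (\<lambda>k. \<delta> i (v k)) = \<delta> i (lincomb (K i) n u v)"
  by (rule lincomb_hom[OF hom_\<delta> module_K module_K, symmetric])

text \<open>A tuple that kills \<open>U\<close> is a homomorphism from R^n / U to
  \<open>K i\<close>. As \<open>J\<close> kills \<open>K i\<close>, cycles modulo
  \<open>boundaries\<close> compute Ext over R / J of R^n / (U + J R^n) with values in the kernel of
  \<open>\<delta> 0\<close>.\<close>

definition cycles :: "nat \<Rightarrow> nat \<Rightarrow> (nat \<Rightarrow> 'a) set \<Rightarrow> (nat \<Rightarrow> 'e) set" where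
  "cycles i n U = {v \<in> carrier (power_module n (K i)). (\<forall>k<n. \<delta> i (v k) = \<zero>\<^bsub>K (Suc i)\<^esub>) \<and>
    (\<forall>u\<in>U. lincomb (K i) n u v = \<zero>\<^bsub>K i\<^esub>)}"

definition d_map :: "nat \<Rightarrow> nat \<Rightarrow> (nat \<Rightarrow> 'e) \<Rightarrow> nat \<Rightarrow> 'e" where
  "d_map i n w = (\<lambda>k\<in>{..<n}. \<delta> i (w k))"

primrec boundaries :: "nat \<Rightarrow> nat \<Rightarrow> (nat \<Rightarrow> 'a) set \<Rightarrow> (nat \<Rightarrow> 'e) set" where
  "boundaries 0 n U = {\<zero>\<^bsub>power_module n (K 0)\<^esub>}"
| "boundaries (Suc i) n U =
    d_map i n ` {w \<in> carrier (power_module n (K i)). \<forall>u\<in>U. lincomb (K i) n u w = \<zero>\<^bsub>K i\<^esub>}"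

lemma d_map_hom: "d_map i n \<in> hom_module R (power_module n (K i)) (power_module n (K (Suc i)))"
proof -
  have "d_map i n = (\<lambda>w. \<lambda>k\<in>{..<n}. \<delta> i (w k))" by (intro ext) (simp add: d_map_def)
  moreover have "(\<lambda>w. \<delta> i (w k)) \<in> hom_module R (power_module n (K i)) (K (Suc i))" if "k < n" for k
    using \<delta>_hom PK_apply that by (auto simp: hom_module_def power_module_simps)
  then have "(\<lambda>w. \<lambda>k\<in>{..<n}. \<delta> i (w k)) \<in> hom_module R (power_module n (K i)) (power_module n (K (Suc i)))"
    by (rule K.power_hom)
  ultimately show ?thesis by simp
qed

lemmas d_map_homs = hom_moduleD[OF d_map_hom]

lemmas lincomb_PK_homs = hom_moduleD[OF K.lincomb_hom_right]
lemmas lincomb_PK_zero = hom_module_zero[OF K.lincomb_hom_right PK.module_axioms module_K]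
lemmas lincomb_PK_minus = hom_module_minus[OF K.lincomb_hom_right PK.module_axioms module_K]

lemma cycles_submodule:
  assumes "U \<subseteq> carrier (P n)" shows "submodule (cycles i n U) R (power_module n (K i))"
proof -
  have U: "u k \<in> carrier R" if "u \<in> U" "k < n" for u k using that assms P_apply by blast
  show ?thesis
    unfolding PK.submodule_iff cycles_def
    using U by (auto simp: lincomb_PK_homs lincomb_PK_zero)
      (auto simp: power_module_simps \<delta>_hom \<delta>_zero PK_apply)
qed

lemma lincomb_generators_zero:
  assumes us: "\<And>j. j < m \<Longrightarrow> us j \<in> carrier (P n)" "U = gen_submodule R (P n) (us ` {..<m})"
    and w: "w \<in> carrier (power_module n (K i))" "\<And>j. j < m \<Longrightarrow> lincomb (K i) n (us j) w = \<zero>\<^bsub>K i\<^esub>"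
    and u: "u \<in> U"
  shows "lincomb (K i) n u w = \<zero>\<^bsub>K i\<^esub>"
proof -
  have "(\<lambda>u. lincomb (K i) n u w) \<in> hom_module R (P n) (K i)"
    by (rule K.lincomb_hom_left) (rule PK_apply[OF w(1)])
  from submodule_hom_preimage[OF this P.module_axioms module_K K.zero_submodule]
  have "submodule {u \<in> carrier (P n). lincomb (K i) n u w = \<zero>\<^bsub>K i\<^esub>} R (P n)" by simp
  moreover have "us ` {..<m} \<subseteq> {u \<in> carrier (P n). lincomb (K i) n u w = \<zero>\<^bsub>K i\<^esub>}" using us w by auto
  ultimately have "gen_submodule R (P n) (us ` {..<m}) \<subseteq> {u \<in> carrier (P n). lincomb (K i) n u w = \<zero>\<^bsub>K i\<^esub>}"
    by (rule P.gen_submodule_min)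
  then show ?thesis using u us(2) by auto
qed

lemma submodule_generating_list:
  assumes U: "submodule U R (P n)"
  obtains m :: nat and us where "\<And>j. j < m \<Longrightarrow> us j \<in> carrier (P n)" "U = gen_submodule R (P n) (us ` {..<m})"
proof -
  have one: "gen_submodule R (ring_as_module R) {\<one>} = carrier R"
    using genideal_one genideal_eq_gen_submodule[OF cring_axioms] by metis
  obtain T where T: "finite T" "T \<subseteq> carrier (P n)"
    "{v \<in> carrier (P n). \<forall>k<n. v k \<in> gen_submodule R (ring_as_module R) {\<one>}} \<subseteq> gen_submodule R (P n) T"
    by (rule RM.power_finitely_generated[of "{\<one>}" n]) simp_all
  have "U \<subseteq> gen_submodule R (P n) T"
  proof
    fix u assume "u \<in> U"
    then have "u \<in> carrier (P n)" by (rule P.submoduleD(7)[OF U])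
    then have "u \<in> {v \<in> carrier (P n). \<forall>k<n. v k \<in> gen_submodule R (ring_as_module R) {\<one>}}"
      using P_apply one by simp
    then show "u \<in> gen_submodule R (P n) T" using T(3) by (rule set_rev_mp)
  qed
  then obtain T' where T': "finite T'" "T' \<subseteq> U" "gen_submodule R (P n) T' = U"
    using submodule_finitely_generated[OF noetherian_ring_axioms P.module_axioms T(1,2) U] by blast
  obtain m us where m: "T' = us ` {i. i < (m::nat)}"
    using finite_imp_nat_seg_image_inj_on[OF T'(1)] by blast
  have "{i. i < m} = {..<m}" by auto
  then have T'_eq: "us ` {..<m} = T'" using m by simp
  show thesis
  proof (rule that[of m us])
    fix j assume "j < m"
    then have "us j \<in> T'" using T'_eq by blast
    then have "us j \<in> U" using T'(2) by blast
    then show "us j \<in> carrier (P n)" by (rule P.submoduleD(7)[OF U])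
  qed (simp add: T'_eq T'(3))
qed

text \<open>Dimension shifting along a presentation of \<open>R\<^sup>n / U\<close> with relation module \<open>U'\<close>.\<close>

lemma finitely_generated_cohomology:
  assumes "submodule U R (P n)"
  shows "\<exists>S. finite S \<and> S \<subseteq> cycles i n U \<and>
    cycles i n U \<subseteq> gen_submodule R (power_module n (K i)) (boundaries i n U \<union> S)"
  using assms
proof (induction i arbitrary: n U)
  case 0
  obtain S where S: "finite S" "S \<subseteq> carrier (K 0)" "gen_submodule R (K 0) S = module_ker (K 0) (K 1) (\<delta> 0)"
    using fg_kernel by blast
  obtain T where T: "finite T" "T \<subseteq> carrier (power_module n (K 0))"
    "{v \<in> carrier (power_module n (K 0)). \<forall>k<n. v k \<in> gen_submodule R (K 0) S}
      \<subseteq> gen_submodule R (power_module n (K 0)) T"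
    by (rule K.power_finitely_generated[OF S(1,2)])
  have sub: "submodule (cycles 0 n U) R (power_module n (K 0))"
    by (rule cycles_submodule[OF P.submoduleD(1)[OF 0]])
  have "cycles 0 n U \<subseteq> {v \<in> carrier (power_module n (K 0)). \<forall>k<n. v k \<in> gen_submodule R (K 0) S}"
    using PK_apply S(3) by (auto simp: cycles_def module_ker_def)
  then have "cycles 0 n U \<subseteq> gen_submodule R (power_module n (K 0)) T" using T(3) by (rule subset_trans)
  then obtain S' where S': "finite S'" "S' \<subseteq> cycles 0 n U"
    "gen_submodule R (power_module n (K 0)) S' = cycles 0 n U"
    using submodule_finitely_generated[OF noetherian_ring_axioms PK.module_axioms T(1,2) sub] by blast
  have "cycles 0 n U \<subseteq> gen_submodule R (power_module n (K 0)) (boundaries 0 n U \<union> S')"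
    unfolding S'(3)[symmetric] by (rule PK.gen_submodule_mono) blast
  then show ?case using S' by blast
next
  case (Suc i)
  obtain m :: nat and us where us: "\<And>j. j < m \<Longrightarrow> us j \<in> carrier (P n)" "U = gen_submodule R (P n) (us ` {..<m})"
    using submodule_generating_list[OF Suc.prems] by blast
  have usR: "us j k \<in> carrier R" if "j < m" "k < n" for j k using P_apply[OF us(1)] that by blast
  have killU: "lincomb (K i) n u w = \<zero>\<^bsub>K i\<^esub>"
    if "w \<in> carrier (power_module n (K i))" "\<And>j. j < m \<Longrightarrow> lincomb (K i) n (us j) w = \<zero>\<^bsub>K i\<^esub>" "u \<in> U" for w u i
    by (rule lincomb_generators_zero[of m us n U w i u]) (fact us that)+
  \<comment> \<open>R^m / U' is the image of \<open>U\<close> in (R / J)^n. So there is an exact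
    sequence with R^m / U', (R / J)^n and R^n / (U + J R^n), whose middle term has no cohomology in
    positive degrees.\<close>
  define U' where "U' = {b \<in> carrier (P m). \<forall>k<n. lincomb (P n) m b us k \<in> J}"
  have us_hom: "(\<lambda>b. lincomb (P n) m b us) \<in> hom_module R (P m) (P n)"
    by (rule P.lincomb_hom_left) (rule us(1))
  have "U' = {b \<in> carrier (P m). lincomb (P n) m b us \<in> {v \<in> carrier (P n). \<forall>k<n. v k \<in> J}}"
    using hom_moduleD(1)[OF us_hom] by (auto simp: U'_def)
  moreover have "submodule J R (ring_as_module R)" using ideal_J ideal_iff_submodule[OF cring_axioms] by simp
  ultimately have sU': "submodule U' R (P m)"
    using submodule_hom_preimage[OF us_hom P.module_axioms P.module_axioms RM.power_submodule] by simp
  \<comment> \<open>Relative injectivity: a homomorphism on R^m / U', viewed inside (R / J)^n,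
    extends to all of (R / J)^n.\<close>
  have lift: "\<exists>w\<in>carrier (power_module n (K i)). \<forall>j<m. lincomb (K i) n (us j) w = t j"
    if t: "t \<in> carrier (power_module m (K i))" "\<forall>b\<in>U'. lincomb (K i) m b t = \<zero>\<^bsub>K i\<^esub>" for t i
  proof -
    have tk: "\<And>k. k < m \<Longrightarrow> t k \<in> carrier (K i)" using PK_apply[OF t(1)] .
    have t_hom: "(\<lambda>b. lincomb (K i) m b t) \<in> hom_module R (P m) (K i)"
      by (rule K.lincomb_hom_left) (rule tk)
    define G where "G = {(lincomb (P n) m b us, lincomb (K i) m b t) | b. b \<in> carrier (P m)}"
    have GI: "(x, y) \<in> G" if "b \<in> carrier (P m)" "x = lincomb (P n) m b us" "y = lincomb (K i) m b t" for b x y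
      using that by (auto simp: G_def)
    have GE: "\<exists>b. b \<in> carrier (P m) \<and> x = lincomb (P n) m b us \<and> y = lincomb (K i) m b t" if "(x, y) \<in> G" for x y
      using that by (auto simp: G_def)
    have "\<exists>w\<in>{..<n} \<rightarrow> carrier (K i). \<forall>u y. (u, y) \<in> G \<longrightarrow> y = lincomb (K i) n u w"
    proof (rule relatively_injectiveD[OF inj_K])
      show "G \<subseteq> carrier (P n) \<times> carrier (K i)"
        using P.lincomb_closed[of m _ us] K.lincomb_closed[of m _ t i] us(1) tk P_apply by (auto simp: G_def)
    next
      fix u y u' y' assume 1: "(u, y) \<in> G" and 2: "(u', y') \<in> G"
      obtain b where b: "b \<in> carrier (P m)" "u = lincomb (P n) m b us" "y = lincomb (K i) m b t" using GE[OF 1] by blast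
      obtain b' where b': "b' \<in> carrier (P m)" "u' = lincomb (P n) m b' us" "y' = lincomb (K i) m b' t" using GE[OF 2] by blast
      show "(u \<oplus>\<^bsub>P n\<^esub> u', y \<oplus>\<^bsub>K i\<^esub> y') \<in> G"
        by (rule GI[of "b \<oplus>\<^bsub>P m\<^esub> b'"])
          (use b b' in \<open>simp_all add: hom_moduleD(2)[OF us_hom] hom_moduleD(2)[OF t_hom]\<close>)
    next
      fix a u y assume a: "a \<in> carrier R" and 1: "(u, y) \<in> G"
      obtain b where b: "b \<in> carrier (P m)" "u = lincomb (P n) m b us" "y = lincomb (K i) m b t" using GE[OF 1] by blast
      show "(a \<odot>\<^bsub>P n\<^esub> u, a \<odot>\<^bsub>K i\<^esub> y) \<in> G"
        by (rule GI[of "a \<odot>\<^bsub>P m\<^esub> b"])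
          (use b a in \<open>simp_all add: hom_moduleD(3)[OF us_hom] hom_moduleD(3)[OF t_hom]\<close>)
    next
      fix u y assume 1: "(u, y) \<in> G" and 2: "\<And>k. k < n \<Longrightarrow> u k \<in> J"
      obtain b where b: "b \<in> carrier (P m)" "u = lincomb (P n) m b us" "y = lincomb (K i) m b t" using GE[OF 1] by blast
      then have "b \<in> U'" using 2 by (simp add: U'_def)
      then show "y = \<zero>\<^bsub>K i\<^esub>" using t(2) b by blast
    qed
    then obtain w where w: "w \<in> {..<n} \<rightarrow> carrier (K i)" "\<forall>u y. (u, y) \<in> G \<longrightarrow> y = lincomb (K i) n u w" by blast
    have "lincomb (K i) n (us j) (restrict w {..<n}) = t j" if j: "j < m" for j
    proof -
      let ?e = "unit_vector R m j"
      have e: "?e \<in> carrier (P m)" by (auto simp: P_car unit_vector_def)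
      have "lincomb (P n) m ?e us = us j"
        using P.lincomb_unit[OF j, of us n] us(1) lincomb_cong[of m ?e "\<lambda>k. if k = j then \<one> else \<zero>" us us "P n"]
        by (simp add: unit_vector_def)
      moreover have "lincomb (K i) m ?e t = t j"
        using K.lincomb_unit[OF j, of t i] tk lincomb_cong[of m ?e "\<lambda>k. if k = j then \<one> else \<zero>" t t "K i"]
        by (simp add: unit_vector_def)
      ultimately have "(us j, t j) \<in> G" using GI[OF e] by metis
      then have "t j = lincomb (K i) n (us j) w" using w(2) by blast
      also have "\<dots> = lincomb (K i) n (us j) (restrict w {..<n})" by (rule lincomb_cong) auto
      finally show ?thesis by simp
    qed
    moreover have "restrict w {..<n} \<in> carrier (power_module n (K i))" using w(1) by (auto simp: PK_car)
    ultimately show ?thesis by blast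
  qed
  obtain S' where S': "finite S'" "S' \<subseteq> cycles i m U'"
    "cycles i m U' \<subseteq> gen_submodule R (power_module m (K i)) (boundaries i m U' \<union> S')"
    using Suc.IH[OF sU'] by blast
  have S'_cyc: "t \<in> carrier (power_module m (K i))" "\<forall>k<m. \<delta> i (t k) = \<zero>\<^bsub>K (Suc i)\<^esub>"
    "\<forall>b\<in>U'. lincomb (K i) m b t = \<zero>\<^bsub>K i\<^esub>" if "t \<in> S'" for t
    using that S'(2) by (auto simp: cycles_def)
  have "\<forall>t\<in>S'. \<exists>w. w \<in> carrier (power_module n (K i)) \<and> (\<forall>j<m. lincomb (K i) n (us j) w = t j)"
  proof
    fix t assume t: "t \<in> S'"
    show "\<exists>w. w \<in> carrier (power_module n (K i)) \<and> (\<forall>j<m. lincomb (K i) n (us j) w = t j)"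
      using lift[OF S'_cyc(1)[OF t] S'_cyc(3)[OF t]] by auto
  qed
  then obtain W where W: "\<forall>t\<in>S'. W t \<in> carrier (power_module n (K i)) \<and> (\<forall>j<m. lincomb (K i) n (us j) (W t) = t j)"
    by (rule bchoice[THEN exE])
  have lin_d: "lincomb (K (Suc i)) n u (d_map i n w) = \<delta> i (lincomb (K i) n u w)"
    if "\<And>k. k < n \<Longrightarrow> u k \<in> carrier R" "w \<in> carrier (power_module n (K i))" for u w i
  proof -
    have "lincomb (K (Suc i)) n u (d_map i n w) = lincomb (K (Suc i)) n u (\<lambda>k. \<delta> i (w k))"
      by (rule lincomb_cong) (auto simp: d_map_def)
    then show ?thesis using lincomb_\<delta>[of n u w i] that PK_apply by simp
  qed
  \<comment> \<open>The images of the lower cycles \<open>S'\<close> under the connecting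
    homomorphism: extend to (R / J)^n, then apply the differential.\<close>
  define S where "S = (\<lambda>t. d_map i n (W t)) ` S'"
  have S_cyc: "S \<subseteq> cycles (Suc i) n U"
  proof
    fix v assume "v \<in> S"
    then obtain t where t: "t \<in> S'" "v = d_map i n (W t)" by (auto simp: S_def)
    have w: "W t \<in> carrier (power_module n (K i))" "\<And>j. j < m \<Longrightarrow> lincomb (K i) n (us j) (W t) = t j"
      using W t(1) by auto
    have v: "v \<in> carrier (power_module n (K (Suc i)))" using d_map_homs(1)[OF w(1)] t(2) by simp
    have "\<delta> (Suc i) (v k) = \<zero>\<^bsub>K (Suc (Suc i))\<^esub>" if "k < n" for k
      using that t(2) \<delta>_\<delta> PK_apply[OF w(1)] by (simp add: d_map_def)
    moreover have "lincomb (K (Suc i)) n (us j) v = \<zero>\<^bsub>K (Suc i)\<^esub>" if "j < m" for j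
      using that lin_d[of "us j" "W t" i] usR w S'_cyc(2)[OF t(1)] t(2) by simp
    then have "lincomb (K (Suc i)) n u v = \<zero>\<^bsub>K (Suc i)\<^esub>" if "u \<in> U" for u
      using killU[OF v _ that] by blast
    ultimately show "v \<in> cycles (Suc i) n U" using v by (simp add: cycles_def)
  qed
  let ?B = "boundaries (Suc i) n U"
  have BS: "?B \<union> S \<subseteq> carrier (power_module n (K (Suc i)))"
    using S_cyc d_map_homs(1) by (auto simp: cycles_def)
  let ?H = "gen_submodule R (power_module n (K (Suc i))) (?B \<union> S)"
  note H = PK.submoduleD[OF PK.gen_submodule_submodule[OF BS]]
  have inH: "?B \<union> S \<subseteq> ?H" by (rule PK.gen_submodule_incl)
  \<comment> \<open>Restriction of homomorphisms along R^m \<rightarrow> R^n. The set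
    \<open>\<G>\<close> of restrictions of those \<open>w\<close> whose differential lies in
    \<open>?H\<close> is a submodule, so it suffices to find the generators of the lower cycles in
    it.\<close>
  define \<Phi> where "\<Phi> = (\<lambda>w. \<lambda>j\<in>{..<m}. lincomb (K i) n (us j) w)"
  define \<G> where "\<G> = \<Phi> ` {w \<in> carrier (power_module n (K i)). d_map i n w \<in> ?H}"
  have "\<Phi> \<in> hom_module R (power_module n (K i)) (power_module m (K i))"
    unfolding \<Phi>_def by (intro K.power_hom K.lincomb_hom_right usR)
  then have sG: "submodule \<G> R (power_module m (K i))"
    unfolding \<G>_def
    by (rule submodule_hom_image[OF _ PK.module_axioms PK.module_axioms
          submodule_hom_preimage[OF d_map_hom PK.module_axioms PK.module_axioms PK.gen_submodule_submodule[OF BS]]])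
  have GI: "t \<in> \<G>" if "t \<in> carrier (power_module m (K i))" "w \<in> carrier (power_module n (K i))"
      "\<And>j. j < m \<Longrightarrow> lincomb (K i) n (us j) w = t j" "d_map i n w \<in> ?H" for t w
  proof -
    have "t = \<Phi> w" using that(1,3) by (auto simp: \<Phi>_def PK_car PiE_iff extensional_def fun_eq_iff)
    then show ?thesis using that(2,4) by (simp add: \<G>_def)
  qed
  have GE: "\<exists>w. w \<in> carrier (power_module n (K i)) \<and> (\<forall>j<m. lincomb (K i) n (us j) w = t j) \<and> d_map i n w \<in> ?H"
    if "t \<in> \<G>" for t using that by (auto simp: \<G>_def \<Phi>_def)
  have "S' \<subseteq> \<G>"
  proof
    fix t assume t: "t \<in> S'"
    have "d_map i n (W t) \<in> ?H" using inH t by (auto simp: S_def)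
    then show "t \<in> \<G>" using W t by (intro GI[OF S'_cyc(1)[OF t], of "W t"]) auto
  qed
  \<comment> \<open>The boundary of \<open>x\<close> is the restriction of the boundary of an
    extension of \<open>x\<close>, and the differential of the latter is zero.\<close>
  moreover have "boundaries i m U' \<subseteq> \<G>"
  proof (cases i)
    case 0
    then show ?thesis using PK.submoduleD(2)[OF sG] by simp
  next
    case (Suc i')
    show ?thesis
    proof
      fix t assume "t \<in> boundaries i m U'"
      then obtain x where x: "x \<in> carrier (power_module m (K i'))" "\<forall>b\<in>U'. lincomb (K i') m b x = \<zero>\<^bsub>K i'\<^esub>"
        "t = d_map i' m x" by (auto simp: Suc)
      obtain z where z: "z \<in> carrier (power_module n (K i'))" "\<forall>j<m. lincomb (K i') n (us j) z = x j"
        using lift[OF x(1,2)] by blast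
      show "t \<in> \<G>"
      proof (rule GI)
        show "t \<in> carrier (power_module m (K i))" using d_map_homs(1)[OF x(1)] x(3) Suc by simp
        show "d_map i' n z \<in> carrier (power_module n (K i))" using d_map_homs(1)[OF z(1)] Suc by simp
        show "lincomb (K i) n (us j) (d_map i' n z) = t j" if "j < m" for j
          using lin_d[OF usR[OF that] z(1)] z(2) x(3) that Suc by (simp add: d_map_def)
        have "d_map i n (d_map i' n z) = \<zero>\<^bsub>power_module n (K (Suc i))\<^esub>"
          unfolding Suc using \<delta>_\<delta> PK_apply[OF z(1)] by (auto simp: d_map_def power_module_simps intro!: restrict_ext)
        then show "d_map i n (d_map i' n z) \<in> ?H" using H(2) by simp
      qed
    qed
  qed
  ultimately have "gen_submodule R (power_module m (K i)) (boundaries i m U' \<union> S') \<subseteq> \<G>"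
    by (intro PK.gen_submodule_min[OF sG]) blast
  then have cyc_G: "cycles i m U' \<subseteq> \<G>" using S'(3) by (rule subset_trans[rotated])
  have "cycles (Suc i) n U \<subseteq> ?H"
  proof
    fix v assume v: "v \<in> cycles (Suc i) n U"
    then have vP: "v \<in> carrier (power_module n (K (Suc i)))" by (simp add: cycles_def)
    have "\<forall>k\<in>{..<n}. \<exists>x. x \<in> carrier (K i) \<and> v k = \<delta> i x"
    proof
      fix k assume k: "k \<in> {..<n}"
      then have "v k \<in> carrier (K (Suc i))" "\<delta> (Suc i) (v k) = \<zero>\<^bsub>K (Suc (Suc i))\<^esub>"
        using PK_apply[OF vP] v by (auto simp: cycles_def)
      then show "\<exists>x. x \<in> carrier (K i) \<and> v k = \<delta> i x" using exactE by metis
    qed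
    then obtain w0 where w0: "\<forall>k\<in>{..<n}. w0 k \<in> carrier (K i) \<and> v k = \<delta> i (w0 k)" by (rule bchoice[THEN exE])
    define w where "w = restrict w0 {..<n}"
    have w: "w \<in> carrier (power_module n (K i))" using w0 by (auto simp: w_def PK_car)
    have vw: "v = d_map i n w"
      using w0 vP by (auto simp: w_def d_map_def PK_car PiE_iff extensional_def fun_eq_iff)
    define t where "t = (\<lambda>j\<in>{..<m}. lincomb (K i) n (us j) w)"
    have t: "t \<in> carrier (power_module m (K i))"
      using K.lincomb_closed[of n _ w i] usR PK_apply[OF w] by (auto simp: t_def PK_car)
    have "\<delta> i (t j) = \<zero>\<^bsub>K (Suc i)\<^esub>" if j: "j < m" for j
    proof -
      have "us j \<in> U" using us(2) P.gen_submodule_incl[of "us ` {..<m}"] j by auto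
      then have "lincomb (K (Suc i)) n (us j) v = \<zero>\<^bsub>K (Suc i)\<^esub>" using v by (simp add: cycles_def)
      then show ?thesis using lin_d[OF usR[OF j] w] vw j by (simp add: t_def)
    qed
    moreover have "lincomb (K i) m b t = \<zero>\<^bsub>K i\<^esub>" if b: "b \<in> U'" for b
    proof -
      have bP: "b \<in> carrier (P m)" and bJ: "\<And>k. k < n \<Longrightarrow> lincomb (P n) m b us k \<in> J" using b by (auto simp: U'_def)
      have "lincomb (K i) m b t = lincomb (K i) m b (\<lambda>j. lincomb (K i) n (us j) w)"
        by (rule lincomb_cong) (auto simp: t_def)
      also have "\<dots> = lincomb (K i) n (lincomb (P n) m b us) w"
        using K.lincomb_swap[of m b us n w i] P_apply[OF bP] us(1) PK_apply[OF w] by simp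
      also have "\<dots> = \<zero>\<^bsub>K i\<^esub>" using bJ w by (rule lincomb_J)
      finally show ?thesis .
    qed
    ultimately have "t \<in> cycles i m U'" using t by (simp add: cycles_def)
    then have "t \<in> \<G>" using cyc_G by blast
    then obtain x where x: "x \<in> carrier (power_module n (K i))" "\<forall>j<m. lincomb (K i) n (us j) x = t j" "d_map i n x \<in> ?H"
      using GE by blast
    \<comment> \<open>Both \<open>w\<close> and \<open>x\<close> restrict to \<open>t\<close>, so
      their difference kills \<open>U\<close> and its differential is a boundary.\<close>
    have wx: "w \<ominus>\<^bsub>power_module n (K i)\<^esub> x \<in> carrier (power_module n (K i))" using w x by simp
    have "lincomb (K i) n (us j) (w \<ominus>\<^bsub>power_module n (K i)\<^esub> x) = \<zero>\<^bsub>K i\<^esub>" if j: "j < m" for j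
      using lincomb_PK_minus[OF usR[OF j] w x(1)] x(2) j PK_apply[OF t j]
      by (simp add: t_def K.minus_eq_zero_iff)
    then have "\<forall>u\<in>U. lincomb (K i) n u (w \<ominus>\<^bsub>power_module n (K i)\<^esub> x) = \<zero>\<^bsub>K i\<^esub>"
      using killU[OF wx] by blast
    then have "d_map i n (w \<ominus>\<^bsub>power_module n (K i)\<^esub> x) \<in> ?B" using wx by simp
    then have "d_map i n (w \<ominus>\<^bsub>power_module n (K i)\<^esub> x) \<in> ?H" using inH by blast
    then have "d_map i n (w \<ominus>\<^bsub>power_module n (K i)\<^esub> x) \<oplus>\<^bsub>power_module n (K (Suc i))\<^esub> d_map i n x \<in> ?H"
      using x(3) by (rule H(3))
    then show "v \<in> ?H" using d_map_homs(2)[OF wx x(1)] PK.add_minus_cancel[OF w x(1)] vw by simp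
  qed
  moreover have "finite S" using S'(1) by (simp add: S_def)
  ultimately show ?case using S_cyc by blast
qed

end

section \<open>Vanishing of Ext over R / J and Bass's argument\<close>

context relatively_injective_resolution begin

interpretation K: module R "K i" for i by (rule module_K)
interpretation RM: module R "ring_as_module R" by (rule ring_as_module)
interpretation P: module R "P n" for n by (rule RM.power_module_module)
interpretation PK: module R "power_module n (K i)" for n i by (rule K.power_module_module)

text \<open>The cohomology of \<open>Hom (R / I, K)\<close>.\<close>

definition ann_cycles :: "nat \<Rightarrow> 'a set \<Rightarrow> 'e set" where
  "ann_cycles i I = {y \<in> annihilated (K i) I. \<delta> i y = \<zero>\<^bsub>K (Suc i)\<^esub>}"

primrec ann_boundaries :: "nat \<Rightarrow> 'a set \<Rightarrow> 'e set" where
  "ann_boundaries 0 I = {\<zero>\<^bsub>K 0\<^esub>}"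
| "ann_boundaries (Suc i) I = \<delta> i ` annihilated (K i) I"

lemma ann_cyclesD: "y \<in> ann_cycles i I \<Longrightarrow> y \<in> carrier (K i)"
  "y \<in> ann_cycles i I \<Longrightarrow> c \<in> I \<Longrightarrow> c \<odot>\<^bsub>K i\<^esub> y = \<zero>\<^bsub>K i\<^esub>"
  "y \<in> ann_cycles i I \<Longrightarrow> \<delta> i y = \<zero>\<^bsub>K (Suc i)\<^esub>"
  "y \<in> ann_cycles i I \<Longrightarrow> y \<in> annihilated (K i) I"
  by (auto simp: ann_cycles_def annihilated_def)

lemma ann_cyclesI:
  "y \<in> carrier (K i) \<Longrightarrow> (\<And>c. c \<in> I \<Longrightarrow> c \<odot>\<^bsub>K i\<^esub> y = \<zero>\<^bsub>K i\<^esub>) \<Longrightarrow> \<delta> i y = \<zero>\<^bsub>K (Suc i)\<^esub> \<Longrightarrow>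
    y \<in> ann_cycles i I"
  by (auto simp: ann_cycles_def annihilated_def)

lemma ann_cycles_submodule:
  assumes "ideal I R" shows "submodule (ann_cycles i I) R (K i)"
proof -
  have "ann_cycles i I = annihilated (K i) I \<inter> {y \<in> carrier (K i). \<delta> i y \<in> {\<zero>\<^bsub>K (Suc i)\<^esub>}}"
    by (auto simp: ann_cycles_def annihilated_def)
  then show ?thesis
    using K.submodule_Int[OF K.annihilated_submodule[OF idealD(1)[OF assms]]
        submodule_hom_preimage[OF hom_\<delta> module_K module_K K.zero_submodule]] by simp
qed

lemma ann_boundaries_submodule:
  assumes "ideal I R" shows "submodule (ann_boundaries i I) R (K i)"
proof (cases i)
  case 0
  then show ?thesis using K.zero_submodule by simp
next
  case (Suc i')
  then show ?thesis
    using submodule_hom_image[OF hom_\<delta> module_K module_K K.annihilated_submodule[OF idealD(1)[OF assms]]] by simp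
qed

lemma ann_boundaries_le_cycles:
  assumes "ideal I R" shows "ann_boundaries i I \<subseteq> ann_cycles i I"
proof (cases i)
  case 0
  then show ?thesis using K.submoduleD(2)[OF ann_cycles_submodule[OF assms], of 0] by simp
next
  case (Suc i')
  show ?thesis
  proof
    fix y assume "y \<in> ann_boundaries i I"
    then obtain w where w: "w \<in> annihilated (K i') I" "y = \<delta> i' w" using Suc by auto
    have wK: "w \<in> carrier (K i')" using annihilatedD(1)[OF w(1)] .
    have "c \<odot>\<^bsub>K i\<^esub> y = \<zero>\<^bsub>K i\<^esub>" if "c \<in> I" for c
      using \<delta>_hom(3)[OF idealD(8)[OF assms that] wK] annihilatedD(2)[OF w(1) that] w(2) \<delta>_zero Suc by simp
    then show "y \<in> ann_cycles i I" using w(2) \<delta>_hom(1)[OF wK] \<delta>_\<delta>[OF wK] Suc by (intro ann_cyclesI) auto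
  qed
qed

lemma cyclic_lift:
  assumes I: "ideal I R" "J \<subseteq> I" and a: "a \<in> carrier R" and y: "y \<in> carrier (K i)"
    and "\<And>b. b \<in> carrier R \<Longrightarrow> b \<otimes> a \<in> I \<Longrightarrow> b \<odot>\<^bsub>K i\<^esub> y = \<zero>\<^bsub>K i\<^esub>"
  obtains w where "w \<in> annihilated (K i) I" "a \<odot>\<^bsub>K i\<^esub> w = y"
  using relatively_injective_cyclic_lift[OF inj_K module_K assms] by blast

text \<open>The hypothesis says that multiplication by \<open>a\<close> is onto on the cohomology,
  which is finitely generated; as \<open>a\<close> lies in \<open>\<mm>\<close>, the cohomology
  vanishes.\<close>

lemma nakayama_cohomology:
  assumes I: "ideal I R" and a: "a \<in> \<mm>"
    and div: "\<And>y. y \<in> ann_cycles i I \<Longrightarrow> \<exists>z\<in>ann_cycles i I. y = a \<odot>\<^bsub>K i\<^esub> z"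
  shows "ann_cycles i I \<subseteq> ann_boundaries i I"
proof -
  note Id = idealD[OF I]
  \<comment> \<open>The ideal \<open>I\<close> inside \<open>R^1\<close>, to which the finiteness
    result for R^n / U is applied.\<close>
  define U where "U = {u \<in> carrier (P 1). u 0 \<in> I}"
  have "submodule I R (ring_as_module R)" using I ideal_iff_submodule[OF cring_axioms] by simp
  from RM.power_submodule[OF this, where n = 1] have "submodule U R (P 1)" by (simp add: U_def)
  then have "\<exists>S. finite S \<and> S \<subseteq> cycles i 1 U \<and>
      cycles i 1 U \<subseteq> gen_submodule R (power_module 1 (K i)) (boundaries i 1 U \<union> S)"
    by (rule finitely_generated_cohomology)
  then obtain S where S: "finite S" "S \<subseteq> cycles i 1 U"
    "cycles i 1 U \<subseteq> gen_submodule R (power_module 1 (K i)) (boundaries i 1 U \<union> S)"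
    by blast
  have lin1: "lincomb (K i) 1 u v = u 0 \<odot>\<^bsub>K i\<^esub> v 0" if "u 0 \<in> carrier R" "v 0 \<in> carrier (K i)" for u v i
    using that by simp
  have U_unit: "(\<lambda>k\<in>{..<1}. c) \<in> U" if "c \<in> I" for c using that Id(8) by (auto simp: U_def P_car)
  have kill: "v 0 \<in> annihilated (K i) I"
    if v: "v \<in> carrier (power_module 1 (K i))" "\<forall>u\<in>U. lincomb (K i) 1 u v = \<zero>\<^bsub>K i\<^esub>" for v i
  proof -
    have v0: "v 0 \<in> carrier (K i)" using PK_apply[OF v(1), of 0] by simp
    have "c \<odot>\<^bsub>K i\<^esub> v 0 = \<zero>\<^bsub>K i\<^esub>" if "c \<in> I" for c
    proof -
      have "lincomb (K i) 1 (\<lambda>k\<in>{..<1}. c) v = \<zero>\<^bsub>K i\<^esub>" using v(2) U_unit[OF that] by blast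
      then show ?thesis using v0 Id(8)[OF that] by simp
    qed
    then show ?thesis using v0 by (simp add: annihilated_def)
  qed
  let ?W = "ann_boundaries i I" and ?Z = "ann_cycles i I"
  define S1 where "S1 = (\<lambda>v. v 0) ` S"
  have "S1 \<subseteq> ?Z"
  proof
    fix y assume "y \<in> S1"
    then obtain v where v: "v \<in> cycles i 1 U" "y = v 0" using S(2) by (auto simp: S1_def)
    then show "y \<in> ?Z" using kill[of v i] by (auto simp: cycles_def ann_cycles_def)
  qed
  note sZ = ann_cycles_submodule[OF I, of i]
  have WS: "?W \<union> S1 \<subseteq> ?Z" using ann_boundaries_le_cycles[OF I] \<open>S1 \<subseteq> ?Z\<close> by blast
  have WSK: "?W \<union> S1 \<subseteq> carrier (K i)" using WS K.submoduleD(1)[OF sZ] by (rule subset_trans)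
  let ?H = "gen_submodule R (K i) (?W \<union> S1)"
  note H = K.submoduleD[OF K.gen_submodule_submodule[OF WSK]]
  have inH: "?W \<union> S1 \<subseteq> ?H" by (rule K.gen_submodule_incl)
  have HZ: "?H \<subseteq> ?Z" by (rule K.gen_submodule_min[OF sZ WS])
  have sV: "submodule {v \<in> carrier (power_module 1 (K i)). v 0 \<in> ?H} R (power_module 1 (K i))"
    using K.power_submodule[OF K.gen_submodule_submodule[OF WSK], where n = 1] by simp
  have "boundaries i 1 U \<union> S \<subseteq> {v \<in> carrier (power_module 1 (K i)). v 0 \<in> ?H}"
  proof (rule Un_least)
    show "S \<subseteq> {v \<in> carrier (power_module 1 (K i)). v 0 \<in> ?H}"
      using S(2) inH by (auto simp: cycles_def S1_def)
    show "boundaries i 1 U \<subseteq> {v \<in> carrier (power_module 1 (K i)). v 0 \<in> ?H}"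
    proof (cases i)
      case 0
      then show ?thesis using PK.submoduleD(2)[OF sV] by simp
    next
      case (Suc i')
      show ?thesis
      proof
        fix v assume "v \<in> boundaries i 1 U"
        then obtain w where w: "w \<in> carrier (power_module 1 (K i'))" "\<forall>u\<in>U. lincomb (K i') 1 u w = \<zero>\<^bsub>K i'\<^esub>"
          "v = d_map i' 1 w" using Suc by auto
        have "v 0 \<in> ?W" using kill[OF w(1,2)] w(3) Suc by (simp add: d_map_def)
        then show "v \<in> {v \<in> carrier (power_module 1 (K i)). v 0 \<in> ?H}"
          using inH d_map_homs(1)[OF w(1)] w(3) Suc by auto
      qed
    qed
  qed
  then have "gen_submodule R (power_module 1 (K i)) (boundaries i 1 U \<union> S)
      \<subseteq> {v \<in> carrier (power_module 1 (K i)). v 0 \<in> ?H}" by (rule PK.gen_submodule_min[OF sV])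
  then have cyc: "cycles i 1 U \<subseteq> {v \<in> carrier (power_module 1 (K i)). v 0 \<in> ?H}" using S(3) by (rule subset_trans[rotated])
  have "?Z \<subseteq> ?H"
  proof
    fix y assume y: "y \<in> ?Z"
    have yK: "y \<in> carrier (K i)" using ann_cyclesD(1)[OF y] .
    have "lincomb (K i) 1 u (\<lambda>k\<in>{..<1}. y) = \<zero>\<^bsub>K i\<^esub>" if "u \<in> U" for u
      using lin1[of u "\<lambda>k\<in>{..<1}. y" i] that yK Id(8) ann_cyclesD(2)[OF y] by (simp add: U_def)
    then have "(\<lambda>k\<in>{..<1}. y) \<in> cycles i 1 U"
      using yK ann_cyclesD(3)[OF y] by (auto simp: cycles_def PK_car)
    then show "y \<in> ?H" using cyc by auto
  qed
  then have eq: "?H = ?Z" using HZ by blast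
  have "?H \<subseteq> ?W"
  proof (rule nakayama[OF module_K ann_boundaries_submodule[OF I]])
    show "finite S1" using S(1) by (simp add: S1_def)
    show "S1 \<subseteq> carrier (K i)" using WSK by blast
    show "?H \<subseteq> gen_submodule R (K i) (?W \<union> {c \<odot>\<^bsub>K i\<^esub> z |c z. c \<in> \<mm> \<and> z \<in> ?H})"
      unfolding eq
    proof
      fix y assume "y \<in> ?Z"
      then obtain z where "z \<in> ?Z" "y = a \<odot>\<^bsub>K i\<^esub> z" using div by blast
      then have "y \<in> ?W \<union> {c \<odot>\<^bsub>K i\<^esub> z |c z. c \<in> \<mm> \<and> z \<in> ?Z}" using a by blast
      then show "y \<in> gen_submodule R (K i) (?W \<union> {c \<odot>\<^bsub>K i\<^esub> z |c z. c \<in> \<mm> \<and> z \<in> ?Z})"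
        by (rule subsetD[OF K.gen_submodule_incl])
    qed
  qed
  then show ?thesis using eq by simp
qed

lemmas \<delta>_annihilated = hom_annihilated[OF hom_\<delta> module_K module_K]

text \<open>The connecting homomorphism: \<open>\<delta> w\<close> is a cycle modulo \<open>I + (a)\<close> if \<open>a w\<close> is a cycle.\<close>

lemma connecting_lift:
  assumes I: "ideal I R" and a: "a \<in> carrier R" and w: "w \<in> annihilated (K i) I"
    and cyc: "\<delta> i (a \<odot>\<^bsub>K i\<^esub> w) = \<zero>\<^bsub>K (Suc i)\<^esub>"
    and van: "ann_cycles (Suc i) (adjoin R I a) \<subseteq> ann_boundaries (Suc i) (adjoin R I a)"
  shows "\<exists>z\<in>ann_cycles i I. a \<odot>\<^bsub>K i\<^esub> z = a \<odot>\<^bsub>K i\<^esub> w"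
proof -
  note Id = idealD[OF I] and ad = adjoin[OF I a]
  have wK: "w \<in> carrier (K i)" using annihilatedD(1)[OF w] .
  have "\<delta> i w \<in> annihilated (K (Suc i)) (adjoin R I a)"
    using \<delta>_annihilated[OF w Id(1)] \<delta>_hom(3)[OF a wK] cyc by (intro K.annihilated_adjoinI a Id(1)) auto
  then have "\<delta> i w \<in> ann_cycles (Suc i) (adjoin R I a)" using \<delta>_\<delta>[OF wK] by (simp add: ann_cycles_def)
  then have "\<delta> i w \<in> ann_boundaries (Suc i) (adjoin R I a)" using van by blast
  \<comment> \<open>The element \<open>x\<close> is killed by \<open>a\<close> and has the same
    differential as \<open>w\<close>. Hence \<open>w - x\<close> is a cycle with the same multiple
    by \<open>a\<close>.\<close>
  then obtain x where x: "x \<in> annihilated (K i) (adjoin R I a)" "\<delta> i w = \<delta> i x" by auto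
  have xK: "x \<in> carrier (K i)" using annihilatedD(1)[OF x(1)] .
  have xI: "x \<in> annihilated (K i) I" by (rule subsetD[OF annihilated_mono[OF ad(2)] x(1)])
  have ax: "a \<odot>\<^bsub>K i\<^esub> x = \<zero>\<^bsub>K i\<^esub>" using annihilatedD(2)[OF x(1) ad(3)] .
  have "w \<ominus>\<^bsub>K i\<^esub> x \<in> annihilated (K i) I"
    using K.submoduleD(6)[OF K.annihilated_submodule[OF Id(1)] w xI] .
  moreover have "\<delta> i (w \<ominus>\<^bsub>K i\<^esub> x) = \<zero>\<^bsub>K (Suc i)\<^esub>"
    using \<delta>_minus[OF wK xK] x(2) \<delta>_hom(1)[OF xK] by (simp add: K.minus_eq_zero_iff)
  ultimately have "w \<ominus>\<^bsub>K i\<^esub> x \<in> ann_cycles i I" by (simp add: ann_cycles_def)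
  moreover have "a \<odot>\<^bsub>K i\<^esub> (w \<ominus>\<^bsub>K i\<^esub> x) = a \<odot>\<^bsub>K i\<^esub> w"
    using wK xK a ax by (simp add: K.smult_minus_distr) (simp add: a_minus_def)
  ultimately show ?thesis by blast
qed

text \<open>The middle term of the long exact sequence of 0 \<rightarrow> R / (I : a) \<rightarrow>
  R / I \<rightarrow> R / (I + R a) \<rightarrow> 0, the first map being multiplication by
  \<open>a\<close>.\<close>

lemma vanishing_extension:
  assumes I: "ideal I R" "J \<subseteq> I" and a: "a \<in> carrier R"
    and v1: "ann_cycles i (colon R (ring_as_module R) I a) \<subseteq> ann_boundaries i (colon R (ring_as_module R) I a)"
    and v2: "ann_cycles i (adjoin R I a) \<subseteq> ann_boundaries i (adjoin R I a)"
  shows "ann_cycles i I \<subseteq> ann_boundaries i I"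
proof
  note Id = idealD[OF I(1)] and ad = adjoin[OF I(1) a]
  fix y assume y: "y \<in> ann_cycles i I"
  have yK: "y \<in> carrier (K i)" using ann_cyclesD(1)[OF y] .
  let ?C = "colon R (ring_as_module R) I a"
  have "a \<odot>\<^bsub>K i\<^esub> y \<in> ann_cycles i ?C"
  proof (rule ann_cyclesI)
    fix c assume c: "c \<in> ?C"
    then have "c \<in> carrier R" "c \<otimes> a \<in> I" by (auto simp: colon_def)
    then show "c \<odot>\<^bsub>K i\<^esub> (a \<odot>\<^bsub>K i\<^esub> y) = \<zero>\<^bsub>K i\<^esub>"
      using ann_cyclesD(2)[OF y, of "c \<otimes> a"] a yK by (simp add: K.smult_assoc1)
  next
    show "\<delta> i (a \<odot>\<^bsub>K i\<^esub> y) = \<zero>\<^bsub>K (Suc i)\<^esub>" using \<delta>_hom(3)[OF a yK] ann_cyclesD(3)[OF y] a by simp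
  qed (use a yK in simp)
  then have ay: "a \<odot>\<^bsub>K i\<^esub> y \<in> ann_boundaries i ?C" using v1 by blast
  show "y \<in> ann_boundaries i I"
  proof (cases i)
    case 0
    then have "a \<odot>\<^bsub>K i\<^esub> y = \<zero>\<^bsub>K i\<^esub>" using ay by simp
    then have "y \<in> annihilated (K i) (adjoin R I a)"
      using ann_cyclesD(4)[OF y] a Id(1) by (intro K.annihilated_adjoinI)
    then have "y \<in> ann_cycles i (adjoin R I a)" using ann_cyclesD(3)[OF y] by (simp add: ann_cycles_def)
    then have "y \<in> ann_boundaries i (adjoin R I a)" using v2 by blast
    then show ?thesis using 0 by simp
  next
    case (Suc i')
    then obtain z where z: "z \<in> annihilated (K i') ?C" "a \<odot>\<^bsub>K i\<^esub> y = \<delta> i' z" using ay by auto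
    have zK: "z \<in> carrier (K i')" using annihilatedD(1)[OF z(1)] .
    \<comment> \<open>Lift the cochain \<open>z\<close> on R / (I : a) to a cochain \<open>x\<close>
      on R / I with \<open>a x = z\<close>. After subtracting \<open>\<delta> x\<close> the cycle
      \<open>y\<close> is killed by \<open>a\<close> as well and comes from R / (I + R a).\<close>
    obtain x where x: "x \<in> annihilated (K i') I" "a \<odot>\<^bsub>K i'\<^esub> x = z"
    proof (rule cyclic_lift[OF I a zK])
      fix b assume "b \<in> carrier R" "b \<otimes> a \<in> I"
      then have "b \<in> ?C" by (simp add: colon_def)
      then show "b \<odot>\<^bsub>K i'\<^esub> z = \<zero>\<^bsub>K i'\<^esub>" by (rule annihilatedD(2)[OF z(1)])
    qed
    have xK: "x \<in> carrier (K i')" using annihilatedD(1)[OF x(1)] .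
    let ?u = "y \<ominus>\<^bsub>K i\<^esub> \<delta> i' x"
    have dx: "\<delta> i' x \<in> carrier (K i)" using \<delta>_hom(1)[OF xK] Suc by simp
    have "\<delta> i' x \<in> annihilated (K i) I" using \<delta>_annihilated[OF x(1) Id(1)] Suc by simp
    then have uI: "?u \<in> annihilated (K i) I"
      using K.submoduleD(6)[OF K.annihilated_submodule[OF Id(1)] ann_cyclesD(4)[OF y]] by blast
    have "a \<odot>\<^bsub>K i\<^esub> \<delta> i' x = \<delta> i' z" using \<delta>_hom(3)[OF a xK] x(2) Suc by simp
    then have "a \<odot>\<^bsub>K i\<^esub> ?u = \<zero>\<^bsub>K i\<^esub>"
      using yK dx a z(2) \<delta>_hom(1)[OF zK] Suc by (simp add: K.smult_minus_distr K.minus_eq_zero_iff)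
    then have "?u \<in> annihilated (K i) (adjoin R I a)" using uI a Id(1) by (intro K.annihilated_adjoinI)
    moreover have "\<delta> i ?u = \<zero>\<^bsub>K (Suc i)\<^esub>"
      using \<delta>_minus[OF yK dx] ann_cyclesD(3)[OF y] \<delta>_\<delta>[OF xK] Suc by (simp add: K.minus_eq_zero_iff)
    ultimately have "?u \<in> ann_cycles i (adjoin R I a)" by (simp add: ann_cycles_def)
    then have "?u \<in> ann_boundaries i (adjoin R I a)" using v2 by blast
    then obtain v where v: "v \<in> annihilated (K i') (adjoin R I a)" "?u = \<delta> i' v" using Suc by auto
    have vK: "v \<in> carrier (K i')" using annihilatedD(1)[OF v(1)] .
    have vI: "v \<in> annihilated (K i') I" by (rule subsetD[OF annihilated_mono[OF ad(2)] v(1)])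
    have "y = ?u \<oplus>\<^bsub>K i\<^esub> \<delta> i' x" using K.add_minus_cancel[OF yK dx] by simp
    also have "\<dots> = \<delta> i' (v \<oplus>\<^bsub>K i'\<^esub> x)" using \<delta>_hom(2)[OF vK xK] v(2) Suc by simp
    finally show ?thesis
      using K.submoduleD(3)[OF K.annihilated_submodule[OF Id(1)] vI x(1)] Suc by simp
  qed
qed

text \<open>Noetherian induction reduces the vanishing for all cyclic modules to that for the residue
  field; a regular element is handled by Nakayama's lemma.\<close>

lemma vanishing_from_residue_field:
  assumes van: "\<And>I. ideal I R \<Longrightarrow> J \<subseteq> I \<Longrightarrow> ann_cycles (Suc i) I \<subseteq> ann_boundaries (Suc i) I"
    and res: "ann_cycles i \<mm> \<subseteq> ann_boundaries i \<mm>"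
    and "ideal I R" "J \<subseteq> I"
  shows "ann_cycles i I \<subseteq> ann_boundaries i I"
  using assms(3,4)
proof (induction rule: ideal_noetherian_induct)
  case (step I)
  note Id = idealD[OF step(1)]
  consider "I = carrier R" | "I = \<mm>" | "I \<noteq> carrier R" "I \<noteq> \<mm>" by blast
  then show ?case
  proof cases
    case 1
    have "y = \<zero>\<^bsub>K i\<^esub>" if "y \<in> ann_cycles i I" for y
      using ann_cyclesD(2)[OF that, of \<one>] ann_cyclesD(1)[OF that] 1 by simp
    then show ?thesis using K.submoduleD(2)[OF ann_boundaries_submodule[OF step(1)]] by auto
  next
    case 2
    then show ?thesis using res by simp
  next
    case 3
    then have "I \<subset> \<mm>" using proper_ideal_le_max_ideal[OF step(1)] by blast
    then obtain a where a: "a \<in> \<mm>" "a \<notin> I" by blast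
    have aR: "a \<in> carrier R" using max_idealD(8)[OF a(1)] .
    note ad = adjoin[OF step(1) aR]
    have Iad: "I \<subset> adjoin R I a" "J \<subseteq> adjoin R I a" using ad a(2) step(3) by auto
    let ?C = "colon R (ring_as_module R) I a"
    have idC: "ideal ?C R"
      using RM.colon_ideal[of I a] aR step(1) ideal_iff_submodule[OF cring_axioms] by simp
    have IC: "I \<subseteq> ?C" using Id(5,8) aR by (auto simp: colon_def)
    show ?thesis
    \<comment> \<open>Either both outer terms of the exact sequence belong to strictly larger
      ideals, or \<open>a\<close> is regular on R / I.\<close>
    proof (cases "?C = I")
      case False
      then have "I \<subset> ?C" using IC by blast
      then have "ann_cycles i ?C \<subseteq> ann_boundaries i ?C" using step(2)[OF idC] step(3) by blast
      moreover have "ann_cycles i (adjoin R I a) \<subseteq> ann_boundaries i (adjoin R I a)"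
        using step(2)[OF ad(1) Iad(1)] Iad(2) by blast
      ultimately show ?thesis by (rule vanishing_extension[OF step(1,3) aR])
    next
      case True
      show ?thesis
      proof (rule nakayama_cohomology[OF step(1) a(1)])
        fix y assume y: "y \<in> ann_cycles i I"
        obtain w where w: "w \<in> annihilated (K i) I" "a \<odot>\<^bsub>K i\<^esub> w = y"
        proof (rule cyclic_lift[OF step(1,3) aR ann_cyclesD(1)[OF y]])
          fix b assume "b \<in> carrier R" "b \<otimes> a \<in> I"
          then have "b \<in> ?C" by (simp add: colon_def)
          then show "b \<odot>\<^bsub>K i\<^esub> y = \<zero>\<^bsub>K i\<^esub>" using ann_cyclesD(2)[OF y] True by simp
        qed
        \<comment> \<open>The quotient \<open>w\<close> of \<open>y\<close> by \<open>a\<close> need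
          not be a cycle; the vanishing in degree \<open>i + 1\<close> for I + R a allows it to be
          corrected to one.\<close>
        have "\<exists>z\<in>ann_cycles i I. a \<odot>\<^bsub>K i\<^esub> z = a \<odot>\<^bsub>K i\<^esub> w"
          by (rule connecting_lift[OF step(1) aR w(1) _ van[OF ad(1) Iad(2)]])
            (use w(2) ann_cyclesD(3)[OF y] in simp)
        then show "\<exists>z\<in>ann_cycles i I. y = a \<odot>\<^bsub>K i\<^esub> z" using w(2) by metis
      qed
    qed
  qed
qed

text \<open>Multiplication by \<open>s\<close> embeds k into R / J. If all Ext in degree
  \<open>i + 1\<close> vanish, then Ext^i of R / J maps onto Ext^i of k. This map is zero: for
  positive \<open>i\<close> its source vanishes, and for \<open>i = 0\<close> it is multiplication
  by \<open>s\<close> on the kernel, which \<open>kill\<close> annihilates. So Ext^i of k vanishes,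
  then Ext^i of every R / I with \<open>I\<close> over \<open>J\<close>. Descending from the end of
  the resolution to degree 0 with \<open>I = J\<close> shows that the kernel itself is zero.\<close>

theorem kernel_faithful_on_socle:
  assumes s: "s \<in> carrier R" "colon R (ring_as_module R) J s = \<mm>" and J: "J \<subseteq> \<mm>"
    and kill: "\<And>y. y \<in> module_ker (K 0) (K 1) (\<delta> 0) \<Longrightarrow> s \<odot>\<^bsub>K 0\<^esub> y = \<zero>\<^bsub>K 0\<^esub>"
  shows "module_ker (K 0) (K 1) (\<delta> 0) = {\<zero>\<^bsub>K 0\<^esub>}"
proof -
  have sm: "b \<in> \<mm> \<longleftrightarrow> b \<in> carrier R \<and> b \<otimes> s \<in> J" for b using s(2) by (auto simp: colon_def)
  have descend: "ann_cycles i I \<subseteq> ann_boundaries i I"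
    if van: "\<And>I. ideal I R \<Longrightarrow> J \<subseteq> I \<Longrightarrow> ann_cycles (Suc i) I \<subseteq> ann_boundaries (Suc i) I"
      and I: "ideal I R" "J \<subseteq> I" for i I
  proof (rule vanishing_from_residue_field[OF van _ I])
    show "ann_cycles i \<mm> \<subseteq> ann_boundaries i \<mm>"
    proof
      fix y assume y: "y \<in> ann_cycles i \<mm>"
      obtain w where w: "w \<in> annihilated (K i) J" "s \<odot>\<^bsub>K i\<^esub> w = y"
      proof (rule cyclic_lift[OF ideal_J subset_refl s(1) ann_cyclesD(1)[OF y]])
        fix b assume "b \<in> carrier R" "b \<otimes> s \<in> J"
        then show "b \<odot>\<^bsub>K i\<^esub> y = \<zero>\<^bsub>K i\<^esub>" using ann_cyclesD(2)[OF y] sm by blast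
      qed
      have "\<exists>z\<in>ann_cycles i J. s \<odot>\<^bsub>K i\<^esub> z = s \<odot>\<^bsub>K i\<^esub> w"
        by (rule connecting_lift[OF ideal_J s(1) w(1) _ van[OF adjoin(1,2)[OF ideal_J s(1)]]])
          (use w(2) ann_cyclesD(3)[OF y] in simp)
      then obtain z where z: "z \<in> ann_cycles i J" "s \<odot>\<^bsub>K i\<^esub> z = y" using w(2) by auto
      show "y \<in> ann_boundaries i \<mm>"
      \<comment> \<open>As \<open>J\<close> kills \<open>K\<close>, the element \<open>z\<close> is
        just a cycle of \<open>K\<close>. In degree 0 it lies in the kernel that \<open>s\<close>
        annihilates; in higher degrees it is \<open>\<delta> x\<close>, and \<open>s x\<close> is
        killed by \<open>\<mm>\<close>.\<close>
      proof (cases i)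
        case 0
        then have "z \<in> module_ker (K 0) (K 1) (\<delta> 0)"
          using ann_cyclesD(1,3)[OF z(1)] by (simp add: module_ker_def)
        then show ?thesis using kill z(2) 0 by simp
      next
        case (Suc i')
        then obtain x where x: "x \<in> carrier (K i')" "z = \<delta> i' x"
          using exactE[of z i'] ann_cyclesD(1,3)[OF z(1)] by metis
        have sx: "s \<odot>\<^bsub>K i'\<^esub> x \<in> carrier (K i')" using s(1) x(1) by simp
        have "c \<odot>\<^bsub>K i'\<^esub> (s \<odot>\<^bsub>K i'\<^esub> x) = \<zero>\<^bsub>K i'\<^esub>" if "c \<in> \<mm>" for c
          using that sm[of c] J_K[OF _ x(1), of "c \<otimes> s"] s(1) x(1) by (simp add: K.smult_assoc1)
        then have "s \<odot>\<^bsub>K i'\<^esub> x \<in> annihilated (K i') \<mm>" using sx by (simp add: annihilated_def)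
        moreover have "y = \<delta> i' (s \<odot>\<^bsub>K i'\<^esub> x)" using \<delta>_hom(3)[OF s(1) x(1)] x(2) z(2) Suc by simp
        ultimately show ?thesis using Suc by simp
      qed
    qed
  qed
  obtain n where n: "\<forall>i\<ge>n. carrier (K i) = {\<zero>\<^bsub>K i\<^esub>}" using finite_length by blast
  have all: "\<forall>I. ideal I R \<longrightarrow> J \<subseteq> I \<longrightarrow> ann_cycles i I \<subseteq> ann_boundaries i I" if "i \<le> n" for i
    using that
  proof (induction rule: inc_induct)
    case base
    have "y \<in> ann_boundaries n I" if "ideal I R" "y \<in> ann_cycles n I" for y I
    proof -
      have "y = \<zero>\<^bsub>K n\<^esub>" using ann_cyclesD(1)[OF that(2)] n by auto
      then show ?thesis using K.submoduleD(2)[OF ann_boundaries_submodule[OF that(1)]] by simp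
    qed
    then show ?case by blast
  next
    case (step i)
    show ?case
    proof (intro allI impI)
      fix I assume I: "ideal I R" "J \<subseteq> I"
      show "ann_cycles i I \<subseteq> ann_boundaries i I"
        by (rule descend[OF _ I]) (use step.IH in blast)
    qed
  qed
  have v0: "ann_cycles 0 J \<subseteq> {\<zero>\<^bsub>K 0\<^esub>}" using all[of 0] ideal_J by simp
  have "module_ker (K 0) (K 1) (\<delta> 0) \<subseteq> ann_cycles 0 J"
    using J_K[of _ _ 0] by (auto simp: module_ker_def intro!: ann_cyclesI)
  moreover have "\<zero>\<^bsub>K 0\<^esub> \<in> module_ker (K 0) (K 1) (\<delta> 0)" using \<delta>_zero[of 0] by (simp add: module_ker_def)
  ultimately show ?thesis using v0 by auto
qed

end

section \<open>Injective resolutions modulo a regular sequence\<close>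

locale injective_resolution_of = noetherian_local R for R (structure) +
  fixes L :: "('a, 'l, 'm) module_scheme" and I :: "nat \<Rightarrow> ('a, 'e) module"
    and \<delta> :: "nat \<Rightarrow> 'e \<Rightarrow> 'e" and \<eta> :: "'l \<Rightarrow> 'e"
  assumes res: "injective_resolution R L I \<delta> \<eta>" and module_L: "module R L"
begin

lemma inj_I: "injective_module R (I i)" and hom_\<eta>: "\<eta> \<in> hom_module R L (I 0)"
  and inj_\<eta>: "inj_on \<eta> (carrier L)" and hom_\<delta>: "\<delta> i \<in> hom_module R (I i) (I (Suc i))"
  and image_\<eta>: "\<eta> ` carrier L = module_ker (I 0) (I 1) (\<delta> 0)"
  and image_\<delta>: "\<delta> i ` carrier (I i) = module_ker (I (Suc i)) (I (Suc (Suc i))) (\<delta> (Suc i))"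
  using res by (auto simp: injective_resolution_def)

lemma module_I: "module R (I i)"
  using inj_I by (simp add: injective_module_def)

sublocale I: module R "I i" for i by (rule module_I)
sublocale L: module R L by (rule module_L)

lemmas \<delta>_hom = hom_moduleD[OF hom_\<delta>]
lemmas \<delta>_zero = hom_module_zero[OF hom_\<delta> module_I module_I]
lemmas \<delta>_minus = hom_module_minus[OF hom_\<delta> module_I module_I]

lemma \<delta>_\<delta>: "y \<in> carrier (I i) \<Longrightarrow> \<delta> (Suc i) (\<delta> i y) = \<zero>\<^bsub>I (Suc (Suc i))\<^esub>"
  using image_\<delta>[of i] by (auto simp: module_ker_def)

abbreviation "ann i J \<equiv> annihilated (I i) J"

lemmas annD = annihilatedD[of _ "I i" for i]

lemma ann_submodule: "ideal J R \<Longrightarrow> submodule (ann i J) R (I i)"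
  by (rule I.annihilated_submodule) (rule idealD(1))

lemmas annS = I.submoduleD[OF ann_submodule]

lemma ann_adjoinI:
  "w \<in> ann i J \<Longrightarrow> a \<in> carrier R \<Longrightarrow> a \<odot>\<^bsub>I i\<^esub> w = \<zero>\<^bsub>I i\<^esub> \<Longrightarrow> ideal J R \<Longrightarrow> w \<in> ann i (adjoin R J a)"
  by (rule I.annihilated_adjoinI[OF _ _ _ idealD(1)])

lemma \<delta>_ann: "w \<in> ann i J \<Longrightarrow> ideal J R \<Longrightarrow> \<delta> i w \<in> ann (Suc i) J"
  by (rule hom_annihilated[OF hom_\<delta> module_I module_I _ idealD(1)])

text \<open>Hom (R / J, I) is injective over R / J, hence divisible by the elements regular on R /
  J.\<close>

lemma divide:
  assumes J: "ideal J R" and a: "a \<in> carrier R" "regular_on (ring_as_module R) J a" and y: "y \<in> ann i J"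
  obtains w where "w \<in> ann i J" "a \<odot>\<^bsub>I i\<^esub> w = y"
proof -
  let ?E = "I i\<lparr>carrier := ann i J\<rparr>"
  have E: "module R ?E"
    using submodule.submodule_is_module[OF ann_submodule[OF J]] module_I by blast
  have 1: "b \<odot>\<^bsub>?E\<^esub> y = \<zero>\<^bsub>?E\<^esub>" if b: "b \<in> carrier R" "b \<otimes> a \<in> J" for b
  proof -
    have "b \<in> J" using a b m_comm[OF a(1) b(1)] by (simp add: regular_on_def)
    then show ?thesis using annD(2)[OF y] by simp
  qed
  have y': "y \<in> carrier ?E" using y by simp
  obtain w where w: "w \<in> annihilated ?E J" "a \<odot>\<^bsub>?E\<^esub> w = y"
    using relatively_injective_cyclic_lift[OF relatively_injective_annihilated[OF inj_I J] E J subset_refl a(1) y' 1]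
    by blast
  show thesis by (rule that[of w]) (use w in \<open>auto simp: annihilated_def\<close>)
qed

text \<open>This says that \<open>Ext\<^sup>i (R / J, L)\<close> vanishes for all \<open>i > j\<close>.\<close>

lemma exact_annihilated:
  assumes "regular_ideal R N j J" "j \<le> i" "y \<in> ann (Suc i) J" "\<delta> (Suc i) y = \<zero>\<^bsub>I (Suc (Suc i))\<^esub>"
  shows "\<exists>z\<in>ann i J. \<delta> i z = y"
  using assms
proof (induction arbitrary: i y rule: regular_ideal.induct)
  case zero
  have "y \<in> module_ker (I (Suc i)) (I (Suc (Suc i))) (\<delta> (Suc i))"
    using zero annD(1) by (simp add: module_ker_def)
  then obtain z where "z \<in> carrier (I i)" "y = \<delta> i z" using image_\<delta>[of i] by blast
  then show ?case by (auto simp: annihilated_def)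
next
  case (step j J a)
  note J = regular_ideal(1)[OF step.hyps(1)]
  have aR: "a \<in> carrier R" using max_idealD(8)[OF step.hyps(2)] .
  note ad = adjoin[OF J aR]
  obtain k where k: "i = Suc k" "j \<le> k" using step.prems(1) by (cases i) auto
  have yJ: "y \<in> ann (Suc i) J" by (rule subsetD[OF annihilated_mono[OF ad(2)] step.prems(2)])
  obtain z where z: "z \<in> ann i J" "\<delta> i z = y"
    using step.IH[OF _ yJ step.prems(3)] step.prems(1) by auto
  have zI: "z \<in> carrier (I i)" using annD(1)[OF z(1)] .
  \<comment> \<open>The preimage \<open>z\<close> need not be killed by \<open>a\<close>. But
    \<open>a z\<close> is a cycle, so it is the differential of some \<open>z'\<close> one degree
    lower; dividing \<open>z'\<close> by \<open>a\<close> yields \<open>w\<close>, and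
    \<open>z - \<delta> w\<close> is killed by \<open>a\<close> with unchanged differential.\<close>
  have az: "a \<odot>\<^bsub>I i\<^esub> z \<in> ann (Suc k) J" using annS(4)[OF J aR z(1)] k by simp
  have "\<delta> (Suc k) (a \<odot>\<^bsub>I i\<^esub> z) = \<zero>\<^bsub>I (Suc (Suc k))\<^esub>"
    using \<delta>_hom(3)[OF aR zI] z(2) annD(2)[OF step.prems(2) ad(3)] k(1) by simp
  then obtain z' where z': "z' \<in> ann k J" "\<delta> k z' = a \<odot>\<^bsub>I i\<^esub> z" using step.IH[OF k(2) az] by blast
  obtain w where w: "w \<in> ann k J" "a \<odot>\<^bsub>I k\<^esub> w = z'" by (rule divide[OF J aR step.hyps(4) z'(1)])
  have wI: "w \<in> carrier (I k)" using annD(1)[OF w(1)] .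
  have dw: "\<delta> k w \<in> ann i J" using \<delta>_ann[OF w(1) J] k by simp
  have dwI: "\<delta> k w \<in> carrier (I i)" using annD(1)[OF dw] .
  have adw: "a \<odot>\<^bsub>I i\<^esub> \<delta> k w = a \<odot>\<^bsub>I i\<^esub> z" using \<delta>_hom(3)[OF aR wI] w(2) z'(2) k(1) by simp
  have "a \<odot>\<^bsub>I i\<^esub> (z \<ominus>\<^bsub>I i\<^esub> \<delta> k w) = \<zero>\<^bsub>I i\<^esub>"
    using aR zI dwI adw by (simp add: I.smult_minus_distr I.minus_eq_zero_iff)
  then have "z \<ominus>\<^bsub>I i\<^esub> \<delta> k w \<in> ann i (adjoin R J a)"
    by (rule ann_adjoinI[OF annS(6)[OF J z(1) dw] aR _ J])
  moreover have "\<delta> i (z \<ominus>\<^bsub>I i\<^esub> \<delta> k w) = y"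
    using \<delta>_minus[OF zI dwI] \<delta>_\<delta>[OF wI] z(2) k(1) annD(1)[OF yJ] by (simp add: a_minus_def)
  ultimately show ?case by blast
qed

text \<open>Only the cohomology \<open>Ext\<^sup>j (R / J, L) = L / J L\<close> survives. The boundaries in degree \<open>j\<close> split
  off; \<open>p\<close> is the projection of the cochains in degree \<open>j\<close> onto a complement, in which \<open>\<pi>\<close>
  identifies \<open>L / J L\<close> with the cycles.\<close>

definition reduction :: "nat \<Rightarrow> 'a set \<Rightarrow> ('e \<Rightarrow> 'e) \<Rightarrow> ('l \<Rightarrow> 'e) \<Rightarrow> bool" where
  "reduction j J p \<pi> \<longleftrightarrow>
    p \<in> hom_module R (I j\<lparr>carrier := ann j J\<rparr>) (I j\<lparr>carrier := ann j J\<rparr>) \<and>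
    (\<forall>y\<in>ann j J. p (p y) = p y \<and> \<delta> j (p y) = \<delta> j y) \<and>
    \<pi> \<in> hom_module R L (I j) \<and>
    \<pi> ` carrier L = {y \<in> ann j J. \<delta> j y = \<zero>\<^bsub>I (Suc j)\<^esub> \<and> p y = y} \<and>
    (\<forall>l\<in>carrier L. \<pi> l = \<zero>\<^bsub>I j\<^esub> \<longleftrightarrow> l \<in> ideal_smult R J L)"

lemma reduction_zero: "reduction 0 {\<zero>} id \<eta>"
proof -
  have "\<eta> l = \<zero>\<^bsub>I 0\<^esub> \<longleftrightarrow> l = \<zero>\<^bsub>L\<^esub>" if "l \<in> carrier L" for l
    using hom_module_zero[OF hom_\<eta> module_L module_I] inj_onD[OF inj_\<eta>, of l "\<zero>\<^bsub>L\<^esub>"] that by auto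
  moreover have "\<eta> ` carrier L = {y \<in> ann 0 {\<zero>}. \<delta> 0 y = \<zero>\<^bsub>I (Suc 0)\<^esub>}"
    unfolding image_\<eta> by (auto simp: module_ker_def annihilated_def)
  ultimately show ?thesis
    using hom_\<eta> by (auto simp: reduction_def L.ideal_smult_zero hom_module_def)
qed

lemma reduction_submodule:
  assumes J: "ideal J R" and red: "reduction j J p \<pi>"
  shows "submodule {y \<in> ann j J. p y = y} R (I j)"
proof -
  note annJ = annS[OF J]
  have p_add: "p (x \<oplus>\<^bsub>I j\<^esub> y) = p x \<oplus>\<^bsub>I j\<^esub> p y" if "x \<in> ann j J" "y \<in> ann j J" for x y
    using red that by (auto simp: reduction_def hom_module_def)
  have p_smult: "p (b \<odot>\<^bsub>I j\<^esub> y) = b \<odot>\<^bsub>I j\<^esub> p y" if "b \<in> carrier R" "y \<in> ann j J" for b y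
    using red that by (auto simp: reduction_def hom_module_def)
  have "p \<zero>\<^bsub>I j\<^esub> \<in> ann j J" using red annJ(2)[of j] by (auto simp: reduction_def hom_module_def)
  then have p0: "p \<zero>\<^bsub>I j\<^esub> = \<zero>\<^bsub>I j\<^esub>" using p_smult[of \<zero> "\<zero>\<^bsub>I j\<^esub>"] annJ(2)[of j] annD(1) by simp
  show ?thesis
    unfolding I.submodule_iff
  proof (intro conjI ballI)
    show "{y \<in> ann j J. p y = y} \<subseteq> carrier (I j)" using annD(1) by blast
    show "\<zero>\<^bsub>I j\<^esub> \<in> {y \<in> ann j J. p y = y}" using annJ(2) p0 by simp
    show "x \<oplus>\<^bsub>I j\<^esub> y \<in> {y \<in> ann j J. p y = y}" if "x \<in> {y \<in> ann j J. p y = y}" "y \<in> {y \<in> ann j J. p y = y}" for x y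
      using that p_add annJ(3) by simp
    show "b \<odot>\<^bsub>I j\<^esub> x \<in> {y \<in> ann j J. p y = y}" if "b \<in> carrier R" "x \<in> {y \<in> ann j J. p y = y}" for b x
      using that p_smult annJ(4) by simp
  qed
qed

text \<open>The Rees shift on cochains. The cokernel of \<open>a\<close> on Ext^j (R / J, L) = L / J
  L becomes Ext^(j+1) for J + R a through the connecting homomorphism; regularity of
  \<open>a\<close> on L / J L makes the cohomology for J + R a vanish in degree \<open>j\<close>, so
  that the boundaries in degree \<open>j + 1\<close> split off.\<close>

lemma reduction_step:
  assumes ri: "regular_ideal R N j J" and a: "a \<in> \<mm>" "regular_on (ring_as_module R) J a"
      "regular_on L (ideal_smult R J L) a"
    and red: "reduction j J p \<pi>"
  shows "\<exists>p' \<pi>'. reduction (Suc j) (adjoin R J a) p' \<pi>'"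
proof -
  note J = regular_ideal(1)[OF ri]
  have aR: "a \<in> carrier R" using max_idealD(8)[OF a(1)] .
  note ad = adjoin[OF J aR]
  let ?J = "adjoin R J a"
  note annJ = annS[OF J] and annJ' = annS[OF ad(1)]
  have p_in: "p y \<in> ann j J" if "y \<in> ann j J" for y using red that by (auto simp: reduction_def hom_module_def)
  have p_add: "p (x \<oplus>\<^bsub>I j\<^esub> y) = p x \<oplus>\<^bsub>I j\<^esub> p y" if "x \<in> ann j J" "y \<in> ann j J" for x y
    using red that by (auto simp: reduction_def hom_module_def)
  have p_smult: "p (b \<odot>\<^bsub>I j\<^esub> y) = b \<odot>\<^bsub>I j\<^esub> p y" if "b \<in> carrier R" "y \<in> ann j J" for b y
    using red that by (auto simp: reduction_def hom_module_def)
  have p_p: "p (p y) = p y" and \<delta>_p: "\<delta> j (p y) = \<delta> j y" if "y \<in> ann j J" for y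
    using red that by (auto simp: reduction_def)
  have \<pi>: "\<pi> \<in> hom_module R L (I j)" using red by (simp add: reduction_def)
  note \<pi>_hom = hom_moduleD[OF \<pi>]
  have \<pi>_im: "\<pi> ` carrier L = {y \<in> ann j J. \<delta> j y = \<zero>\<^bsub>I (Suc j)\<^esub> \<and> p y = y}" using red by (simp add: reduction_def)
  have \<pi>_l: "\<pi> l \<in> ann j J" "\<delta> j (\<pi> l) = \<zero>\<^bsub>I (Suc j)\<^esub>" "p (\<pi> l) = \<pi> l" if "l \<in> carrier L" for l
    using \<pi>_im that by auto
  have \<pi>_surj: "\<exists>l\<in>carrier L. \<pi> l = y" if "y \<in> ann j J" "\<delta> j y = \<zero>\<^bsub>I (Suc j)\<^esub>" "p y = y" for y
  proof -
    have "y \<in> \<pi> ` carrier L" unfolding \<pi>_im using that by simp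
    then show ?thesis by blast
  qed
  have \<pi>_0: "\<pi> l = \<zero>\<^bsub>I j\<^esub> \<longleftrightarrow> l \<in> ideal_smult R J L" if "l \<in> carrier L" for l
    using red that by (simp add: reduction_def)
  define C where "C = {c \<in> ann j J. p c = c}"
  have CI: "c \<in> C" if "c \<in> ann j J" "p c = c" for c using that by (simp add: C_def)
  have CD: "c \<in> ann j J" "p c = c" "c \<in> carrier (I j)" if "c \<in> C" for c using that annD(1) by (auto simp: C_def)
  have pC: "p y \<in> C" if "y \<in> ann j J" for y using p_in p_p that by (simp add: C_def)
  have p0: "p \<zero>\<^bsub>I j\<^esub> = \<zero>\<^bsub>I j\<^esub>"
    using p_smult[of \<zero> "\<zero>\<^bsub>I j\<^esub>"] annJ(2)[of j] annD(1)[OF p_in[OF annJ(2)]] by simp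
  have sC: "submodule C R (I j)" unfolding C_def by (rule reduction_submodule[OF J red])
  note C = I.submoduleD[OF sC]
  \<comment> \<open>The cochains for J + R a that remain in degree \<open>j\<close> after the
    boundaries are split off. A cycle among them is a class in L / J L killed by \<open>a\<close>,
    hence zero, so \<open>\<delta>\<close> is injective on \<open>D\<close>.\<close>
  define D where "D = {c \<in> C. a \<odot>\<^bsub>I j\<^esub> c = \<zero>\<^bsub>I j\<^esub>}"
  have DI: "c \<in> D" if "c \<in> C" "a \<odot>\<^bsub>I j\<^esub> c = \<zero>\<^bsub>I j\<^esub>" for c using that by (simp add: D_def)
  have DD: "c \<in> C" "a \<odot>\<^bsub>I j\<^esub> c = \<zero>\<^bsub>I j\<^esub>" "c \<in> carrier (I j)" if "c \<in> D" for c using that CD(3) by (auto simp: D_def)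
  have D_ann: "c \<in> ann j ?J" if "c \<in> D" for c
    using ann_adjoinI[OF CD(1)[OF DD(1)[OF that]] aR DD(2)[OF that] J] .
  have "D = C \<inter> {c \<in> carrier (I j). a \<odot>\<^bsub>I j\<^esub> c \<in> {\<zero>\<^bsub>I j\<^esub>}}"
    using CD(3) by (auto simp: D_def)
  then have sD: "submodule D R (I j)"
    using I.submodule_Int[OF sC submodule_hom_preimage[OF I.smult_hom[OF aR] module_I module_I I.zero_submodule]]
    by simp
  note Ds = I.submoduleD[OF sD]
  have D_inj: "c = c'" if c: "c \<in> D" "c' \<in> D" and eq: "\<delta> j c = \<delta> j c'" for c c'
  proof -
    let ?u = "c \<ominus>\<^bsub>I j\<^esub> c'"
    have u: "?u \<in> D" using Ds(6)[OF c] .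
    have "\<delta> j ?u = \<zero>\<^bsub>I (Suc j)\<^esub>"
      using \<delta>_minus[OF DD(3)[OF c(1)] DD(3)[OF c(2)]] eq \<delta>_hom(1)[OF DD(3)[OF c(2)]] by (simp add: I.minus_eq_zero_iff)
    then obtain l where l: "l \<in> carrier L" "\<pi> l = ?u"
      using \<pi>_surj[OF CD(1)[OF DD(1)[OF u]] _ CD(2)[OF DD(1)[OF u]]] by blast
    have "\<pi> (a \<odot>\<^bsub>L\<^esub> l) = \<zero>\<^bsub>I j\<^esub>" using \<pi>_hom(3)[OF aR l(1)] DD(2)[OF u] l(2) by simp
    then have "a \<odot>\<^bsub>L\<^esub> l \<in> ideal_smult R J L" using \<pi>_0 l(1) aR by simp
    then have "l \<in> ideal_smult R J L" using a(3) l(1) by (simp add: regular_on_def)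
    then have "?u = \<zero>\<^bsub>I j\<^esub>" using \<pi>_0[OF l(1)] l(2) by simp
    then show ?thesis using I.minus_eq_zero_iff DD(3) c by blast
  qed
  \<comment> \<open>These are all boundaries from cochains killed by J + R a: \<open>p\<close> maps
    such cochains into \<open>D\<close> without changing their differential.\<close>
  define W where "W = \<delta> j ` D"
  define f where "f w = (THE c. c \<in> D \<and> \<delta> j c = w)" for w
  have f: "f (\<delta> j c) = c" if "c \<in> D" for c unfolding f_def using that D_inj by blast
  have sW: "submodule W R (I (Suc j))"
    unfolding W_def by (rule submodule_hom_image[OF hom_\<delta> module_I module_I sD])
  have "f \<in> hom_module R (I (Suc j)\<lparr>carrier := W\<rparr>) (I j)"
    unfolding hom_module_def
  proof (intro CollectI conjI ballI Pi_I)
    fix x assume "x \<in> carrier (I (Suc j)\<lparr>carrier := W\<rparr>)"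
    then obtain u where u: "u \<in> D" "x = \<delta> j u" by (auto simp: W_def)
    show "f x \<in> carrier (I j)" using f u DD(3) by simp
    show "f (b \<odot>\<^bsub>I (Suc j)\<lparr>carrier := W\<rparr>\<^esub> x) = b \<odot>\<^bsub>I j\<^esub> f x" if b: "b \<in> carrier R" for b
      using f[OF Ds(4)[OF b u(1)]] \<delta>_hom(3)[OF b DD(3)[OF u(1)]] f[OF u(1)] u(2) by simp
    fix y assume "y \<in> carrier (I (Suc j)\<lparr>carrier := W\<rparr>)"
    then obtain v where v: "v \<in> D" "y = \<delta> j v" by (auto simp: W_def)
    show "f (x \<oplus>\<^bsub>I (Suc j)\<lparr>carrier := W\<rparr>\<^esub> y) = f x \<oplus>\<^bsub>I j\<^esub> f y"
      using f[OF Ds(3)[OF u(1) v(1)]] \<delta>_hom(2)[OF DD(3)[OF u(1)] DD(3)[OF v(1)]] f[OF u(1)] f[OF v(1)] u(2) v(2)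
      by simp
  qed
  \<comment> \<open>Injectivity of \<open>I j\<close> extends the inverse of \<open>\<delta>\<close>
    on \<open>W\<close> to the whole module in degree \<open>j + 1\<close>; this is what splits
    \<open>W\<close> off.\<close>
  then obtain h where h: "h \<in> hom_module R (I (Suc j)) (I j)" "\<forall>x\<in>W. h x = f x"
    using injective_module_extend[OF inj_I module_I sW] by blast
  note h_hom = hom_moduleD[OF h(1)]
  have h_\<delta>: "h (\<delta> j c) = c" if "c \<in> D" for c using h(2) f[OF that] that by (auto simp: W_def)
  have h_ann: "h e \<in> ann j ?J" if e: "e \<in> ann (Suc j) ?J" for e
  proof -
    have "c \<odot>\<^bsub>I j\<^esub> h e = \<zero>\<^bsub>I j\<^esub>" if "c \<in> ?J" for c
      using h_hom(3)[OF idealD(8)[OF ad(1) that] annD(1)[OF e]] annD(2)[OF e that]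
        hom_module_zero[OF h(1) module_I module_I] by simp
    then show ?thesis using h_hom(1) annD(1)[OF e] by (simp add: annihilated_def)
  qed
  have ph_D: "p (h e) \<in> D" if e: "e \<in> ann (Suc j) ?J" for e
  proof -
    have he: "h e \<in> ann j J" by (rule subsetD[OF annihilated_mono[OF ad(2)] h_ann[OF e]])
    have "a \<odot>\<^bsub>I j\<^esub> p (h e) = p (a \<odot>\<^bsub>I j\<^esub> h e)" using p_smult[OF aR he] by simp
    also have "\<dots> = \<zero>\<^bsub>I j\<^esub>" using annD(2)[OF h_ann[OF e] ad(3)] p0 by simp
    finally show ?thesis by (rule DI[OF pC[OF he]])
  qed
  \<comment> \<open>The projection onto \<open>W\<close>; \<open>p'\<close> below is the
    complementary projection 1 - g.\<close>
  define g where "g e = \<delta> j (p (h e))" for e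
  have g_ann: "g e \<in> ann (Suc j) ?J" if "e \<in> ann (Suc j) ?J" for e
    using \<delta>_ann[OF D_ann[OF ph_D[OF that]] ad(1)] by (simp add: g_def)
  have h_J: "h e \<in> ann j J" if "e \<in> ann (Suc j) ?J" for e by (rule subsetD[OF annihilated_mono[OF ad(2)] h_ann[OF that]])
  have g_add: "g (x \<oplus>\<^bsub>I (Suc j)\<^esub> y) = g x \<oplus>\<^bsub>I (Suc j)\<^esub> g y" if "x \<in> ann (Suc j) ?J" "y \<in> ann (Suc j) ?J" for x y
    using h_hom(2)[OF annD(1)[OF that(1)] annD(1)[OF that(2)]] p_add[OF h_J h_J] that
      \<delta>_hom(2)[OF DD(3)[OF ph_D] DD(3)[OF ph_D]] by (simp add: g_def)
  have g_smult: "g (b \<odot>\<^bsub>I (Suc j)\<^esub> x) = b \<odot>\<^bsub>I (Suc j)\<^esub> g x" if "b \<in> carrier R" "x \<in> ann (Suc j) ?J" for b x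
    using h_hom(3)[OF that(1) annD(1)[OF that(2)]] p_smult[OF that(1) h_J[OF that(2)]]
      \<delta>_hom(3)[OF that(1) DD(3)[OF ph_D[OF that(2)]]] by (simp add: g_def)
  have g_W: "g (\<delta> j c) = \<delta> j c" if "c \<in> D" for c
    using h_\<delta>[OF that] CD(2)[OF DD(1)[OF that]] by (simp add: g_def)
  have g_g: "g (g e) = g e" if "e \<in> ann (Suc j) ?J" for e
    using g_W[OF ph_D[OF that]] by (simp add: g_def)
  have \<delta>_g: "\<delta> (Suc j) (g e) = \<zero>\<^bsub>I (Suc (Suc j))\<^esub>" if "e \<in> ann (Suc j) ?J" for e
    using \<delta>_\<delta>[OF DD(3)[OF ph_D[OF that]]] by (simp add: g_def)
  define p' where "p' e = e \<ominus>\<^bsub>I (Suc j)\<^esub> g e" for e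
  have p'_ann: "p' e \<in> ann (Suc j) ?J" if "e \<in> ann (Suc j) ?J" for e
    unfolding p'_def using annJ'(6)[OF that g_ann[OF that]] .
  have g_car: "g e \<in> carrier (I (Suc j))" if "e \<in> ann (Suc j) ?J" for e using annD(1)[OF g_ann[OF that]] .
  have g_p': "g (p' e) = \<zero>\<^bsub>I (Suc j)\<^esub>" if e: "e \<in> ann (Suc j) ?J" for e
  proof -
    have "g e = g (p' e \<oplus>\<^bsub>I (Suc j)\<^esub> g e)"
      unfolding p'_def using I.add_minus_cancel[OF annD(1)[OF e] g_car[OF e]] by simp
    also have "\<dots> = g (p' e) \<oplus>\<^bsub>I (Suc j)\<^esub> g e" using g_add[OF p'_ann[OF e] g_ann[OF e]] g_g[OF e] by simp
    finally have eq: "g (p' e) \<oplus>\<^bsub>I (Suc j)\<^esub> g e = g e" by simp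
    have "g (p' e) = (g (p' e) \<oplus>\<^bsub>I (Suc j)\<^esub> g e) \<ominus>\<^bsub>I (Suc j)\<^esub> g e"
      using g_car[OF e] g_car[OF p'_ann[OF e]] by (simp add: a_minus_def I.M.a_assoc I.M.r_neg)
    also have "\<dots> = \<zero>\<^bsub>I (Suc j)\<^esub>" unfolding eq using I.minus_eq_zero_iff[OF g_car[OF e] g_car[OF e]] by simp
    finally show ?thesis .
  qed
  have p'_p': "p' (p' e) = p' e" if "e \<in> ann (Suc j) ?J" for e
    using g_p'[OF that] annD(1)[OF p'_ann[OF that]] unfolding p'_def[of "p' e"] by (simp add: a_minus_def)
  have \<delta>_p': "\<delta> (Suc j) (p' e) = \<delta> (Suc j) e" if "e \<in> ann (Suc j) ?J" for e
    unfolding p'_def using \<delta>_minus[OF annD(1)[OF that] g_car[OF that]] \<delta>_g[OF that] \<delta>_hom(1)[OF annD(1)[OF that]]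
    by (simp add: a_minus_def)
  have p'_add: "p' (x \<oplus>\<^bsub>I (Suc j)\<^esub> y) = p' x \<oplus>\<^bsub>I (Suc j)\<^esub> p' y" if "x \<in> ann (Suc j) ?J" "y \<in> ann (Suc j) ?J" for x y
    unfolding p'_def using g_add[OF that] annD(1)[OF that(1)] annD(1)[OF that(2)] g_car[OF that(1)] g_car[OF that(2)]
    by (simp add: a_minus_def I.M.minus_add I.M.a_ac)
  have p'_smult: "p' (b \<odot>\<^bsub>I (Suc j)\<^esub> x) = b \<odot>\<^bsub>I (Suc j)\<^esub> p' x" if "b \<in> carrier R" "x \<in> ann (Suc j) ?J" for b x
    unfolding p'_def using g_smult[OF that] annD(1)[OF that(2)] g_car[OF that(2)] that(1) by (simp add: I.smult_minus_distr)
  have p'_0: "p' e = \<zero>\<^bsub>I (Suc j)\<^esub> \<longleftrightarrow> e \<in> W" if e: "e \<in> ann (Suc j) ?J" for e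
  proof
    assume "p' e = \<zero>\<^bsub>I (Suc j)\<^esub>"
    then have "e = g e" using I.minus_eq_zero_iff[OF annD(1)[OF e] g_car[OF e]] by (simp add: p'_def)
    then show "e \<in> W" using ph_D[OF e] unfolding g_def W_def by blast
  next
    assume "e \<in> W"
    then have "g e = e" using g_W by (auto simp: W_def)
    then show "p' e = \<zero>\<^bsub>I (Suc j)\<^esub>" using I.minus_eq_zero_iff[OF annD(1)[OF e] g_car[OF e]] by (simp add: p'_def)
  qed
  have ex_c: "\<exists>c. c \<in> C \<and> a \<odot>\<^bsub>I j\<^esub> c = \<pi> l" if l: "l \<in> carrier L" for l
  proof -
    obtain w where w: "w \<in> ann j J" "a \<odot>\<^bsub>I j\<^esub> w = \<pi> l" by (rule divide[OF J aR a(2) \<pi>_l(1)[OF l]])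
    have "a \<odot>\<^bsub>I j\<^esub> p w = \<pi> l" using p_smult[OF aR w(1)] w(2) \<pi>_l(3)[OF l] by simp
    then show ?thesis using pC[OF w(1)] by blast
  qed
  \<comment> \<open>Connecting homomorphism: divide \<open>\<pi> l\<close> by \<open>a\<close>
    inside \<open>C\<close> and apply \<open>\<delta>\<close>. Two quotients differ by an element of
    \<open>D\<close>, whose differential lies in \<open>W\<close>, the kernel of \<open>p'\<close>,
    so the choice does not affect \<open>\<pi>'\<close>.\<close>
  define c where "c l = (SOME c. c \<in> C \<and> a \<odot>\<^bsub>I j\<^esub> c = \<pi> l)" for l
  have c: "c l \<in> C" "a \<odot>\<^bsub>I j\<^esub> c l = \<pi> l" if "l \<in> carrier L" for l
    using someI_ex[OF ex_c[OF that]] by (auto simp: c_def)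
  have \<delta>_C_ann: "\<delta> j x \<in> ann (Suc j) ?J" if x: "x \<in> C" "\<delta> j (a \<odot>\<^bsub>I j\<^esub> x) = \<zero>\<^bsub>I (Suc j)\<^esub>" for x
    using \<delta>_ann[OF CD(1)[OF x(1)] J] \<delta>_hom(3)[OF aR CD(3)[OF x(1)]] x(2)
    by (intro ann_adjoinI[OF _ aR _ J]) auto
  have dc: "\<delta> j (c l) \<in> ann (Suc j) ?J" if "l \<in> carrier L" for l
    using \<delta>_C_ann[OF c(1)[OF that]] c(2)[OF that] \<pi>_l(2)[OF that] by simp
  have p'_unique: "p' (\<delta> j x) = p' (\<delta> j y)"
    if x: "x \<in> C" "y \<in> C" "a \<odot>\<^bsub>I j\<^esub> x = a \<odot>\<^bsub>I j\<^esub> y" and z: "\<delta> j (a \<odot>\<^bsub>I j\<^esub> y) = \<zero>\<^bsub>I (Suc j)\<^esub>" for x y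
  proof -
    have xI: "x \<in> carrier (I j)" "y \<in> carrier (I j)" using CD(3) x by auto
    have u: "x \<ominus>\<^bsub>I j\<^esub> y \<in> D"
    proof (rule DI)
      show "x \<ominus>\<^bsub>I j\<^esub> y \<in> C" using C(6)[OF x(1,2)] .
      show "a \<odot>\<^bsub>I j\<^esub> (x \<ominus>\<^bsub>I j\<^esub> y) = \<zero>\<^bsub>I j\<^esub>" using x(3) xI aR by (simp add: I.smult_minus_distr I.minus_eq_zero_iff)
    qed
    have dy: "\<delta> j y \<in> ann (Suc j) ?J" using \<delta>_C_ann[OF x(2) z] .
    have du: "\<delta> j (x \<ominus>\<^bsub>I j\<^esub> y) \<in> ann (Suc j) ?J" using \<delta>_ann[OF D_ann[OF u] ad(1)] .
    have "p' (\<delta> j (x \<ominus>\<^bsub>I j\<^esub> y)) = \<zero>\<^bsub>I (Suc j)\<^esub>" using p'_0[OF du] u by (simp add: W_def)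
    moreover have "\<delta> j x = \<delta> j (x \<ominus>\<^bsub>I j\<^esub> y) \<oplus>\<^bsub>I (Suc j)\<^esub> \<delta> j y"
      using \<delta>_hom(2)[OF DD(3)[OF u] xI(2)] I.add_minus_cancel[OF xI] by simp
    ultimately show ?thesis using p'_add[OF du dy] annD(1)[OF p'_ann[OF dy]] by simp
  qed
  define \<pi>' where "\<pi>' l = p' (\<delta> j (c l))" for l
  have \<pi>'_eq: "\<pi>' l = p' (\<delta> j x)" if "l \<in> carrier L" "x \<in> C" "a \<odot>\<^bsub>I j\<^esub> x = \<pi> l" for l x
    unfolding \<pi>'_def using c[OF that(1)] that \<pi>_l(2)[OF that(1)] by (intro p'_unique) auto
  have \<pi>'_ann: "\<pi>' l \<in> ann (Suc j) ?J" if "l \<in> carrier L" for l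
    unfolding \<pi>'_def using p'_ann[OF dc[OF that]] .
  have \<pi>'_hom: "\<pi>' \<in> hom_module R L (I (Suc j))"
    unfolding hom_module_def
  proof (intro CollectI conjI ballI Pi_I)
    fix l assume l: "l \<in> carrier L"
    note cl = c[OF l]
    have clI: "c l \<in> carrier (I j)" using CD(3)[OF cl(1)] .
    show "\<pi>' l \<in> carrier (I (Suc j))" using annD(1)[OF \<pi>'_ann[OF l]] .
    show "\<pi>' (b \<odot>\<^bsub>L\<^esub> l) = b \<odot>\<^bsub>I (Suc j)\<^esub> \<pi>' l" if b: "b \<in> carrier R" for b
    proof -
      have "\<pi>' (b \<odot>\<^bsub>L\<^esub> l) = p' (\<delta> j (b \<odot>\<^bsub>I j\<^esub> c l))"
      proof (rule \<pi>'_eq)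
        show "b \<odot>\<^bsub>L\<^esub> l \<in> carrier L" using b l by simp
        show "b \<odot>\<^bsub>I j\<^esub> c l \<in> C" using C(4)[OF b cl(1)] .
        show "a \<odot>\<^bsub>I j\<^esub> (b \<odot>\<^bsub>I j\<^esub> c l) = \<pi> (b \<odot>\<^bsub>L\<^esub> l)"
          using I.smult_commute[OF aR b clI] cl(2) \<pi>_hom(3)[OF b l] by simp
      qed
      then show ?thesis using \<delta>_hom(3)[OF b clI] p'_smult[OF b dc[OF l]] by (simp add: \<pi>'_def)
    qed
    fix m assume m: "m \<in> carrier L"
    note cm = c[OF m]
    have cmI: "c m \<in> carrier (I j)" using CD(3)[OF cm(1)] .
    have "\<pi>' (l \<oplus>\<^bsub>L\<^esub> m) = p' (\<delta> j (c l \<oplus>\<^bsub>I j\<^esub> c m))"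
    proof (rule \<pi>'_eq)
      show "l \<oplus>\<^bsub>L\<^esub> m \<in> carrier L" using l m by simp
      show "c l \<oplus>\<^bsub>I j\<^esub> c m \<in> C" using C(3)[OF cl(1) cm(1)] .
      show "a \<odot>\<^bsub>I j\<^esub> (c l \<oplus>\<^bsub>I j\<^esub> c m) = \<pi> (l \<oplus>\<^bsub>L\<^esub> m)"
        using aR clI cmI cl(2) cm(2) \<pi>_hom(2)[OF l m] by (simp add: I.smult_r_distr)
    qed
    then show "\<pi>' (l \<oplus>\<^bsub>L\<^esub> m) = \<pi>' l \<oplus>\<^bsub>I (Suc j)\<^esub> \<pi>' m"
      using \<delta>_hom(2)[OF clI cmI] p'_add[OF dc[OF l] dc[OF m]] by (simp add: \<pi>'_def)
  qed
  have \<pi>'_im: "\<pi>' ` carrier L = {y \<in> ann (Suc j) ?J. \<delta> (Suc j) y = \<zero>\<^bsub>I (Suc (Suc j))\<^esub> \<and> p' y = y}"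
  proof (intro subset_antisym subsetI)
    fix y assume "y \<in> \<pi>' ` carrier L"
    then obtain l where l: "l \<in> carrier L" "y = \<pi>' l" by blast
    have "\<delta> (Suc j) (\<pi>' l) = \<zero>\<^bsub>I (Suc (Suc j))\<^esub>"
      unfolding \<pi>'_def using \<delta>_p'[OF dc[OF l(1)]] \<delta>_\<delta>[OF CD(3)[OF c(1)[OF l(1)]]] by simp
    moreover have "p' (\<pi>' l) = \<pi>' l" unfolding \<pi>'_def using p'_p'[OF dc[OF l(1)]] .
    ultimately show "y \<in> {y \<in> ann (Suc j) ?J. \<delta> (Suc j) y = \<zero>\<^bsub>I (Suc (Suc j))\<^esub> \<and> p' y = y}"
      using \<pi>'_ann[OF l(1)] l(2) by simp
  next
    fix e assume "e \<in> {y \<in> ann (Suc j) ?J. \<delta> (Suc j) y = \<zero>\<^bsub>I (Suc (Suc j))\<^esub> \<and> p' y = y}"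
    then have e: "e \<in> ann (Suc j) ?J" "\<delta> (Suc j) e = \<zero>\<^bsub>I (Suc (Suc j))\<^esub>" "p' e = e" by auto
    have "e \<in> ann (Suc j) J" by (rule subsetD[OF annihilated_mono[OF ad(2)] e(1)])
    \<comment> \<open>Surjectivity of the connecting homomorphism: Ext^(j+1) (R / J, L) vanishes, so
      the cycle \<open>e\<close> is a differential of a cochain for \<open>J\<close>.\<close>
    then obtain z where z: "z \<in> ann j J" "\<delta> j z = e" using exact_annihilated[OF ri le_refl _ e(2)] by blast
    let ?x = "p z"
    have x: "?x \<in> C" "\<delta> j ?x = e" using pC[OF z(1)] \<delta>_p[OF z(1)] z(2) by auto
    have ax: "a \<odot>\<^bsub>I j\<^esub> ?x \<in> C" using C(4)[OF aR x(1)] .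
    have "\<delta> j (a \<odot>\<^bsub>I j\<^esub> ?x) = \<zero>\<^bsub>I (Suc j)\<^esub>"
      using \<delta>_hom(3)[OF aR CD(3)[OF x(1)]] x(2) annD(2)[OF e(1) ad(3)] by simp
    then obtain l where l: "l \<in> carrier L" "\<pi> l = a \<odot>\<^bsub>I j\<^esub> ?x"
      using \<pi>_surj[OF CD(1)[OF ax] _ CD(2)[OF ax]] by blast
    have "\<pi>' l = p' (\<delta> j ?x)" using \<pi>'_eq[OF l(1) x(1)] l(2) by simp
    then show "e \<in> \<pi>' ` carrier L" using x(2) e(3) l(1) by force
  qed
  have \<pi>'_0: "\<pi>' l = \<zero>\<^bsub>I (Suc j)\<^esub> \<longleftrightarrow> l \<in> ideal_smult R ?J L" if l: "l \<in> carrier L" for l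
  proof
    note cl = c[OF l]
    have clI: "c l \<in> carrier (I j)" using CD(3)[OF cl(1)] .
    assume "\<pi>' l = \<zero>\<^bsub>I (Suc j)\<^esub>"
    then have "\<delta> j (c l) \<in> W" using p'_0[OF dc[OF l]] by (simp add: \<pi>'_def)
    then obtain x where x: "x \<in> D" "\<delta> j (c l) = \<delta> j x" by (auto simp: W_def)
    have u: "c l \<ominus>\<^bsub>I j\<^esub> x \<in> C" using C(6)[OF cl(1) DD(1)[OF x(1)]] .
    have "\<delta> j (c l \<ominus>\<^bsub>I j\<^esub> x) = \<zero>\<^bsub>I (Suc j)\<^esub>"
      using \<delta>_minus[OF clI DD(3)[OF x(1)]] x(2) \<delta>_hom(1)[OF DD(3)[OF x(1)]] by (simp add: I.minus_eq_zero_iff)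
    then obtain m where m: "m \<in> carrier L" "\<pi> m = c l \<ominus>\<^bsub>I j\<^esub> x"
      using \<pi>_surj[OF CD(1)[OF u] _ CD(2)[OF u]] by blast
    have "\<pi> (a \<odot>\<^bsub>L\<^esub> m) = \<pi> l"
      using \<pi>_hom(3)[OF aR m(1)] m(2) clI DD(2,3)[OF x(1)] aR cl(2) \<pi>_hom(1)[OF l]
      by (simp add: I.smult_minus_distr) (simp add: a_minus_def)
    then have "\<pi> (l \<ominus>\<^bsub>L\<^esub> a \<odot>\<^bsub>L\<^esub> m) = \<zero>\<^bsub>I j\<^esub>"
      using hom_module_minus[OF \<pi> module_L module_I l, of "a \<odot>\<^bsub>L\<^esub> m"] aR m(1) \<pi>_hom(1)[OF l]
      by (simp add: I.minus_eq_zero_iff)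
    then have "l \<ominus>\<^bsub>L\<^esub> a \<odot>\<^bsub>L\<^esub> m \<in> ideal_smult R J L" using \<pi>_0 l m(1) aR by simp
    then have "(l \<ominus>\<^bsub>L\<^esub> a \<odot>\<^bsub>L\<^esub> m) \<oplus>\<^bsub>L\<^esub> a \<odot>\<^bsub>L\<^esub> m \<in> ideal_smult R ?J L"
      using m(1) by (rule L.smult_in_ideal_smult_adjoin[OF J aR])
    then show "l \<in> ideal_smult R ?J L" using L.add_minus_cancel[OF l, of "a \<odot>\<^bsub>L\<^esub> m"] aR m(1) by simp
  next
    assume "l \<in> ideal_smult R ?J L"
    then obtain u m where um: "u \<in> ideal_smult R J L" "m \<in> carrier L" "l = u \<oplus>\<^bsub>L\<^esub> a \<odot>\<^bsub>L\<^esub> m"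
      by (rule L.ideal_smult_adjoinE[OF J aR])
    have uL: "u \<in> carrier L" using L.submoduleD(7)[OF L.ideal_smult_submodule[OF idealD(1)[OF J]] um(1)] .
    have "\<pi> l = \<pi> (a \<odot>\<^bsub>L\<^esub> m)"
      using \<pi>_hom(2)[OF uL, of "a \<odot>\<^bsub>L\<^esub> m"] um aR \<pi>_0[OF uL] \<pi>_hom(1)[of "a \<odot>\<^bsub>L\<^esub> m"] by simp
    also have "\<dots> = a \<odot>\<^bsub>I j\<^esub> \<pi> m" using \<pi>_hom(3)[OF aR um(2)] .
    finally have "\<pi>' l = p' (\<delta> j (\<pi> m))"
      using \<pi>_l[OF um(2)] by (intro \<pi>'_eq[OF l CI]) auto
    also have "\<dots> = \<zero>\<^bsub>I (Suc j)\<^esub>"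
      using \<pi>_l(2)[OF um(2)] p'_0[OF annJ'(2)] I.submoduleD(2)[OF sW] by simp
    finally show "\<pi>' l = \<zero>\<^bsub>I (Suc j)\<^esub>" .
  qed
  have "p' \<in> hom_module R (I (Suc j)\<lparr>carrier := ann (Suc j) ?J\<rparr>) (I (Suc j)\<lparr>carrier := ann (Suc j) ?J\<rparr>)"
    unfolding hom_module_def using p'_ann p'_add p'_smult by auto
  then have "reduction (Suc j) ?J p' \<pi>'"
    unfolding reduction_def using p'_p' \<delta>_p' \<pi>'_hom \<pi>'_im \<pi>'_0 by blast
  then show ?thesis by blast
qed

lemma exists_reduction:
  assumes "regular_ideal R L j J" shows "\<exists>p \<pi>. reduction j J p \<pi>"
  using assms
proof (induction rule: regular_ideal.induct)
  case zero
  then show ?case using reduction_zero by blast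
next
  case (step j J a)
  then obtain p \<pi> where "reduction j J p \<pi>" by blast
  then show ?case by (rule reduction_step[OF step.hyps(1,2,4,5)])
qed

text \<open>The cochains killed by \<open>J\<close>, cut off below degree \<open>j\<close>, form a
  finite injective resolution of L / J L over R / J, to which
  \<open>kernel_faithful_on_socle\<close> applies.\<close>

theorem socle_element_faithful:
  assumes fg: "finitely_generated_module R L" and fin: "\<forall>i>n. carrier (I i) = {\<zero>\<^bsub>I i\<^esub>}"
    and ri: "regular_ideal R L j J" and s: "s \<in> carrier R" "colon R (ring_as_module R) J s = \<mm>"
    and kill: "\<And>l. l \<in> carrier L \<Longrightarrow> s \<odot>\<^bsub>L\<^esub> l \<in> ideal_smult R J L"
  shows "ideal_smult R J L = carrier L"
proof -
  note J = regular_ideal[OF ri]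
  obtain p \<pi> where red: "reduction j J p \<pi>" using exists_reduction[OF ri] by blast
  define C where "C = {y \<in> ann j J. p y = y}"
  \<comment> \<open>Degree 0 is the complement \<open>C\<close> of the boundaries in degree
    \<open>j\<close>. It is still relatively injective, being a retract, and the kernel of
    \<open>\<delta>\<close> on it is \<pi>(L), a copy of L / J L.\<close>
  define K where "K i = I (j + i)\<lparr>carrier := if i = 0 then C else ann (j + i) J\<rparr>" for i
  have K_simps: "carrier (K i) = (if i = 0 then C else ann (j + i) J)" "\<zero>\<^bsub>K i\<^esub> = \<zero>\<^bsub>I (j + i)\<^esub>"
    "x \<oplus>\<^bsub>K i\<^esub> y = x \<oplus>\<^bsub>I (j + i)\<^esub> y" "a \<odot>\<^bsub>K i\<^esub> x = a \<odot>\<^bsub>I (j + i)\<^esub> x" for i x y a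
    by (simp_all add: K_def)
  have C_ann: "C \<subseteq> ann j J" by (auto simp: C_def)
  have K_ann: "y \<in> ann (j + i) J" if "y \<in> carrier (K i)" for y i
    using that C_ann by (cases i) (auto simp: K_simps)
  have K_I: "y \<in> carrier (I (j + i))" if "y \<in> carrier (K i)" for y i using annD(1)[OF K_ann[OF that]] .
  have sC: "submodule C R (I j)" unfolding C_def by (rule reduction_submodule[OF J(1) red])
  have module_K: "module R (K i)" for i
    unfolding K_def using submodule.submodule_is_module[OF sC module_I]
      submodule.submodule_is_module[OF ann_submodule[OF J(1)] module_I] by (cases i) auto
  have p_hom: "p \<in> hom_module R (I j\<lparr>carrier := ann j J\<rparr>) (I j\<lparr>carrier := ann j J\<rparr>)"
    and p_p: "\<And>y. y \<in> ann j J \<Longrightarrow> p (p y) = p y" and \<delta>_p: "\<And>y. y \<in> ann j J \<Longrightarrow> \<delta> j (p y) = \<delta> j y"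
    and \<pi>: "\<pi> \<in> hom_module R L (I j)"
    and \<pi>_im: "\<pi> ` carrier L = {y \<in> ann j J. \<delta> j y = \<zero>\<^bsub>I (Suc j)\<^esub> \<and> p y = y}"
    and \<pi>_0: "\<And>l. l \<in> carrier L \<Longrightarrow> \<pi> l = \<zero>\<^bsub>I j\<^esub> \<longleftrightarrow> l \<in> ideal_smult R J L"
    using red by (auto simp: reduction_def)
  have inj_K: "relatively_injective R J (K i)" for i
  proof (cases i)
    case 0
    let ?E = "I j\<lparr>carrier := ann j J\<rparr>"
    have "relatively_injective R J (?E\<lparr>carrier := {y \<in> carrier ?E. p y = y}\<rparr>)"
      using submodule.submodule_is_module[OF ann_submodule[OF J(1)] module_I] p_p
      by (intro relatively_injective_retract[OF relatively_injective_annihilated[OF inj_I J(1)] _ p_hom]) auto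
    then show ?thesis by (simp add: K_def C_def 0)
  next
    case (Suc i')
    then show ?thesis using relatively_injective_annihilated[OF inj_I J(1), of "j + i"] by (simp add: K_def)
  qed
  have \<delta>_K: "\<delta> (j + i) \<in> hom_module R (K i) (K (Suc i))" for i
    unfolding hom_module_def
    using \<delta>_ann[OF K_ann J(1)] \<delta>_hom(2)[OF K_I K_I] \<delta>_hom(3)[OF _ K_I] by (auto simp: K_simps)
  have ker0: "module_ker (K 0) (K 1) (\<delta> (j + 0)) = \<pi> ` carrier L"
    unfolding \<pi>_im by (auto simp: module_ker_def K_simps C_def)
  have exact: "\<delta> (j + i) ` carrier (K i) = module_ker (K (Suc i)) (K (Suc (Suc i))) (\<delta> (j + Suc i))" for i
  proof (intro subset_antisym subsetI)
    fix y assume "y \<in> \<delta> (j + i) ` carrier (K i)"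
    then obtain w where w: "w \<in> carrier (K i)" "y = \<delta> (j + i) w" by blast
    then show "y \<in> module_ker (K (Suc i)) (K (Suc (Suc i))) (\<delta> (j + Suc i))"
      using hom_moduleD(1)[OF \<delta>_K w(1)] \<delta>_\<delta>[OF K_I[OF w(1)]] by (simp add: module_ker_def K_simps)
  next
    fix y assume "y \<in> module_ker (K (Suc i)) (K (Suc (Suc i))) (\<delta> (j + Suc i))"
    then have y: "y \<in> ann (Suc (j + i)) J" "\<delta> (Suc (j + i)) y = \<zero>\<^bsub>I (Suc (Suc (j + i)))\<^esub>"
      by (auto simp: module_ker_def K_simps)
    obtain z where z: "z \<in> ann (j + i) J" "\<delta> (j + i) z = y"
      using exact_annihilated[OF ri _ y] by auto
    show "y \<in> \<delta> (j + i) ` carrier (K i)"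
    proof (cases i)
      case 0
      have "p z \<in> C" using p_hom z(1) p_p 0 by (auto simp: C_def hom_module_def)
      moreover have "\<delta> j (p z) = y" using \<delta>_p z 0 by simp
      ultimately show ?thesis using 0 by (auto simp: K_simps)
    qed (use z in \<open>auto simp: K_simps\<close>)
  qed
  obtain S where S: "finite S" "S \<subseteq> carrier L" "gen_submodule R L S = carrier L"
    using fg by (auto simp: finitely_generated_module_def)
  interpret K: module R "K i" for i by (rule module_K)
  note \<pi>_hom = hom_moduleD[OF \<pi>]
  have \<pi>_K: "\<pi> l \<in> carrier (K 0)" if "l \<in> carrier L" for l
  proof -
    have "\<pi> l \<in> \<pi> ` carrier L" using that by blast
    then show ?thesis unfolding \<pi>_im by (simp add: K_simps C_def)
  qed
  have \<pi>_hom0: "\<pi> \<in> hom_module R L (K 0)"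
    using \<pi>_K \<pi>_hom(2,3) by (auto simp: hom_module_def K_simps)
  have "\<pi> ` S \<subseteq> carrier (K 0)" using S(2) \<pi>_K by blast
  then have "submodule {l \<in> carrier L. \<pi> l \<in> gen_submodule R (K 0) (\<pi> ` S)} R L"
    by (rule submodule_hom_preimage[OF \<pi>_hom0 module_L module_K K.gen_submodule_submodule])
  moreover have "S \<subseteq> {l \<in> carrier L. \<pi> l \<in> gen_submodule R (K 0) (\<pi> ` S)}"
    using S(2) K.gen_submodule_incl[of "\<pi> ` S" 0] by blast
  ultimately have "carrier L \<subseteq> {l \<in> carrier L. \<pi> l \<in> gen_submodule R (K 0) (\<pi> ` S)}"
    unfolding S(3)[symmetric] by (rule L.gen_submodule_min)
  then have 1: "\<pi> ` carrier L \<subseteq> gen_submodule R (K 0) (\<pi> ` S)" by blast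
  have "submodule (\<pi> ` carrier L) R (K 0)"
    by (rule submodule_hom_image[OF \<pi>_hom0 module_L module_K L.carrier_is_submodule])
  then have "gen_submodule R (K 0) (\<pi> ` S) \<subseteq> \<pi> ` carrier L" using S(2) by (intro K.gen_submodule_min) auto
  then have gen: "gen_submodule R (K 0) (\<pi> ` S) = module_ker (K 0) (K 1) (\<delta> (j + 0))" using 1 ker0 by simp
  interpret rr: relatively_injective_resolution R J K "\<lambda>i. \<delta> (j + i)"
  proof (rule relatively_injective_resolution.intro[OF noetherian_local_axioms],
      rule relatively_injective_resolution_axioms.intro)
    show "ideal J R" by (rule J(1))
    show "c \<odot>\<^bsub>K i\<^esub> y = \<zero>\<^bsub>K i\<^esub>" if "c \<in> J" "y \<in> carrier (K i)" for i c y
      using annD(2)[OF K_ann[OF that(2)] that(1)] by (simp add: K_simps)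
    \<comment> \<open>The bound is strict in \<open>fin\<close> and inclusive in the locale, hence
      \<open>Suc n\<close>.\<close>
    show "\<exists>n. \<forall>i\<ge>n. carrier (K i) = {\<zero>\<^bsub>K i\<^esub>}"
    proof (intro exI[of _ "Suc n"] allI impI)
      fix i assume "i \<ge> Suc n"
      then have "carrier (I (j + i)) = {\<zero>\<^bsub>I (j + i)\<^esub>}" using fin by simp
      then have "y = \<zero>\<^bsub>K i\<^esub>" if "y \<in> carrier (K i)" for y using K_I[OF that] by (simp add: K_simps(2))
      then show "carrier (K i) = {\<zero>\<^bsub>K i\<^esub>}" using K.M.zero_closed[of i] by blast
    qed
    show "\<exists>S. finite S \<and> S \<subseteq> carrier (K 0) \<and> gen_submodule R (K 0) S = module_ker (K 0) (K 1) (\<delta> (j + 0))"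
      using S(1) \<open>\<pi> ` S \<subseteq> carrier (K 0)\<close> gen by (intro exI[of _ "\<pi> ` S"]) auto
  qed (use module_K inj_K \<delta>_K exact in auto)
  have "module_ker (K 0) (K 1) (\<delta> (j + 0)) = {\<zero>\<^bsub>K 0\<^esub>}"
  proof (rule rr.kernel_faithful_on_socle[OF s J(2)])
    fix y assume "y \<in> module_ker (K 0) (K 1) (\<delta> (j + 0))"
    then obtain l where l: "l \<in> carrier L" "y = \<pi> l" unfolding ker0 by blast
    have "\<pi> (s \<odot>\<^bsub>L\<^esub> l) = \<zero>\<^bsub>I j\<^esub>" using \<pi>_0 kill[OF l(1)] l(1) s(1) by simp
    then show "s \<odot>\<^bsub>K 0\<^esub> y = \<zero>\<^bsub>K 0\<^esub>" using \<pi>_hom(3)[OF s(1) l(1)] l(2) by (simp add: K_simps)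
  qed
  then have "\<pi> l = \<zero>\<^bsub>I j\<^esub>" if "l \<in> carrier L" for l using that unfolding ker0 by (auto simp: K_simps)
  then have "carrier L \<subseteq> ideal_smult R J L" using \<pi>_0 by blast
  then show ?thesis
    using L.submoduleD(1)[OF L.ideal_smult_submodule[OF idealD(1)[OF J(1)]]] by blast
qed

end

section \<open>Syzygies of the residue field modulo a regular sequence\<close>

lemma (in module) finsum_in_submodule:
  assumes H: "submodule H R M" and "finite B" "\<And>b. b \<in> B \<Longrightarrow> f b \<in> H"
  shows "finsum M f B \<in> H"
  using assms(2,3)
proof (induction B)
  case empty
  then show ?case using submoduleD(2)[OF H] by simp
next
  case (insert b B)
  have "f \<in> B \<rightarrow> carrier M" "f b \<in> carrier M" using insert.prems submoduleD(7)[OF H] by auto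
  then have "finsum M f (insert b B) = f b \<oplus>\<^bsub>M\<^esub> finsum M f B" using insert.hyps by simp
  moreover have "finsum M f B \<in> H" by (rule insert.IH) (simp add: insert.prems)
  ultimately show ?case using submoduleD(3)[OF H insert.prems[of b]] by simp
qed

text \<open>The facts about a basis that are needed later, packaged as coordinate functions so that
  finite sums do not appear again. Membership in J F can be read off from the coordinates.\<close>

lemma finite_free_coordinates:
  fixes F :: "('a, 'f, 'm) module_scheme"
  assumes "finite_free_module R F"
  shows "\<exists>(B :: 'f set) \<kappa>. (\<forall>x\<in>carrier F. \<forall>b\<in>B. \<kappa> x b \<in> carrier R) \<and>
    (\<forall>a\<in>carrier R. \<forall>x\<in>carrier F. \<forall>b\<in>B. \<kappa> (a \<odot>\<^bsub>F\<^esub> x) b = a \<otimes>\<^bsub>R\<^esub> \<kappa> x b) \<and>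
    (\<forall>J. ideal J R \<longrightarrow> (\<forall>x\<in>carrier F. x \<in> ideal_smult R J F \<longleftrightarrow> (\<forall>b\<in>B. \<kappa> x b \<in> J)))"
proof -
  interpret F: module R F using assms by (simp add: finite_free_module_def)
  have "\<exists>B. finite B \<and> B \<subseteq> carrier F \<and>
      (\<forall>x\<in>carrier F. \<exists>!c. c \<in> B \<rightarrow>\<^sub>E carrier R \<and> x = (\<Oplus>\<^bsub>F\<^esub>b\<in>B. c b \<odot>\<^bsub>F\<^esub> b))"
    using assms unfolding finite_free_module_def by (rule conjunct2)
  then obtain B where B_free: "finite B \<and> B \<subseteq> carrier F \<and>
      (\<forall>x\<in>carrier F. \<exists>!c. c \<in> B \<rightarrow>\<^sub>E carrier R \<and> x = (\<Oplus>\<^bsub>F\<^esub>b\<in>B. c b \<odot>\<^bsub>F\<^esub> b))"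
    by (rule exE)
  then have B: "finite B" "B \<subseteq> carrier F" by simp_all
  have ex: "\<exists>!c. c \<in> B \<rightarrow>\<^sub>E carrier R \<and> x = (\<Oplus>\<^bsub>F\<^esub>b\<in>B. c b \<odot>\<^bsub>F\<^esub> b)" if "x \<in> carrier F" for x
    using B_free[THEN conjunct2, THEN conjunct2, rule_format, OF that] .
  define \<kappa> where "\<kappa> x = (THE c. c \<in> B \<rightarrow>\<^sub>E carrier R \<and> x = (\<Oplus>\<^bsub>F\<^esub>b\<in>B. c b \<odot>\<^bsub>F\<^esub> b))" for x
  have \<kappa>': "\<kappa> x \<in> B \<rightarrow>\<^sub>E carrier R \<and> x = (\<Oplus>\<^bsub>F\<^esub>b\<in>B. \<kappa> x b \<odot>\<^bsub>F\<^esub> b)" if "x \<in> carrier F" for x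
    unfolding \<kappa>_def by (rule theI'[OF ex[OF that]])
  have \<kappa>: "\<kappa> x \<in> B \<rightarrow>\<^sub>E carrier R" "(\<Oplus>\<^bsub>F\<^esub>b\<in>B. \<kappa> x b \<odot>\<^bsub>F\<^esub> b) = x" if "x \<in> carrier F" for x
    by (rule conjunct1[OF \<kappa>'[OF that]], rule conjunct2[OF \<kappa>'[OF that], symmetric])
  have uniq: "\<kappa> x b = c b" if x: "x = (\<Oplus>\<^bsub>F\<^esub>b\<in>B. c b \<odot>\<^bsub>F\<^esub> b)" and c: "\<And>b. b \<in> B \<Longrightarrow> c b \<in> carrier R" and b: "b \<in> B" for x c b
  proof -
    have fin: "(\<lambda>b. c b \<odot>\<^bsub>F\<^esub> b) \<in> B \<rightarrow> carrier F" using c B by auto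
    have xF: "x \<in> carrier F" unfolding x using fin by (rule F.M.finsum_closed)
    have "x = (\<Oplus>\<^bsub>F\<^esub>b\<in>B. restrict c B b \<odot>\<^bsub>F\<^esub> b)" unfolding x
      by (rule F.M.finsum_cong') (use c B in auto)
    moreover have "restrict c B \<in> B \<rightarrow>\<^sub>E carrier R" using c by auto
    ultimately have "\<kappa> x = restrict c B" unfolding \<kappa>_def by (intro the1_equality[OF ex[OF xF]] conjI)
    then show ?thesis using b by simp
  qed
  have \<kappa>R: "\<kappa> x b \<in> carrier R" if "x \<in> carrier F" "b \<in> B" for x b using \<kappa>(1)[OF that(1)] that(2) by auto
  have bF: "b \<in> carrier F" if "b \<in> B" for b using B that by auto
  have summands: "(\<lambda>b. \<kappa> x b \<odot>\<^bsub>F\<^esub> b) \<in> B \<rightarrow> carrier F" if "x \<in> carrier F" for x using \<kappa>R[OF that] bF by auto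
  have add: "\<kappa> (x \<oplus>\<^bsub>F\<^esub> y) b = \<kappa> x b \<oplus>\<^bsub>R\<^esub> \<kappa> y b" if x: "x \<in> carrier F" and y: "y \<in> carrier F" and b: "b \<in> B" for x y b
  proof (rule uniq[OF _ _ b])
    have "(\<Oplus>\<^bsub>F\<^esub>b\<in>B. (\<kappa> x b \<oplus>\<^bsub>R\<^esub> \<kappa> y b) \<odot>\<^bsub>F\<^esub> b) = (\<Oplus>\<^bsub>F\<^esub>b\<in>B. \<kappa> x b \<odot>\<^bsub>F\<^esub> b \<oplus>\<^bsub>F\<^esub> \<kappa> y b \<odot>\<^bsub>F\<^esub> b)"
      by (rule F.M.finsum_cong') (use \<kappa>R x y bF in \<open>auto simp: F.smult_l_distr\<close>)
    also have "\<dots> = (\<Oplus>\<^bsub>F\<^esub>b\<in>B. \<kappa> x b \<odot>\<^bsub>F\<^esub> b) \<oplus>\<^bsub>F\<^esub> (\<Oplus>\<^bsub>F\<^esub>b\<in>B. \<kappa> y b \<odot>\<^bsub>F\<^esub> b)"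
      using summands[OF x] summands[OF y] by (rule F.M.finsum_addf)
    also have "\<dots> = x \<oplus>\<^bsub>F\<^esub> y" unfolding \<kappa>(2)[OF x] \<kappa>(2)[OF y] ..
    finally show "x \<oplus>\<^bsub>F\<^esub> y = (\<Oplus>\<^bsub>F\<^esub>b\<in>B. (\<kappa> x b \<oplus>\<^bsub>R\<^esub> \<kappa> y b) \<odot>\<^bsub>F\<^esub> b)" by (rule sym)
    show "\<kappa> x b \<oplus>\<^bsub>R\<^esub> \<kappa> y b \<in> carrier R" if "b \<in> B" for b using \<kappa>R[OF x that] \<kappa>R[OF y that] by simp
  qed
  have smult: "\<kappa> (a \<odot>\<^bsub>F\<^esub> x) b = a \<otimes>\<^bsub>R\<^esub> \<kappa> x b" if a: "a \<in> carrier R" and x: "x \<in> carrier F" and b: "b \<in> B" for a x b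
  proof (rule uniq[OF _ _ b])
    have "(\<Oplus>\<^bsub>F\<^esub>b\<in>B. (a \<otimes>\<^bsub>R\<^esub> \<kappa> x b) \<odot>\<^bsub>F\<^esub> b) = (\<Oplus>\<^bsub>F\<^esub>b\<in>B. a \<odot>\<^bsub>F\<^esub> (\<kappa> x b \<odot>\<^bsub>F\<^esub> b))"
      by (rule F.M.finsum_cong') (use \<kappa>R x a bF in \<open>auto simp: F.smult_assoc1\<close>)
    also have "\<dots> = a \<odot>\<^bsub>F\<^esub> (\<Oplus>\<^bsub>F\<^esub>b\<in>B. \<kappa> x b \<odot>\<^bsub>F\<^esub> b)"
      by (rule F.finsum_smult_ldistr[OF B(1) a summands[OF x], symmetric])
    also have "\<dots> = a \<odot>\<^bsub>F\<^esub> x" unfolding \<kappa>(2)[OF x] ..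
    finally show "a \<odot>\<^bsub>F\<^esub> x = (\<Oplus>\<^bsub>F\<^esub>b\<in>B. (a \<otimes>\<^bsub>R\<^esub> \<kappa> x b) \<odot>\<^bsub>F\<^esub> b)" by (rule sym)
    show "a \<otimes>\<^bsub>R\<^esub> \<kappa> x b \<in> carrier R" if "b \<in> B" for b using a \<kappa>R[OF x that] by simp
  qed
  have "x \<in> ideal_smult R J F \<longleftrightarrow> (\<forall>b\<in>B. \<kappa> x b \<in> J)" if J: "ideal J R" and x: "x \<in> carrier F" for J x
  proof
    note Jd = F.R.idealD[OF J]
    have "submodule {x \<in> carrier F. \<forall>b\<in>B. \<kappa> x b \<in> J} R F"
      unfolding F.submodule_iff
    proof (intro conjI ballI)
      have "\<kappa> \<zero>\<^bsub>F\<^esub> b = \<zero>\<^bsub>R\<^esub>" if "b \<in> B" for b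
        using smult[of "\<zero>\<^bsub>R\<^esub>" "\<zero>\<^bsub>F\<^esub>" b] that \<kappa>R[of "\<zero>\<^bsub>F\<^esub>" b] by simp
      then show "\<zero>\<^bsub>F\<^esub> \<in> {x \<in> carrier F. \<forall>b\<in>B. \<kappa> x b \<in> J}" using Jd(2) by simp
    qed (use add smult Jd in auto)
    then have "ideal_smult R J F \<subseteq> {x \<in> carrier F. \<forall>b\<in>B. \<kappa> x b \<in> J}"
      by (rule F.ideal_smult_min) (use smult Jd \<kappa>R in auto)
    then show "x \<in> ideal_smult R J F \<Longrightarrow> \<forall>b\<in>B. \<kappa> x b \<in> J" by blast
    assume "\<forall>b\<in>B. \<kappa> x b \<in> J"
    then have "(\<Oplus>\<^bsub>F\<^esub>b\<in>B. \<kappa> x b \<odot>\<^bsub>F\<^esub> b) \<in> ideal_smult R J F"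
      using bF by (intro F.finsum_in_submodule F.ideal_smult_submodule Jd(1) B(1) F.ideal_smultI) auto
    then show "x \<in> ideal_smult R J F" unfolding \<kappa>(2)[OF x] .
  qed
  then have "\<forall>J. ideal J R \<longrightarrow> (\<forall>x\<in>carrier F. x \<in> ideal_smult R J F \<longleftrightarrow> (\<forall>b\<in>B. \<kappa> x b \<in> J))"
    by blast
  moreover have "\<forall>x\<in>carrier F. \<forall>b\<in>B. \<kappa> x b \<in> carrier R" using \<kappa>R by blast
  moreover have "\<forall>a\<in>carrier R. \<forall>x\<in>carrier F. \<forall>b\<in>B. \<kappa> (a \<odot>\<^bsub>F\<^esub> x) b = a \<otimes>\<^bsub>R\<^esub> \<kappa> x b"
    using smult by blast
  ultimately show ?thesis by (intro exI[of _ B] exI[of _ \<kappa>] conjI)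
qed

context noetherian_local begin

text \<open>F / J F is a sum of copies of R / J, so regularity is checked on each
  coordinate.\<close>

lemma regular_on_free:
  fixes F :: "('a, 'f, 'm) module_scheme"
  assumes F: "finite_free_module R F" and J: "ideal J R"
    and a: "a \<in> carrier R" "regular_on (ring_as_module R) J a"
  shows "regular_on F (ideal_smult R J F) a"
proof -
  interpret F: module R F using F by (simp add: finite_free_module_def)
  obtain B :: "'f set" and \<kappa> where "\<forall>x\<in>carrier F. \<forall>b\<in>B. \<kappa> x b \<in> carrier R"
    "\<forall>a\<in>carrier R. \<forall>x\<in>carrier F. \<forall>b\<in>B. \<kappa> (a \<odot>\<^bsub>F\<^esub> x) b = a \<otimes> \<kappa> x b"
    "\<forall>J. ideal J R \<longrightarrow> (\<forall>x\<in>carrier F. x \<in> ideal_smult R J F \<longleftrightarrow> (\<forall>b\<in>B. \<kappa> x b \<in> J))"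
    using finite_free_coordinates[OF F] by (elim exE conjE)
  note \<kappa> = this[rule_format]
  show ?thesis
    unfolding regular_on_def
  proof (intro ballI impI)
    fix x assume x: "x \<in> carrier F" "a \<odot>\<^bsub>F\<^esub> x \<in> ideal_smult R J F"
    have "\<kappa> x b \<in> J" if b: "b \<in> B" for b
    proof -
      have "a \<odot>\<^bsub>F\<^esub> x \<in> carrier F" using a(1) x(1) by simp
      then have "\<kappa> (a \<odot>\<^bsub>F\<^esub> x) b \<in> J" using \<kappa>(3)[OF J] x(2) b by blast
      then show ?thesis using \<kappa>(1)[OF x(1) b] \<kappa>(2)[OF a(1) x(1) b] a(2) by (simp add: regular_on_def)
    qed
    then show "x \<in> ideal_smult R J F" using \<kappa>(3)[OF J x(1)] by blast
  qed
qed

text \<open>The summand \<open>\<xi>\<close> already lies in Q F, so \<open>a u\<close> does too. A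
  coordinate of \<open>u\<close> outside \<open>\<mm>\<close> would be a unit and would put
  \<open>a\<close> into \<open>Q\<close>.\<close>

lemma free_cancel_max_square:
  fixes F :: "('a, 'f, 'm) module_scheme"
  assumes F: "finite_free_module R F" and J: "ideal J R" "J \<subseteq> Q"
    and Q: "ideal Q R" and a: "a \<in> carrier R" "a \<notin> Q"
    and u: "u \<in> carrier F" "\<xi> \<in> ideal_smult R J F" "\<xi> \<oplus>\<^bsub>F\<^esub> a \<odot>\<^bsub>F\<^esub> u \<in> ideal_smult R Q F"
  shows "u \<in> ideal_smult R \<mm> F"
proof -
  interpret F: module R F using F by (simp add: finite_free_module_def)
  obtain B :: "'f set" and \<kappa> where "\<forall>x\<in>carrier F. \<forall>b\<in>B. \<kappa> x b \<in> carrier R"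
    "\<forall>a\<in>carrier R. \<forall>x\<in>carrier F. \<forall>b\<in>B. \<kappa> (a \<odot>\<^bsub>F\<^esub> x) b = a \<otimes> \<kappa> x b"
    "\<forall>J. ideal J R \<longrightarrow> (\<forall>x\<in>carrier F. x \<in> ideal_smult R J F \<longleftrightarrow> (\<forall>b\<in>B. \<kappa> x b \<in> J))"
    using finite_free_coordinates[OF F] by (elim exE conjE)
  note \<kappa> = this[rule_format]
  have sQ: "submodule (ideal_smult R Q F) R F" by (rule F.ideal_smult_submodule[OF idealD(1)[OF Q]])
  have \<xi>: "\<xi> \<in> ideal_smult R Q F" using F.ideal_smult_mono[OF J(2)] u(2) by blast
  have au: "a \<odot>\<^bsub>F\<^esub> u \<in> carrier F" using a(1) u(1) by simp
  have "a \<odot>\<^bsub>F\<^esub> u \<oplus>\<^bsub>F\<^esub> \<xi> \<in> ideal_smult R Q F"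
    using u(3) F.M.a_comm[OF au F.submoduleD(7)[OF sQ \<xi>]] by simp
  then have auQ: "a \<odot>\<^bsub>F\<^esub> u \<in> ideal_smult R Q F" using F.submodule_diff_iff[OF sQ au \<xi>] by simp
  have "\<kappa> u b \<in> \<mm>" if b: "b \<in> B" for b
  proof (rule ccontr)
    assume "\<kappa> u b \<notin> \<mm>"
    then obtain r where r: "r \<in> carrier R" "r \<otimes> \<kappa> u b = \<one>" using inverse_notin_max_ideal[OF \<kappa>(1)[OF u(1) b]] by blast
    have "a \<otimes> \<kappa> u b \<in> Q" using \<kappa>(3)[OF Q au] auQ b \<kappa>(2)[OF a(1) u(1) b] by auto
    then have "r \<otimes> (a \<otimes> \<kappa> u b) \<in> Q" by (rule idealD(4)[OF Q r(1)])
    moreover have "r \<otimes> (a \<otimes> \<kappa> u b) = a \<otimes> (r \<otimes> \<kappa> u b)" using r(1) a(1) \<kappa>(1)[OF u(1) b] by (simp add: m_ac)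
    ultimately show False using r(2) a by simp
  qed
  then show ?thesis using \<kappa>(3)[OF ideal_max_ideal u(1)] by blast
qed

lemma smult_max_ideal_smult:
  assumes "module R F" and Q: "ideal Q R" and c: "c \<in> carrier R" "\<And>b. b \<in> \<mm> \<Longrightarrow> c \<otimes> b \<in> Q"
    and x: "x \<in> ideal_smult R \<mm> F"
  shows "c \<odot>\<^bsub>F\<^esub> x \<in> ideal_smult R Q F"
proof -
  interpret F: module R F by fact
  have "submodule {x \<in> carrier F. c \<odot>\<^bsub>F\<^esub> x \<in> ideal_smult R Q F} R F"
    by (rule submodule_hom_preimage[OF F.smult_hom[OF c(1)] F.module_axioms F.module_axioms
          F.ideal_smult_submodule[OF idealD(1)[OF Q]]])
  then have "ideal_smult R \<mm> F \<subseteq> {x \<in> carrier F. c \<odot>\<^bsub>F\<^esub> x \<in> ideal_smult R Q F}"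
  proof (rule F.ideal_smult_min)
    fix b y assume b: "b \<in> \<mm>" and y: "y \<in> carrier F"
    have "(c \<otimes> b) \<odot>\<^bsub>F\<^esub> y \<in> ideal_smult R Q F" using c(2)[OF b] y by (rule F.ideal_smultI)
    then show "b \<odot>\<^bsub>F\<^esub> y \<in> {x \<in> carrier F. c \<odot>\<^bsub>F\<^esub> x \<in> ideal_smult R Q F}"
      using c(1) max_idealD(8)[OF b] y by (simp add: F.smult_assoc1)
  qed
  then show ?thesis using x by blast
qed

lemma residue_field_smult_zero:
  assumes "a \<in> \<mm>" "x \<in> carrier (residue_field R)"
  shows "a \<odot>\<^bsub>residue_field R\<^esub> x = \<zero>\<^bsub>residue_field R\<^esub>"
proof -
  interpret m: ideal \<mm> R by (rule ideal_max_ideal)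
  interpret Q: cring "R Quot \<mm>" by (rule m.quotient_is_cring) (rule cring_axioms)
  have "\<mm> +> a = \<zero>\<^bsub>R Quot \<mm>\<^esub>" using m.a_rcos_const[OF assms(1)] by (simp add: FactRing_def)
  then show ?thesis using assms(2) by (simp add: residue_field_def ring.defs module.defs)
qed

end

locale minimal_resolution = noetherian_local R for R (structure) +
  fixes F :: "nat \<Rightarrow> ('a, 'f) module" and d :: "nat \<Rightarrow> 'f \<Rightarrow> 'f" and \<epsilon> :: "'f \<Rightarrow> 'a set"
  assumes minres: "minimal_free_resolution R (residue_field R) F d \<epsilon>"
begin

lemma free_F: "finite_free_module R (F i)" and hom_\<epsilon>: "\<epsilon> \<in> hom_module R (F 0) (residue_field R)"
  and hom_d: "d i \<in> hom_module R (F (Suc i)) (F i)"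
  and image_d0: "d 0 ` carrier (F 1) = module_ker (F 0) (residue_field R) \<epsilon>"
  and image_d: "d (Suc i) ` carrier (F (Suc (Suc i))) = module_ker (F (Suc i)) (F i) (d i)"
  and minimal: "d i ` carrier (F (Suc i)) \<subseteq> ideal_smult R \<mm> (F i)"
  using minres by (auto simp: minimal_free_resolution_def)

lemma module_F: "module R (F i)"
  using free_F by (simp add: finite_free_module_def)

sublocale F: module R "F i" for i by (rule module_F)

lemma module_k: "module R (residue_field R)"
  using noetherian_local_ring_iff[of R] noetherian_local_axioms by (intro residue_field_module) simp

lemmas d_hom = hom_moduleD[OF hom_d]
lemmas d_minus = hom_module_minus[OF hom_d module_F module_F]

lemma d_d: "x \<in> carrier (F (Suc (Suc i))) \<Longrightarrow> d i (d (Suc i) x) = \<zero>\<^bsub>F i\<^esub>"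
  using image_d[of i] by (auto simp: module_ker_def)

abbreviation "JF J i \<equiv> ideal_smult R J (F i)"

lemma JF_submodule: "ideal J R \<Longrightarrow> submodule (JF J i) R (F i)"
  by (rule F.ideal_smult_submodule) (rule idealD(1))

lemmas JFD = F.submoduleD[OF JF_submodule]

lemma d_JF: "ideal J R \<Longrightarrow> x \<in> JF J (Suc i) \<Longrightarrow> d i x \<in> JF J i"
  by (rule hom_ideal_smult[OF hom_d module_F module_F]) (auto dest: idealD(1))

text \<open>The augmentation kills \<mm> F 0, because \<open>\<mm>\<close> kills the residue field;
  exactness at \<open>F 0\<close> does the rest.\<close>

lemma max_ideal_boundary:
  assumes "z \<in> JF \<mm> 0" obtains w where "w \<in> carrier (F 1)" "z = d 0 w"
proof -
  interpret k: module R "residue_field R" by (rule module_k)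
  have "submodule {\<zero>\<^bsub>residue_field R\<^esub>} R (residue_field R)" by (rule k.zero_submodule)
  then have "ideal_smult R \<mm> (residue_field R) \<subseteq> {\<zero>\<^bsub>residue_field R\<^esub>}"
    by (rule k.ideal_smult_min) (simp add: residue_field_smult_zero)
  moreover have "\<epsilon> z \<in> ideal_smult R \<mm> (residue_field R)"
    by (rule hom_ideal_smult[OF hom_\<epsilon> module_F module_k max_idealD(1) assms])
  ultimately have "z \<in> module_ker (F 0) (residue_field R) \<epsilon>"
    using JFD(7)[OF ideal_max_ideal assms] by (auto simp: module_ker_def)
  then show thesis using image_d0 that by blast
qed

text \<open>The map from \<open>Tor (R / J, k)\<close> to \<open>Tor (k, k)\<close> is injective. For the induction step, the cycle \<open>u\<close> with
  \<open>d z = \<xi> + a u\<close> again lies in \<open>\<mm> F\<close>, since \<open>d z\<close> lies in \<open>\<mm>\<^sup>2 F\<close> and \<open>a\<close> is not in \<open>J + \<mm>\<^sup>2\<close>.\<close>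

lemma max_ideal_cycle_boundary:
  assumes "regular_ideal R N j J" "z \<in> JF \<mm> (Suc n)" "d n z \<in> JF J n"
  shows "\<exists>w\<in>carrier (F (Suc (Suc n))). \<exists>\<xi>\<in>JF J (Suc n). z = d (Suc n) w \<oplus>\<^bsub>F (Suc n)\<^esub> \<xi>"
  using assms
proof (induction arbitrary: n z rule: regular_ideal.induct)
  case zero
  have zF: "z \<in> carrier (F (Suc n))" using JFD(7)[OF ideal_max_ideal zero(1)] .
  have "d n z = \<zero>\<^bsub>F n\<^esub>" using zero(2) F.ideal_smult_zero by simp
  then have "z \<in> module_ker (F (Suc n)) (F n) (d n)" using zF by (simp add: module_ker_def)
  then obtain w where w: "w \<in> carrier (F (Suc (Suc n)))" "z = d (Suc n) w" using image_d[of n] by blast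
  then have "z = d (Suc n) w \<oplus>\<^bsub>F (Suc n)\<^esub> \<zero>\<^bsub>F (Suc n)\<^esub>" using zF by simp
  moreover have "\<zero>\<^bsub>F (Suc n)\<^esub> \<in> JF {\<zero>} (Suc n)" using F.ideal_smult_zero by simp
  ultimately show ?case using w(1) by blast
next
  case (step j J a)
  note J = regular_ideal[OF step.hyps(1)]
  note aR = max_idealD(8)[OF step.hyps(2)]
  define Q where "Q = add_max_square R J"
  have JR: "J \<subseteq> carrier R" by (rule idealD(1)[OF J(1)])
  have Q: "ideal Q R" "J \<subseteq> Q" "\<And>x y. x \<in> \<mm> \<Longrightarrow> y \<in> \<mm> \<Longrightarrow> x \<otimes> y \<in> Q"
    unfolding Q_def using add_max_square[OF JR] by blast+
  note JF = JFD[OF J(1)] and mF = JFD[OF ideal_max_ideal]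
  have zF: "z \<in> carrier (F (Suc n))" using mF(7) step.prems(1) .
  obtain \<xi> u where u: "\<xi> \<in> JF J n" "u \<in> carrier (F n)" "d n z = \<xi> \<oplus>\<^bsub>F n\<^esub> a \<odot>\<^bsub>F n\<^esub> u"
    using step.prems(2) by (rule F.ideal_smult_adjoinE[OF J(1) aR])
  have \<xi>F: "\<xi> \<in> carrier (F n)" using JF(7) u(1) .
  have auF: "a \<odot>\<^bsub>F n\<^esub> u \<in> carrier (F n)" using aR u(2) by simp
  have "submodule {x \<in> carrier (F (Suc n)). d n x \<in> JF Q n} R (F (Suc n))"
    by (rule submodule_hom_preimage[OF hom_d module_F module_F JF_submodule[OF Q(1)]])
  \<comment> \<open>By minimality \<open>d\<close> maps \<mm> F into \<mm>^2 F, which is contained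
    in Q F.\<close>
  then have "JF \<mm> (Suc n) \<subseteq> {x \<in> carrier (F (Suc n)). d n x \<in> JF Q n}"
  proof (rule F.ideal_smult_min)
    fix c x assume c: "c \<in> \<mm>" and x: "x \<in> carrier (F (Suc n))"
    have cR: "c \<in> carrier R" using max_idealD(8)[OF c] .
    have "d n x \<in> JF \<mm> n" using minimal x by blast
    then have "c \<odot>\<^bsub>F n\<^esub> d n x \<in> JF Q n" using Q(3)[OF c] by (intro smult_max_ideal_smult[OF module_F Q(1) cR])
    then show "c \<odot>\<^bsub>F (Suc n)\<^esub> x \<in> {x \<in> carrier (F (Suc n)). d n x \<in> JF Q n}"
      using cR x d_hom(3)[OF cR x] by simp
  qed
  then have "\<xi> \<oplus>\<^bsub>F n\<^esub> a \<odot>\<^bsub>F n\<^esub> u \<in> JF Q n" using step.prems(1) u(3) by auto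
  then have um: "u \<in> JF \<mm> n"
    using step.hyps(3) by (intro free_cancel_max_square[OF free_F J(1) Q(2,1) aR _ u(2,1)]) (simp_all add: Q_def)
  \<comment> \<open>So \<open>u\<close> is a boundary modulo J F. In degree 0 this holds for all of
    \<mm> F 0; in higher degrees \<open>d d z = 0\<close> puts \<open>a d u\<close> into J F,
    regularity of \<open>a\<close> puts \<open>d u\<close> there, and the induction hypothesis
    applies to \<open>u\<close>.\<close>
  have "\<exists>w\<in>carrier (F (Suc n)). \<exists>\<zeta>\<in>JF J n. u = d n w \<oplus>\<^bsub>F n\<^esub> \<zeta>"
  proof (cases n)
    case 0
    then obtain w where w: "w \<in> carrier (F 1)" "u = d 0 w" using max_ideal_boundary um by blast
    have "\<zero>\<^bsub>F n\<^esub> \<in> JF J n" by (rule JF(2))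
    moreover have "u = d n w \<oplus>\<^bsub>F n\<^esub> \<zero>\<^bsub>F n\<^esub>" using w u(2) 0 by simp
    moreover have "w \<in> carrier (F (Suc n))" using w(1) 0 by simp
    ultimately show ?thesis by blast
  next
    case (Suc m)
    have uF: "u \<in> carrier (F (Suc m))" using u(2) Suc by simp
    have "\<zero>\<^bsub>F m\<^esub> = d m (d n z)" using d_d[of z m] zF Suc by simp
    also have "\<dots> = d m \<xi> \<oplus>\<^bsub>F m\<^esub> a \<odot>\<^bsub>F m\<^esub> d m u"
      using u(3) d_hom(2)[OF \<xi>F[unfolded Suc] auF[unfolded Suc]] d_hom(3)[OF aR uF] Suc by simp
    finally have eq: "d m \<xi> \<oplus>\<^bsub>F m\<^esub> a \<odot>\<^bsub>F m\<^esub> d m u = \<zero>\<^bsub>F m\<^esub>" by simp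
    have d\<xi>: "d m \<xi> \<in> JF J m" using d_JF[OF J(1)] u(1) Suc by simp
    have du: "d m u \<in> carrier (F m)" using d_hom(1)[OF uF] .
    have adu: "a \<odot>\<^bsub>F m\<^esub> d m u \<in> carrier (F m)" using aR du by simp
    have "a \<odot>\<^bsub>F m\<^esub> d m u \<oplus>\<^bsub>F m\<^esub> d m \<xi> \<in> JF J m"
      using eq JF(2)[of m] F.M.a_comm[OF adu JF(7)[OF d\<xi>]] by simp
    then have "a \<odot>\<^bsub>F m\<^esub> d m u \<in> JF J m"
      using F.submodule_diff_iff[OF JF_submodule[OF J(1)] adu d\<xi>] by simp
    then have "d m u \<in> JF J m"
      using regular_on_free[OF free_F J(1) aR step.hyps(4), of m] du by (simp add: regular_on_def)
    then show ?thesis using step.IH[of u m] um Suc by simp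
  qed
  then obtain w \<zeta> where w: "w \<in> carrier (F (Suc n))" "\<zeta> \<in> JF J n" "u = d n w \<oplus>\<^bsub>F n\<^esub> \<zeta>" by blast
  have awF: "a \<odot>\<^bsub>F (Suc n)\<^esub> w \<in> carrier (F (Suc n))" using aR w(1) by simp
  have \<zeta>F: "\<zeta> \<in> carrier (F n)" using JF(7) w(2) .
  have dw: "d n w \<in> carrier (F n)" using d_hom(1)[OF w(1)] .
  \<comment> \<open>Subtracting \<open>a w\<close> changes nothing modulo J + R a and brings the
    differential into J F, so the induction hypothesis applies a second time.\<close>
  let ?z = "z \<ominus>\<^bsub>F (Suc n)\<^esub> a \<odot>\<^bsub>F (Suc n)\<^esub> w"
  have "?z \<in> JF \<mm> (Suc n)"
    using mF(6)[OF step.prems(1)] F.ideal_smultI[OF step.hyps(2) w(1)] by blast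
  moreover have "d n ?z = \<xi> \<oplus>\<^bsub>F n\<^esub> a \<odot>\<^bsub>F n\<^esub> \<zeta>"
  proof -
    have "d n ?z = (\<xi> \<oplus>\<^bsub>F n\<^esub> a \<odot>\<^bsub>F n\<^esub> u) \<ominus>\<^bsub>F n\<^esub> a \<odot>\<^bsub>F n\<^esub> d n w"
      using d_minus[OF zF awF] d_hom(3)[OF aR w(1)] u(3) by simp
    also have "\<dots> = \<xi> \<oplus>\<^bsub>F n\<^esub> a \<odot>\<^bsub>F n\<^esub> \<zeta>"
      using w(3) aR \<xi>F \<zeta>F dw by (simp add: F.smult_r_distr a_minus_def F.M.a_ac F.M.r_neg F.M.r_neg1)
    finally show ?thesis .
  qed
  then have "d n ?z \<in> JF J n" using JF(3)[OF u(1) JF(4)[OF aR w(2)]] by simp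
  ultimately obtain w' \<xi>' where w': "w' \<in> carrier (F (Suc (Suc n)))" "\<xi>' \<in> JF J (Suc n)"
    "?z = d (Suc n) w' \<oplus>\<^bsub>F (Suc n)\<^esub> \<xi>'" using step.IH[of ?z n] by blast
  have \<xi>'F: "\<xi>' \<in> carrier (F (Suc n))" using JF(7) w'(2) .
  have "z = ?z \<oplus>\<^bsub>F (Suc n)\<^esub> a \<odot>\<^bsub>F (Suc n)\<^esub> w" using F.add_minus_cancel[OF zF awF] by simp
  also have "\<dots> = d (Suc n) w' \<oplus>\<^bsub>F (Suc n)\<^esub> (\<xi>' \<oplus>\<^bsub>F (Suc n)\<^esub> a \<odot>\<^bsub>F (Suc n)\<^esub> w)"
    using w'(3) d_hom(1)[OF w'(1)] \<xi>'F awF by (simp add: F.M.a_assoc)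
  finally have "z = d (Suc n) w' \<oplus>\<^bsub>F (Suc n)\<^esub> (\<xi>' \<oplus>\<^bsub>F (Suc n)\<^esub> a \<odot>\<^bsub>F (Suc n)\<^esub> w)" .
  moreover have "\<xi>' \<oplus>\<^bsub>F (Suc n)\<^esub> a \<odot>\<^bsub>F (Suc n)\<^esub> w \<in> JF (adjoin R J a) (Suc n)"
    using w'(2) w(1) by (rule F.smult_in_ideal_smult_adjoin[OF J(1) aR])
  ultimately show ?case using w'(1) by blast
qed

text \<open>Write an element of a positive syzygy as \<open>d c\<close>. Then \<open>s c\<close>
  lies in \<mm> F and \<open>d (s c) = s (d c)\<close> in J F, since \<open>d c\<close> lies in
  \<mm> F. So \<open>s c = d w + \<xi>\<close> with \<open>\<xi>\<close> in J F, and
  \<open>s (d c) = d \<xi>\<close>. The residue field itself is killed by \<open>s\<close>.\<close>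

lemma syzygy_smult_socle:
  fixes N :: "('a, 'x, 'n) module_scheme"
  assumes syz: "is_syzygy R (residue_field R) F d n N"
    and ri: "regular_ideal R N' j J" and s: "s \<in> \<mm>" "\<And>b. b \<in> \<mm> \<Longrightarrow> s \<otimes> b \<in> J"
    and x: "x \<in> carrier N"
  shows "s \<odot>\<^bsub>N\<^esub> x \<in> ideal_smult R J N"
proof -
  note J = regular_ideal(1)[OF ri]
  have JR: "J \<subseteq> carrier R" by (rule idealD(1)[OF J])
  interpret N: module R N using syz by (simp add: is_syzygy_def)
  have sR: "s \<in> carrier R" using max_idealD(8)[OF s(1)] .
  note JN = N.submoduleD[OF N.ideal_smult_submodule[OF JR]]
  show ?thesis
  proof (cases n)
    case 0
    then obtain f where f: "f \<in> hom_module R N (residue_field R)" "bij_betw f (carrier N) (carrier (residue_field R))"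
      using syz by (auto simp: is_syzygy_def module_isomorphic_def)
    have "f (s \<odot>\<^bsub>N\<^esub> x) = \<zero>\<^bsub>residue_field R\<^esub>"
      using hom_moduleD(1,3)[OF f(1)] sR x residue_field_smult_zero[OF s(1)] by simp
    also have "\<dots> = f \<zero>\<^bsub>N\<^esub>" using hom_module_zero[OF f(1) N.module_axioms module_k] by simp
    finally have "s \<odot>\<^bsub>N\<^esub> x = \<zero>\<^bsub>N\<^esub>" using f(2) sR x by (auto simp: bij_betw_def inj_on_def)
    then show ?thesis using JN(2) by simp
  next
    case (Suc i)
    let ?Z = "F i\<lparr>carrier := d i ` carrier (F (Suc i))\<rparr>"
    obtain f where f: "f \<in> hom_module R N ?Z" "bij_betw f (carrier N) (carrier ?Z)"
      using syz Suc by (auto simp: is_syzygy_def module_isomorphic_def)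
    have sZ: "submodule (d i ` carrier (F (Suc i))) R (F i)"
      by (rule submodule_hom_image[OF hom_d module_F module_F F.carrier_is_submodule])
    have modZ: "module R ?Z" by (rule submodule.submodule_is_module[OF sZ module_F])
    have d_Z: "d i \<in> hom_module R (F (Suc i)) ?Z" using d_hom by (auto simp: hom_module_def)
    have "f x \<in> carrier ?Z" using hom_moduleD(1)[OF f(1) x] .
    then obtain c where c: "c \<in> carrier (F (Suc i))" "f x = d i c" by auto
    have sc: "s \<odot>\<^bsub>F (Suc i)\<^esub> c \<in> JF \<mm> (Suc i)" using s(1) c(1) by (rule F.ideal_smultI)
    have "d i c \<in> JF \<mm> i" using minimal c(1) by blast
    then have "s \<odot>\<^bsub>F i\<^esub> d i c \<in> JF J i"
      using s(2) by (intro smult_max_ideal_smult[OF module_F J sR])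
    then have "d i (s \<odot>\<^bsub>F (Suc i)\<^esub> c) \<in> JF J i" using d_hom(3)[OF sR c(1)] by simp
    then obtain w \<xi> where w: "w \<in> carrier (F (Suc (Suc i)))" "\<xi> \<in> JF J (Suc i)"
      "s \<odot>\<^bsub>F (Suc i)\<^esub> c = d (Suc i) w \<oplus>\<^bsub>F (Suc i)\<^esub> \<xi>"
      using max_ideal_cycle_boundary[OF ri sc] by blast
    have \<xi>F: "\<xi> \<in> carrier (F (Suc i))" using JFD(7)[OF J w(2)] .
    have "d i (s \<odot>\<^bsub>F (Suc i)\<^esub> c) = d i (d (Suc i) w) \<oplus>\<^bsub>F i\<^esub> d i \<xi>"
      using d_hom(2)[OF d_hom(1)[OF w(1)] \<xi>F] w(3) by simp
    then have "d i (s \<odot>\<^bsub>F (Suc i)\<^esub> c) = d i \<xi>" using d_d[OF w(1)] d_hom(1)[OF \<xi>F] by simp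
    then have "f (s \<odot>\<^bsub>N\<^esub> x) = d i \<xi>" using hom_moduleD(3)[OF f(1) sR x] c(2) d_hom(3)[OF sR c(1)] by simp
    \<comment> \<open>This is membership in J times the syzygy, which is stronger than membership in
      J F; it is the reason for replacing \<open>s c\<close> by \<open>\<xi>\<close>.\<close>
    moreover have "d i \<xi> \<in> ideal_smult R J ?Z" by (rule hom_ideal_smult[OF d_Z module_F modZ JR w(2)])
    ultimately have fs: "f (s \<odot>\<^bsub>N\<^esub> x) \<in> ideal_smult R J ?Z" by simp
    \<comment> \<open>The syzygy is only given up to isomorphism, so the result is carried back
      along the inverse of \<open>f\<close>.\<close>
    define g where "g = inv_into (carrier N) f"
    have fg: "f (g z) = z" and gN: "g z \<in> carrier N" if "z \<in> carrier ?Z" for z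
      using f(2) that bij_betw_inv_into_right[OF f(2) that] bij_betw_apply[OF bij_betw_inv_into[OF f(2)] that]
      by (auto simp: g_def)
    have gf: "g (f y) = y" if "y \<in> carrier N" for y using bij_betw_inv_into_left[OF f(2) that] by (simp add: g_def)
    have "g \<in> hom_module R ?Z N"
      unfolding hom_module_def
    proof (intro CollectI conjI ballI Pi_I)
      fix y assume y: "y \<in> carrier ?Z"
      show "g y \<in> carrier N" using gN[OF y] .
      show "g (b \<odot>\<^bsub>?Z\<^esub> y) = b \<odot>\<^bsub>N\<^esub> g y" if b: "b \<in> carrier R" for b
        using hom_moduleD(3)[OF f(1) b gN[OF y]] fg[OF y] gf[of "b \<odot>\<^bsub>N\<^esub> g y"] b gN[OF y] by simp
      fix z assume z: "z \<in> carrier ?Z"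
      show "g (y \<oplus>\<^bsub>?Z\<^esub> z) = g y \<oplus>\<^bsub>N\<^esub> g z"
        using hom_moduleD(2)[OF f(1) gN[OF y] gN[OF z]] fg[OF y] fg[OF z] gf[of "g y \<oplus>\<^bsub>N\<^esub> g z"] gN[OF y] gN[OF z] by simp
    qed
    then have "g (f (s \<odot>\<^bsub>N\<^esub> x)) \<in> ideal_smult R J N"
      by (rule hom_ideal_smult[OF _ modZ N.module_axioms JR fs])
    then show ?thesis using gf sR x by simp
  qed
qed

end

section \<open>Transfer along the surjection and conclusion\<close>

text \<open>Homomorphisms respect multiples by \<open>J\<close>, so the inclusion of each summand
  followed by \<open>\<phi>\<close> carries \<open>sM\<close> over to \<open>L\<close>; a general
  element is treated by induction on its support.\<close>

lemma direct_sum_hom_ideal_smult: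
  fixes M :: "'i \<Rightarrow> ('a, 'x, 'm) module_scheme" and L :: "('a, 'l, 'n) module_scheme"
  assumes "finite T" and M: "\<And>i. i \<in> T \<Longrightarrow> module R (M i)" and L: "module R L"
    and \<phi>: "\<phi> \<in> hom_module R (direct_sum T M) L" and J: "J \<subseteq> carrier R" and s: "s \<in> carrier R"
    and sM: "\<And>i x. i \<in> T \<Longrightarrow> x \<in> carrier (M i) \<Longrightarrow> s \<odot>\<^bsub>M i\<^esub> x \<in> ideal_smult R J (M i)"
    and f: "f \<in> carrier (direct_sum T M)"
  shows "s \<odot>\<^bsub>L\<^esub> \<phi> f \<in> ideal_smult R J L"
proof -
  interpret L: module R L by fact
  note cring = L.R.cring_axioms
  have D: "module R (direct_sum T M)" by (rule direct_sum_module[OF cring M])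
  note JL = L.submoduleD[OF L.ideal_smult_submodule[OF J]]
  note car = direct_sum_carrier[OF assms(1) M]
  note \<phi>h = hom_moduleD[OF \<phi>]
  have zero_M: "\<zero>\<^bsub>M i\<^esub> \<in> carrier (M i)" "\<And>x. x \<in> carrier (M i) \<Longrightarrow> x \<oplus>\<^bsub>M i\<^esub> \<zero>\<^bsub>M i\<^esub> = x"
    "\<And>x. x \<in> carrier (M i) \<Longrightarrow> \<zero>\<^bsub>M i\<^esub> \<oplus>\<^bsub>M i\<^esub> x = x" "\<And>a. a \<in> carrier R \<Longrightarrow> a \<odot>\<^bsub>M i\<^esub> \<zero>\<^bsub>M i\<^esub> = \<zero>\<^bsub>M i\<^esub>" if "i \<in> T" for i
  proof -
    interpret module R "M i" by (rule M[OF that])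
    show "\<zero>\<^bsub>M i\<^esub> \<in> carrier (M i)" "\<And>x. x \<in> carrier (M i) \<Longrightarrow> x \<oplus>\<^bsub>M i\<^esub> \<zero>\<^bsub>M i\<^esub> = x"
    "\<And>x. x \<in> carrier (M i) \<Longrightarrow> \<zero>\<^bsub>M i\<^esub> \<oplus>\<^bsub>M i\<^esub> x = x" "\<And>a. a \<in> carrier R \<Longrightarrow> a \<odot>\<^bsub>M i\<^esub> \<zero>\<^bsub>M i\<^esub> = \<zero>\<^bsub>M i\<^esub>" by simp_all
  qed
  define sng where "sng t x = (\<lambda>i\<in>T. if i = t then x else \<zero>\<^bsub>M i\<^esub>)" for t and x
  have sng_hom: "sng t \<in> hom_module R (M t) (direct_sum T M)" if t: "t \<in> T" for t
    unfolding hom_module_def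
    by (auto simp: sng_def car direct_sum_simps zero_M intro!: restrict_ext)
  have single: "s \<odot>\<^bsub>L\<^esub> \<phi> (sng t x) \<in> ideal_smult R J L" if t: "t \<in> T" and x: "x \<in> carrier (M t)" for t x
  proof -
    note sh = hom_moduleD[OF sng_hom[OF t]]
    have "\<phi> (sng t (s \<odot>\<^bsub>M t\<^esub> x)) \<in> ideal_smult R J L"
      using sM[OF t x]
      by (intro hom_ideal_smult[OF \<phi> D L J] hom_ideal_smult[OF sng_hom[OF t] M[OF t] D J])
    then show ?thesis using sh(3)[OF s x] \<phi>h(3)[OF s sh(1)[OF x]] by simp
  qed
  have "s \<odot>\<^bsub>L\<^esub> \<phi> f \<in> ideal_smult R J L"
    if "finite U" "U \<subseteq> T" "f \<in> carrier (direct_sum T M)" "\<And>i. i \<in> T - U \<Longrightarrow> f i = \<zero>\<^bsub>M i\<^esub>" for U f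
    using that
  proof (induction U arbitrary: f)
    case empty
    have "f = \<zero>\<^bsub>direct_sum T M\<^esub>"
      using empty by (auto simp: car direct_sum_simps PiE_iff extensional_def fun_eq_iff)
    then show ?case using hom_module_zero[OF \<phi> D L] s JL(2) by simp
  next
    case (insert t U)
    have t: "t \<in> T" using insert.prems(1) by simp
    have ft: "f i \<in> carrier (M i)" if "i \<in> T" for i using insert.prems(2) that by (auto simp: car PiE_iff)
    define f' where "f' = (\<lambda>i\<in>T. if i = t then \<zero>\<^bsub>M i\<^esub> else f i)"
    have f': "f' \<in> carrier (direct_sum T M)" using ft zero_M(1) by (auto simp: f'_def car)
    have "f = f' \<oplus>\<^bsub>direct_sum T M\<^esub> sng t (f t)"
      using insert.prems(2) ft zero_M
      by (auto simp: car direct_sum_simps f'_def sng_def PiE_iff extensional_def fun_eq_iff)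
    moreover have sf: "sng t (f t) \<in> carrier (direct_sum T M)" using hom_moduleD(1)[OF sng_hom[OF t] ft[OF t]] .
    ultimately have "s \<odot>\<^bsub>L\<^esub> \<phi> f = s \<odot>\<^bsub>L\<^esub> \<phi> f' \<oplus>\<^bsub>L\<^esub> s \<odot>\<^bsub>L\<^esub> \<phi> (sng t (f t))"
      using \<phi>h(2)[OF f' sf] \<phi>h(1)[OF f'] \<phi>h(1)[OF sf] s by (simp add: L.smult_r_distr)
    moreover have "s \<odot>\<^bsub>L\<^esub> \<phi> f' \<in> ideal_smult R J L"
      using insert.prems by (intro insert.IH f') (auto simp: f'_def)
    ultimately show ?case using JL(3) single[OF t ft[OF t]] by simp
  qed
  from this[OF assms(1) subset_refl f] show ?thesis by simp
qed

theorem theorem1p4p9: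
  fixes A :: "('a, 'r) ring_scheme"
    and F :: "nat \<Rightarrow> ('a, 'f) module" and d :: "nat \<Rightarrow> 'f \<Rightarrow> 'f" and \<epsilon> :: "'f \<Rightarrow> 'a set"
    and \<Omega> :: "nat \<Rightarrow> ('a, 'x) module"
    and \<Lambda> :: "nat set" and j :: "nat \<Rightarrow> nat"
    and L :: "('a, 'l) module"
    and \<phi> :: "(nat \<times> nat \<Rightarrow> 'x) \<Rightarrow> 'l"
  assumes "noetherian_local_ring A"
    and "minimal_free_resolution A (residue_field A) F d \<epsilon>"
    and "finite \<Lambda>" and "\<And>n. n \<in> \<Lambda> \<Longrightarrow> 1 \<le> j n"
    and "\<And>n. n \<in> \<Lambda> \<Longrightarrow> is_syzygy A (residue_field A) F d n (\<Omega> n)"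
    and "maximal_cohen_macaulay A L" and "carrier L \<noteq> {\<zero>\<^bsub>L\<^esub>}"
    and "finite_injective_dimension TYPE('e) A L"
    and "\<phi> \<in> hom_module A (direct_sum (SIGMA n:\<Lambda>. {..<j n}) (\<lambda>(n, i). \<Omega> n)) L"
    and "\<phi> ` carrier (direct_sum (SIGMA n:\<Lambda>. {..<j n}) (\<lambda>(n, i). \<Omega> n)) = carrier L"
  shows "regular_local_ring A"
proof -
  interpret noetherian_local A using assms(1) noetherian_local_ring_iff by blast
  interpret mr: minimal_resolution A F d \<epsilon> by unfold_locales (rule assms(2))
  have fg: "finitely_generated_module A L" using assms(6) by (simp add: maximal_cohen_macaulay_def)
  then have L: "module A L" by (simp add: finitely_generated_module_def)
  obtain n and I :: "nat \<Rightarrow> ('a, 'e) module" and \<delta> \<eta>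
    where I: "injective_resolution A L I \<delta> \<eta>" "\<forall>i>n. carrier (I i) = {\<zero>\<^bsub>I i\<^esub>}"
    using assms(8) unfolding finite_injective_dimension_def by (elim exE conjE)
  have "injective_resolution_of A L I \<delta> \<eta>"
    by (rule injective_resolution_of.intro[OF noetherian_local_axioms injective_resolution_of_axioms.intro[OF I(1) L]])
  note faithful = injective_resolution_of.socle_element_faithful[OF this]
  let ?T = "SIGMA n:\<Lambda>. {..<j n}" and ?M = "\<lambda>(n, i :: nat). \<Omega> n"
  show ?thesis
  proof (rule regular_if_no_socle[OF assms(6,7)])
    fix k J s
    assume ri: "regular_ideal A L k J" and "J \<noteq> \<mm>" and s: "s \<in> carrier A - J"
    note J = regular_ideal[OF ri]
    show "colon A (ring_as_module A) J s \<noteq> \<mm>"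
    proof
      assume eq: "colon A (ring_as_module A) J s = \<mm>"
      have sA: "s \<in> carrier A" using s by blast
      have bs: "b \<otimes>\<^bsub>A\<^esub> s \<in> J" if "b \<in> \<mm>" for b using that unfolding eq[symmetric] by (simp add: colon_def)
      \<comment> \<open>If \<open>s\<close> were a unit, \<mm> s inside \<open>J\<close> would give
        \<open>\<mm> = J\<close>, which is excluded.\<close>
      have sm: "s \<in> \<mm>"
      proof (rule ccontr)
        assume "s \<notin> \<mm>"
        then obtain r where r: "r \<in> carrier A" "r \<otimes>\<^bsub>A\<^esub> s = \<one>\<^bsub>A\<^esub>" using inverse_notin_max_ideal[OF sA] by blast
        have "b \<in> J" if b: "b \<in> \<mm>" for b
        proof -
          have bA: "b \<in> carrier A" using max_idealD(8)[OF b] .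
          have "r \<otimes>\<^bsub>A\<^esub> (b \<otimes>\<^bsub>A\<^esub> s) \<in> J" using idealD(4)[OF J(1) r(1) bs[OF b]] .
          moreover have "r \<otimes>\<^bsub>A\<^esub> (b \<otimes>\<^bsub>A\<^esub> s) = b \<otimes>\<^bsub>A\<^esub> (r \<otimes>\<^bsub>A\<^esub> s)" using r(1) bA sA by (simp add: m_ac)
          ultimately show ?thesis using r(2) bA by simp
        qed
        then show False using J(2) \<open>J \<noteq> \<mm>\<close> by blast
      qed
      have sb: "s \<otimes>\<^bsub>A\<^esub> b \<in> J" if "b \<in> \<mm>" for b
        using bs[OF that] m_comm[OF sA max_idealD(8)[OF that]] by simp
      have M: "module A (?M p)" if p: "p \<in> ?T" for p
      proof -
        obtain m i where m: "p = (m, i)" "m \<in> \<Lambda>" using p by blast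
        show ?thesis using assms(5)[OF m(2)] m(1) by (simp add: is_syzygy_def)
      qed
      have sM: "s \<odot>\<^bsub>?M p\<^esub> x \<in> ideal_smult A J (?M p)" if p: "p \<in> ?T" and x: "x \<in> carrier (?M p)" for p x
      proof -
        obtain m i where m: "p = (m, i)" "m \<in> \<Lambda>" using p by blast
        show ?thesis using mr.syzygy_smult_socle[OF assms(5)[OF m(2)] ri sm sb, of x] x m(1) by simp
      qed
      have finT: "finite ?T" using assms(3) by simp
      have "s \<odot>\<^bsub>L\<^esub> l \<in> ideal_smult A J L" if l: "l \<in> carrier L" for l
      proof -
        have "l \<in> \<phi> ` carrier (direct_sum ?T ?M)" using l unfolding assms(10) .
        then obtain f where f: "l = \<phi> f" "f \<in> carrier (direct_sum ?T ?M)" by (rule imageE)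
        show ?thesis
          unfolding f(1)
        proof (rule direct_sum_hom_ideal_smult[OF finT _ L assms(9) idealD(1)[OF J(1)] sA _ f(2)])
          show "module A (?M p)" if "p \<in> ?T" for p using that by (rule M)
          show "s \<odot>\<^bsub>?M p\<^esub> x \<in> ideal_smult A J (?M p)" if "p \<in> ?T" "x \<in> carrier (?M p)" for p x
            using that by (rule sM)
        qed
      qed
      then have "ideal_smult A J L = carrier L" by (rule faithful[OF fg I(2) ri sA eq])
      then show False using ideal_smult_neq_carrier[OF fg assms(7) J(2)] by simp
    qed
  qed
qed

end
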